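(* The topos points (up to isomorphism) of $\bar{\mathrm{P}}^{\mathrm{ns}}(\mathbb{Z})\text{-}\mathsf{Set}$ are given by $$\widehat{\mathbb{Z}}^\times\backslash\widehat{\mathbb{Z}}/\mathbb{N}_+^\times=\widehat{\mathbb{Z}}^\times\backslash\mathbb{A}_f/\mathbb{Q}^\times ,$$ where the class of $z\in\widehat{\mathbb{Z}}$ corresponds to the point $p_z$ described in the context. In particular, they agree with the topos points of $\mathbb{N}_+^\times\text{-}\mathsf{Set}$, the underlying topos of the Arithmetic Site of Connes and Consani.
   Context: $\bar{\mathrm{P}}^{\mathrm{ns}}(\mathbb{Z})$ is the monoid, under matrix multiplication, of matrices $\begin{pmatrix}a&b\\0&1\end{pmatrix}$ with $a,b\in\mathbb{Z}$, $a\ne0$. $\mathbb{N}_+^\times$ is the monoid of strictly positive natural numbers under multiplication. For a monoid $M$, $M\text{-}\mathsf{Set}$ is the topos of sets with a left $M$-action and equivariant maps. $\widehat{\mathbb{Z}}=\prod_p\mathbb{Z}_p$ and $\mathbb{A}_f=\widehat{\mathbb{Z}}\otimes\mathbb{Q}$. $\widehat{\mathbb{Z}}^\times\backslash\widehat{\mathbb{Z}}/\mathbb{N}_+^\times$ is the quotient of $\widehat{\mathbb{Z}}$ by the equivalence relation generated by $z\sim uz$ ($u\in\widehat{\mathbb{Z}}^\times$) and $z\sim zn$ ($n\in\mathbb{N}_+^\times$); $\widehat{\mathbb{Z}}^\times\backslash\mathbb{A}_f/\mathbb{Q}^\times$ is the quotient of $\mathbb{A}_f$ by multiplication by $\widehat{\mathbb{Z}}^\times$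 and $\mathbb{Q}^\times$. For $z\in\widehat{\mathbb{Z}}$, $p_z$ is the point with inverse image functor $p_z^*N=\varinjlim_{a\mid z}N$, the colimit of sets over positive integers $a$ dividing $z$ in $\widehat{\mathbb{Z}}$, ordered by divisibility, with transition map for $a\mid a'$ given by the action of $\begin{pmatrix}a'/a&0\\0&1\end{pmatrix}$ on $N$. It is known (Le Bruyn) that the isomorphism classes of points of $\mathbb{N}_+^\times\text{-}\mathsf{Set}$ are given by $\widehat{\mathbb{Z}}^\times\backslash\mathbb{A}_f/\mathbb{Q}^\times$. *)

theory Defs
  imports
    "HOL-Analysis.Analysis"
    "HOL-Algebra.Group"
    "HOL-Library.Poly_Mapping"
    "HOL-Library.Equipollence"
begin

section \<open>Categories, functors, geometric morphisms\<close>

record ('o, 'a) cat =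
  Obj :: "'o set"
  Arr :: "'a set"
  Dom :: "'a \<Rightarrow> 'o"
  Cod :: "'a \<Rightarrow> 'o"
  Idn :: "'o \<Rightarrow> 'a"
  Cmp :: "'a \<Rightarrow> 'a \<Rightarrow> 'a"

definition Homs :: "('o, 'a) cat \<Rightarrow> 'o \<Rightarrow> 'o \<Rightarrow> 'a set" where
  "Homs C X Y = {f \<in> Arr C. Dom C f = X \<and> Cod C f = Y}"

definition category :: "('o, 'a) cat \<Rightarrow> bool" where
  "category C \<longleftrightarrow>
     (\<forall>f\<in>Arr C. Dom C f \<in> Obj C \<and> Cod C f \<in> Obj C) \<and>
     (\<forall>X\<in>Obj C. Idn C X \<in> Homs C X X) \<and>
     (\<forall>f\<in>Arr C. \<forall>g\<in>Arr C. Cod C f = Dom C g \<longrightarrow>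
        Cmp C g f \<in> Homs C (Dom C f) (Cod C g)) \<and>
     (\<forall>f\<in>Arr C. Cmp C f (Idn C (Dom C f)) = f \<and> Cmp C (Idn C (Cod C f)) f = f) \<and>
     (\<forall>f\<in>Arr C. \<forall>g\<in>Arr C. \<forall>h\<in>Arr C. Cod C f = Dom C g \<longrightarrow> Cod C g = Dom C h \<longrightarrow>
        Cmp C h (Cmp C g f) = Cmp C (Cmp C h g) f)"

definition isomorphism :: "('o, 'a) cat \<Rightarrow> 'a \<Rightarrow> bool" where
  "isomorphism C f \<longleftrightarrow> f \<in> Arr C \<and>
     (\<exists>g \<in> Homs C (Cod C f) (Dom C f).
        Cmp C g f = Idn C (Dom C f) \<and> Cmp C f g = Idn C (Cod C f))"

record ('o, 'a, 'p, 'b) fctr =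
  OMap :: "'o \<Rightarrow> 'p"
  AMap :: "'a \<Rightarrow> 'b"

definition is_functor ::
  "('o, 'a) cat \<Rightarrow> ('p, 'b) cat \<Rightarrow> ('o, 'a, 'p, 'b) fctr \<Rightarrow> bool" where
  "is_functor C D F \<longleftrightarrow>
     category C \<and> category D \<and>
     (\<forall>X\<in>Obj C. OMap F X \<in> Obj D) \<and>
     (\<forall>f\<in>Arr C. AMap F f \<in> Homs D (OMap F (Dom C f)) (OMap F (Cod C f))) \<and>
     (\<forall>X\<in>Obj C. AMap F (Idn C X) = Idn D (OMap F X)) \<and>
     (\<forall>f\<in>Arr C. \<forall>g\<in>Arr C. Cod C f = Dom C g \<longrightarrow>
        AMap F (Cmp C g f) = Cmp D (AMap F g) (AMap F f))"

definition fcomp ::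
  "('p, 'b, 'q, 'c) fctr \<Rightarrow> ('o, 'a, 'p, 'b) fctr \<Rightarrow> ('o, 'a, 'q, 'c) fctr" where
  "fcomp G F = \<lparr>OMap = OMap G \<circ> OMap F, AMap = AMap G \<circ> AMap F\<rparr>"

definition naturally_isomorphic ::
  "('o, 'a) cat \<Rightarrow> ('p, 'b) cat \<Rightarrow> ('o, 'a, 'p, 'b) fctr \<Rightarrow> ('o, 'a, 'p, 'b) fctr \<Rightarrow> bool" where
  "naturally_isomorphic C D F G \<longleftrightarrow>
     (\<exists>\<eta>. (\<forall>X\<in>Obj C. \<eta> X \<in> Homs D (OMap F X) (OMap G X) \<and> isomorphism D (\<eta> X)) \<and>
          (\<forall>f\<in>Arr C. Cmp D (AMap G f) (\<eta> (Dom C f)) = Cmp D (\<eta> (Cod C f)) (AMap F f)))"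

definition cone ::
  "('j, 'k) cat \<Rightarrow> ('o, 'a) cat \<Rightarrow> ('j, 'k, 'o, 'a) fctr \<Rightarrow> 'o \<Rightarrow> ('j \<Rightarrow> 'a) \<Rightarrow> bool" where
  "cone J C D X \<pi> \<longleftrightarrow> X \<in> Obj C \<and>
     (\<forall>j\<in>Obj J. \<pi> j \<in> Homs C X (OMap D j)) \<and>
     (\<forall>u\<in>Arr J. Cmp C (AMap D u) (\<pi> (Dom J u)) = \<pi> (Cod J u))"

definition limit_cone ::
  "('j, 'k) cat \<Rightarrow> ('o, 'a) cat \<Rightarrow> ('j, 'k, 'o, 'a) fctr \<Rightarrow> 'o \<Rightarrow> ('j \<Rightarrow> 'a) \<Rightarrow> bool" where
  "limit_cone J C D X \<pi> \<longleftrightarrow> cone J C D X \<pi> \<and>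
     (\<forall>Y \<rho>. cone J C D Y \<rho> \<longrightarrow>
        (\<exists>!h. h \<in> Homs C Y X \<and> (\<forall>j\<in>Obj J. Cmp C (\<pi> j) h = \<rho> j)))"

definition cocone ::
  "('j, 'k) cat \<Rightarrow> ('o, 'a) cat \<Rightarrow> ('j, 'k, 'o, 'a) fctr \<Rightarrow> 'o \<Rightarrow> ('j \<Rightarrow> 'a) \<Rightarrow> bool" where
  "cocone J C D X \<iota> \<longleftrightarrow> X \<in> Obj C \<and>
     (\<forall>j\<in>Obj J. \<iota> j \<in> Homs C (OMap D j) X) \<and>
     (\<forall>u\<in>Arr J. Cmp C (\<iota> (Cod J u)) (AMap D u) = \<iota> (Dom J u))"

definition colimit_cocone ::
  "('j, 'k) cat \<Rightarrow> ('o, 'a) cat \<Rightarrow> ('j, 'k, 'o, 'a) fctr \<Rightarrow> 'o \<Rightarrow> ('j \<Rightarrow> 'a) \<Rightarrow> bool" where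
  "colimit_cocone J C D X \<iota> \<longleftrightarrow> cocone J C D X \<iota> \<and>
     (\<forall>Y \<rho>. cocone J C D Y \<rho> \<longrightarrow>
        (\<exists>!h. h \<in> Homs C X Y \<and> (\<forall>j\<in>Obj J. Cmp C h (\<iota> j) = \<rho> j)))"

text \<open>Every finite category is isomorphic to one whose objects and arrows are natural numbers, so
  it suffices to let the shape \<open>J\<close> range over those.\<close>

definition preserves_finite_limits ::
  "('o, 'a) cat \<Rightarrow> ('p, 'b) cat \<Rightarrow> ('o, 'a, 'p, 'b) fctr \<Rightarrow> bool" where
  "preserves_finite_limits C D F \<longleftrightarrow>
     (\<forall>(J :: (nat, nat) cat) K X \<pi>.
        finite (Obj J) \<and> finite (Arr J) \<and> is_functor J C K \<and> limit_cone J C K X \<pi> \<longrightarrow>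
        limit_cone J D (fcomp F K) (OMap F X) (AMap F \<circ> \<pi>))"

text \<open>\<open>adjoint C D F G\<close>: the functor \<open>F : C \<rightarrow> D\<close> is left adjoint to \<open>G : D \<rightarrow> C\<close>.\<close>

definition adjoint ::
  "('o, 'a) cat \<Rightarrow> ('p, 'b) cat \<Rightarrow> ('o, 'a, 'p, 'b) fctr \<Rightarrow> ('p, 'b, 'o, 'a) fctr \<Rightarrow> bool" where
  "adjoint C D F G \<longleftrightarrow>
     (\<exists>\<phi>. (\<forall>X\<in>Obj C. \<forall>Y\<in>Obj D. bij_betw (\<phi> X Y) (Homs D (OMap F X) Y) (Homs C X (OMap G Y))) \<and>
          (\<forall>h\<in>Arr C. \<forall>k\<in>Arr D. \<forall>f \<in> Homs D (OMap F (Cod C h)) (Dom D k).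
             \<phi> (Dom C h) (Cod D k) (Cmp D k (Cmp D f (AMap F h))) =
             Cmp C (AMap G k) (Cmp C (\<phi> (Cod C h) (Dom D k) f) h)))"

text \<open>A geometric morphism \<open>E \<rightarrow> T\<close> is a direct image functor \<open>E \<rightarrow> T\<close> together with a left exact
  left adjoint \<open>T \<rightarrow> E\<close>; the parameters of the record are those of \<open>T\<close>, then those of \<open>E\<close>.\<close>

record ('o, 'a, 'p, 'b) geom =
  inverse_image :: "('o, 'a, 'p, 'b) fctr"
  direct_image :: "('p, 'b, 'o, 'a) fctr"

definition geometric_morphism ::
  "('p, 'b) cat \<Rightarrow> ('o, 'a) cat \<Rightarrow> ('o, 'a, 'p, 'b) geom \<Rightarrow> bool" where
  "geometric_morphism E T f \<longleftrightarrow>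
     is_functor T E (inverse_image f) \<and> is_functor E T (direct_image f) \<and>
     adjoint T E (inverse_image f) (direct_image f) \<and>
     preserves_finite_limits T E (inverse_image f)"

section \<open>The categories of sets and of sets with a monoid action\<close>

text \<open>No HOL type collects all sets, so the small sets are the members of a family \<open>U\<close> of subsets
  of some type. The members of an uncountable Grothendieck universe satisfy the closure conditions
  below, but so do weaker families that exist in plain HOL, such as the one in the lemma.\<close>

definition set_universe :: "'u set set \<Rightarrow> bool" where
  "set_universe U \<longleftrightarrow>
     (\<exists>X\<in>U. infinite X) \<and>
     (\<forall>X\<in>U. \<forall>Y :: 'u set. Y \<lesssim> X \<longrightarrow> Y \<in> U) \<and>
     (\<forall>X\<in>U. \<forall>Y\<in>U. \<exists>Z\<in>U. X \<times> Y \<lesssim> Z) \<and>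
     (\<forall>X\<in>U. \<exists>Z\<in>U. ((UNIV :: nat set) \<rightarrow>\<^sub>E X) \<lesssim> Z)"

lemma set_universe_example: "set_universe (UNIV :: nat set set set)"
proof -
  have inf: "infinite (UNIV :: nat set set)"
    by (simp add: Finite_Set.finite_set)
  have prod: "X \<times> Y \<lesssim> (UNIV :: nat set set)" for X Y :: "nat set set"
    unfolding lepoll_def
  proof (intro exI conjI inj_onI)
    fix p q :: "nat set \<times> nat set"
    assume "sum_encode ` (fst p <+> snd p) = sum_encode ` (fst q <+> snd q)"
    then have eq: "fst p <+> snd p = fst q <+> snd q"
      by (rule inj_image_eq_iff[OF inj_sum_encode, THEN iffD1])
    have "fst p = Inl -` (fst p <+> snd p)" "snd p = Inr -` (fst p <+> snd p)"
      "fst q = Inl -` (fst q <+> snd q)" "snd q = Inr -` (fst q <+> snd q)"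
      by auto
    with eq show "p = q"
      by (metis prod_eq_iff)
  qed simp
  have power: "((UNIV :: nat set) \<rightarrow>\<^sub>E X) \<lesssim> (UNIV :: nat set set)" for X :: "nat set set"
    unfolding lepoll_def
  proof (intro exI conjI inj_onI)
    fix f g :: "nat \<Rightarrow> nat set"
    assume "prod_encode ` Sigma UNIV f = prod_encode ` Sigma UNIV g"
    then have eq: "Sigma UNIV f = Sigma UNIV g"
      by (rule inj_image_eq_iff[OF inj_prod_encode, THEN iffD1])
    have "f n = Pair n -` Sigma UNIV f" "g n = Pair n -` Sigma UNIV g" for n
      by auto
    with eq show "f = g"
      by (metis ext)
  qed simp
  show ?thesis
    unfolding set_universe_def
  proof (intro conjI ballI allI impI)
    show "\<exists>X\<in>UNIV. infinite (X :: nat set set)"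
      by (rule bexI, rule inf, rule UNIV_I)
    show "\<exists>Z\<in>UNIV. X \<times> Y \<lesssim> (Z :: nat set set)" for X Y :: "nat set set"
      by (rule bexI, rule prod, rule UNIV_I)
    show "\<exists>Z\<in>UNIV. ((UNIV :: nat set) \<rightarrow>\<^sub>E X) \<lesssim> (Z :: nat set set)" for X :: "nat set set"
      by (rule bexI, rule power, rule UNIV_I)
  qed simp
qed

type_synonym 'u set_arr = "'u set \<times> ('u \<Rightarrow> 'u) \<times> 'u set"
type_synonym ('m, 'u) mset = "'u set \<times> ('m \<Rightarrow> 'u \<Rightarrow> 'u)"
type_synonym ('m, 'u) mset_arr = "('m, 'u) mset \<times> ('u \<Rightarrow> 'u) \<times> ('m, 'u) mset"

text \<open>Arrows are triples of source, function and target; functions are made total by extensionality.\<close>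

definition SetCat :: "'u set set \<Rightarrow> ('u set, 'u set_arr) cat" where
  "SetCat U =
     \<lparr>Obj = U,
      Arr = {(X, f, Y). X \<in> U \<and> Y \<in> U \<and> f \<in> X \<rightarrow>\<^sub>E Y},
      Dom = fst, Cod = (\<lambda>a. snd (snd a)),
      Idn = (\<lambda>X. (X, \<lambda>x\<in>X. x, X)),
      Cmp = (\<lambda>(Y, g, Z) (X, f, Y'). (X, compose X g f, Z))\<rparr>"

definition is_left_action :: "('m, 'r) monoid_scheme \<Rightarrow> ('m, 'u) mset \<Rightarrow> bool" where
  "is_left_action M N \<longleftrightarrow>
     snd N \<in> carrier M \<rightarrow>\<^sub>E (fst N \<rightarrow>\<^sub>E fst N) \<and>
     (\<forall>x\<in>fst N. snd N \<one>\<^bsub>M\<^esub> x = x) \<and>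
     (\<forall>m\<in>carrier M. \<forall>n\<in>carrier M. \<forall>x\<in>fst N. snd N (m \<otimes>\<^bsub>M\<^esub> n) x = snd N m (snd N n x))"

definition MSetCat ::
  "'u set set \<Rightarrow> ('m, 'r) monoid_scheme \<Rightarrow> (('m, 'u) mset, ('m, 'u) mset_arr) cat" where
  "MSetCat U M =
     \<lparr>Obj = {N. fst N \<in> U \<and> is_left_action M N},
      Arr = {(N, f, N'). fst N \<in> U \<and> is_left_action M N \<and> fst N' \<in> U \<and> is_left_action M N' \<and>
               f \<in> fst N \<rightarrow>\<^sub>E fst N' \<and>
               (\<forall>m\<in>carrier M. \<forall>x\<in>fst N. f (snd N m x) = snd N' m (f x))},
      Dom = fst, Cod = (\<lambda>a. snd (snd a)),
      Idn = (\<lambda>N. (N, \<lambda>x\<in>fst N. x, N)),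
      Cmp = (\<lambda>(N', g, N'') (N, f, _). (N, compose (fst N) g f, N''))\<rparr>"

lemma category_SetCat: "category (SetCat U)"
  unfolding category_def SetCat_def Homs_def
  by (auto simp: compose_def fun_eq_iff PiE_iff extensional_def)

lemma category_MSetCat: "category (MSetCat U M)"
  unfolding category_def MSetCat_def Homs_def is_left_action_def
  by (auto simp: compose_def fun_eq_iff PiE_iff extensional_def Pi_iff)

definition forgetful :: "(('m, 'u) mset, ('m, 'u) mset_arr, 'u set, 'u set_arr) fctr" where
  "forgetful = \<lparr>OMap = fst, AMap = (\<lambda>(N, f, N'). (fst N, f, fst N'))\<rparr>"

type_synonym ('m, 'u) point =
  "(('m, 'u) mset, ('m, 'u) mset_arr, 'u set, 'u set_arr) geom"

definition points :: "'u set set \<Rightarrow> ('m, 'r) monoid_scheme \<Rightarrow> ('m, 'u) point set" where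
  "points U M = {f. geometric_morphism (SetCat U) (MSetCat U M) f}"

definition points_iso ::
  "'u set set \<Rightarrow> ('m, 'r) monoid_scheme \<Rightarrow> (('m, 'u) point \<times> ('m, 'u) point) set" where
  "points_iso U M = {(f, g). f \<in> points U M \<and> g \<in> points U M \<and>
     naturally_isomorphic (MSetCat U M) (SetCat U) (inverse_image f) (inverse_image g)}"

section \<open>The two monoids\<close>

definition Pns :: "(int^2^2) monoid" where
  "Pns = \<lparr>carrier = {vector [vector [a, b], vector [0, 1]] | a b. a \<noteq> 0},
          mult = (**), one = mat 1\<rparr>"

definition Npos :: "nat monoid" where
  "Npos = \<lparr>carrier = {n. n > 0}, mult = (*), one = 1\<rparr>"

definition diag1 :: "nat \<Rightarrow> int^2^2" where
  "diag1 n = vector [vector [int n, 0], vector [0, 1]]"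

lemma upper_triangular_mult:
  "(vector [vector [a, b], vector [0, 1]] :: int^2^2) **
     (vector [vector [c, d], vector [0, 1]] :: int^2^2) =
     vector [vector [a * c, a * d + b], vector [0, 1]]"
  by (simp add: vec_eq_iff matrix_matrix_mult_def forall_2 sum_2)

lemma monoid_Pns: "monoid Pns"
proof
  have one: "(mat 1 :: int^2^2) = vector [vector [1, 0], vector [0, 1]]"
    by (simp add: vec_eq_iff mat_def forall_2)
  show "\<one>\<^bsub>Pns\<^esub> \<in> carrier Pns"
    by (auto simp: Pns_def one)
  show "x \<otimes>\<^bsub>Pns\<^esub> y \<in> carrier Pns" if "x \<in> carrier Pns" "y \<in> carrier Pns" for x y
    using that by (auto simp: Pns_def upper_triangular_mult) (metis mult_eq_0_iff)
qed (simp_all add: Pns_def matrix_mul_assoc)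

lemma monoid_Npos: "monoid Npos"
  by standard (auto simp: Npos_def)

section \<open>Profinite integers and finite adeles\<close>

text \<open>A \<open>p\<close>-adic integer is the compatible family of its residues modulo \<open>p ^ n\<close>.\<close>

definition padic_ints :: "nat \<Rightarrow> (nat \<Rightarrow> int) set" where
  "padic_ints p = {x. \<forall>n. x n \<in> {0..<int p ^ n} \<and> x (Suc n) mod int p ^ n = x n}"

lemma padic_intsI:
  assumes "prime p" and "\<And>n. y (Suc n) mod int p ^ n = y n mod int p ^ n"
  shows "(\<lambda>n. y n mod int p ^ n) \<in> padic_ints p"
proof -
  have "int p ^ n > 0" for n
    using assms(1) by (simp add: prime_gt_0_nat)
  then show ?thesis
    using assms(2) by (auto simp: padic_ints_def mod_mod_cancel)
qed

lemma padic_ints_mod: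
  "x \<in> padic_ints p \<Longrightarrow> x (Suc n) mod int p ^ n = x n"
  "x \<in> padic_ints p \<Longrightarrow> x n mod int p ^ n = x n"
  by (auto simp: padic_ints_def)

typedef zhat = "\<Pi>\<^sub>E p \<in> {p :: nat. prime p}. padic_ints p"
  morphisms component Abs_zhat
proof
  show "(\<lambda>p\<in>{p. prime p}. \<lambda>n. 0 mod int p ^ n) \<in> (\<Pi>\<^sub>E p \<in> {p :: nat. prime p}. padic_ints p)"
    using padic_intsI[of _ "\<lambda>_. 0"] by auto
qed

setup_lifting type_definition_zhat

lemma component_cases:
  assumes "x \<in> (\<Pi>\<^sub>E p \<in> {p :: nat. prime p}. padic_ints p)"
  shows "prime p \<Longrightarrow> x p \<in> padic_ints p" and "\<not> prime p \<Longrightarrow> x p = undefined"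
  using assms by (auto simp: PiE_iff extensional_def)

instantiation zhat :: comm_ring_1
begin

lift_definition zero_zhat :: zhat is "\<lambda>p\<in>{p. prime p}. \<lambda>n. 0 mod int p ^ n"
  using padic_intsI[of _ "\<lambda>_. 0"] by auto

lift_definition one_zhat :: zhat is "\<lambda>p\<in>{p. prime p}. \<lambda>n. 1 mod int p ^ n"
  using padic_intsI[of _ "\<lambda>_. 1"] by auto

lift_definition plus_zhat :: "zhat \<Rightarrow> zhat \<Rightarrow> zhat" is
  "\<lambda>x y. \<lambda>p\<in>{p. prime p}. \<lambda>n. (x p n + y p n) mod int p ^ n"
  by (intro restrict_PiE_iff[THEN iffD2] ballI padic_intsI)
     (auto simp: PiE_iff intro: mod_add_cong simp: padic_ints_mod)

lift_definition minus_zhat :: "zhat \<Rightarrow> zhat \<Rightarrow> zhat" is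
  "\<lambda>x y. \<lambda>p\<in>{p. prime p}. \<lambda>n. (x p n - y p n) mod int p ^ n"
  by (intro restrict_PiE_iff[THEN iffD2] ballI padic_intsI)
     (auto simp: PiE_iff intro: mod_diff_cong simp: padic_ints_mod)

lift_definition uminus_zhat :: "zhat \<Rightarrow> zhat" is
  "\<lambda>x. \<lambda>p\<in>{p. prime p}. \<lambda>n. (- x p n) mod int p ^ n"
  by (intro restrict_PiE_iff[THEN iffD2] ballI padic_intsI)
     (auto simp: PiE_iff intro: mod_minus_cong simp: padic_ints_mod)

lift_definition times_zhat :: "zhat \<Rightarrow> zhat \<Rightarrow> zhat" is
  "\<lambda>x y. \<lambda>p\<in>{p. prime p}. \<lambda>n. (x p n * y p n) mod int p ^ n"
  by (intro restrict_PiE_iff[THEN iffD2] ballI padic_intsI)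
     (auto simp: PiE_iff intro: mod_mult_cong simp: padic_ints_mod)

instance
proof
  fix a b c :: zhat
  note ext_simps = fun_eq_iff component_cases padic_ints_mod mod_simps algebra_simps
  show "a * b * c = a * (b * c)" "a * b = b * a" "1 * a = a" "a + b + c = a + (b + c)"
    "a + b = b + a" "0 + a = a" "- a + a = 0" "a - b = a + - b" "(a + b) * c = a * c + b * c"
    by (transfer; auto simp: ext_simps)+
  show "(0 :: zhat) \<noteq> 1"
  proof
    assume "(0 :: zhat) = 1"
    then have "component 0 2 1 = component 1 2 1"
      by simp
    then show False
      by (simp add: zero_zhat.rep_eq one_zhat.rep_eq)
  qed
qed

end

lifting_forget zhat.lifting

definition zhat_step :: "zhat \<Rightarrow> zhat \<Rightarrow> bool" where
  "zhat_step z z' \<longleftrightarrow> (\<exists>u. u dvd 1 \<and> z' = u * z) \<or> (\<exists>n :: nat. n > 0 \<and> z' = z * of_nat n)"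

definition zhat_rel :: "(zhat \<times> zhat) set" where
  "zhat_rel = {(z, z'). equivclp zhat_step z z'}"

text \<open>The tensor product of \<open>zhat\<close> and \<open>rat\<close> over the integers, as the free abelian group on pairs
  modulo the subgroup generated by the bilinearity relations.\<close>

inductive_set tensor_relations :: "((zhat \<times> rat) \<Rightarrow>\<^sub>0 int) set" where
  zero: "0 \<in> tensor_relations"
| left: "frag_of (z + z', q) - frag_of (z, q) - frag_of (z', q) \<in> tensor_relations"
| right: "frag_of (z, q + q') - frag_of (z, q) - frag_of (z, q') \<in> tensor_relations"
| diff: "\<lbrakk>x \<in> tensor_relations; y \<in> tensor_relations\<rbrakk> \<Longrightarrow> x - y \<in> tensor_relations"

definition tensor_eq :: "((zhat \<times> rat) \<Rightarrow>\<^sub>0 int) \<Rightarrow> ((zhat \<times> rat) \<Rightarrow>\<^sub>0 int) \<Rightarrow> bool" where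
  "tensor_eq x y \<longleftrightarrow> x - y \<in> tensor_relations"

lemma tensor_relations_uminus: "x \<in> tensor_relations \<Longrightarrow> - x \<in> tensor_relations"
  using tensor_relations.diff[OF tensor_relations.zero] by fastforce

lemma tensor_relations_add:
  "x \<in> tensor_relations \<Longrightarrow> y \<in> tensor_relations \<Longrightarrow> x + y \<in> tensor_relations"
  using tensor_relations.diff[OF _ tensor_relations_uminus] by fastforce

quotient_type finite_adele = "(zhat \<times> rat) \<Rightarrow>\<^sub>0 int" / tensor_eq
proof (rule equivpI)
  show "reflp tensor_eq"
    by (simp add: reflp_def tensor_eq_def tensor_relations.zero)
  show "symp tensor_eq"
    unfolding symp_def tensor_eq_def using tensor_relations_uminus by fastforce
  show "transp tensor_eq"
    unfolding transp_def tensor_eq_def using tensor_relations_add by fastforce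
qed

lift_definition pure_tensor :: "zhat \<Rightarrow> rat \<Rightarrow> finite_adele" is "\<lambda>z q. frag_of (z, q)" .

text \<open>Multiplication by \<open>u \<otimes> q\<close>.\<close>

lift_definition adele_scale :: "zhat \<Rightarrow> rat \<Rightarrow> finite_adele \<Rightarrow> finite_adele" is
  "\<lambda>u q. frag_extend (\<lambda>(z, r). frag_of (u * z, r * q))"
proof -
  fix u :: zhat and q :: rat and x y :: "(zhat \<times> rat) \<Rightarrow>\<^sub>0 int"
  let ?f = "frag_extend (\<lambda>(z :: zhat, r :: rat). frag_of (u * z, r * q))"
  have "?f x \<in> tensor_relations" if "x \<in> tensor_relations" for x
    using that
  proof induction
    case zero
    show ?case by (simp add: tensor_relations.zero)
  next
    case (left z z' r)
    show ?case
      using tensor_relations.left[of "u * z" "u * z'" "r * q"]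
      by (simp only: frag_extend_diff frag_extend_of prod.case distrib_left)
  next
    case (right z r r')
    show ?case
      using tensor_relations.right[of "u * z" "r * q" "r' * q"]
      by (simp only: frag_extend_diff frag_extend_of prod.case distrib_right)
  next
    case (diff x y)
    then show ?case
      by (simp only: frag_extend_diff tensor_relations.diff)
  qed
  then show "tensor_eq x y \<Longrightarrow> tensor_eq (?f x) (?f y)"
    by (metis tensor_eq_def frag_extend_diff)
qed

definition adele_rel :: "(finite_adele \<times> finite_adele) set" where
  "adele_rel = {(x, y). \<exists>u q. u dvd 1 \<and> q \<noteq> 0 \<and> y = adele_scale u q x}"

section \<open>The points attached to profinite integers\<close>

definition divisor_cat :: "zhat \<Rightarrow> (nat, nat \<times> nat) cat" where
  "divisor_cat z =
     \<lparr>Obj = {a. a > 0 \<and> of_nat a dvd z},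
      Arr = {(a, a'). a > 0 \<and> a' > 0 \<and> of_nat a dvd z \<and> of_nat a' dvd z \<and> a dvd a'},
      Dom = fst, Cod = snd, Idn = (\<lambda>a. (a, a)),
      Cmp = (\<lambda>(a', a'') (a, _). (a, a''))\<rparr>"

text \<open>The diagram of sets with value \<open>N\<close> everywhere and transition maps the action of
  \<open>d (a' / a)\<close>, where \<open>d\<close> maps the positive naturals into the acting monoid.\<close>

definition divisor_diagram ::
  "(nat \<Rightarrow> 'm) \<Rightarrow> ('m, 'u) mset \<Rightarrow> (nat, nat \<times> nat, 'u set, 'u set_arr) fctr" where
  "divisor_diagram d N =
     \<lparr>OMap = (\<lambda>a. fst N), AMap = (\<lambda>(a, a'). (fst N, snd N (d (a' div a)), fst N))\<rparr>"

text \<open>The functor \<open>F\<close> sends \<open>N\<close> to the colimit of the diagram above, functorially in \<open>N\<close>. This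
  determines \<open>F\<close> up to natural isomorphism.\<close>

definition is_divisor_colimit ::
  "'u set set \<Rightarrow> ('m, 'r) monoid_scheme \<Rightarrow> (nat \<Rightarrow> 'm) \<Rightarrow> zhat \<Rightarrow>
     (('m, 'u) mset, ('m, 'u) mset_arr, 'u set, 'u set_arr) fctr \<Rightarrow> bool" where
  "is_divisor_colimit U M d z F \<longleftrightarrow>
     is_functor (MSetCat U M) (SetCat U) F \<and>
     (\<exists>\<iota>. (\<forall>N\<in>Obj (MSetCat U M).
             colimit_cocone (divisor_cat z) (SetCat U) (divisor_diagram d N) (OMap F N) (\<iota> N)) \<and>
          (\<forall>f\<in>Arr (MSetCat U M). \<forall>a\<in>Obj (divisor_cat z).
             Cmp (SetCat U) (AMap F f) (\<iota> (Dom (MSetCat U M) f) a) =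
             Cmp (SetCat U) (\<iota> (Cod (MSetCat U M) f) a) (AMap forgetful f)))"

definition point_class ::
  "'u set set \<Rightarrow> ('m, 'r) monoid_scheme \<Rightarrow> (nat \<Rightarrow> 'm) \<Rightarrow> zhat \<Rightarrow> ('m, 'u) point set" where
  "point_class U M d z = {f \<in> points U M. is_divisor_colimit U M d z (inverse_image f)}"

lemma category_divisor_cat: "category (divisor_cat z)"
  unfolding category_def divisor_cat_def Homs_def by (auto intro: dvd_trans)

lemma is_functor_divisor_diagram:
  assumes N: "N \<in> Obj (MSetCat U M)"
    and d: "\<And>a. a > 0 \<Longrightarrow> d a \<in> carrier M" "d 1 = \<one>\<^bsub>M\<^esub>"
      "\<And>a b. a > 0 \<Longrightarrow> b > 0 \<Longrightarrow> d (a * b) = d a \<otimes>\<^bsub>M\<^esub> d b"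
  shows "is_functor (divisor_cat z) (SetCat U) (divisor_diagram d N)"
proof -
  have U: "fst N \<in> U" and act: "is_left_action M N"
    using N by (auto simp: MSetCat_def)
  have maps: "snd N (d a) \<in> fst N \<rightarrow>\<^sub>E fst N" if "a > 0" for a
    using act d(1)[OF that] by (auto simp: is_left_action_def)
  have one: "snd N (d 1) = (\<lambda>x\<in>fst N. x)"
    using act maps[of 1] by (auto simp: d(2)[simplified] is_left_action_def fun_eq_iff PiE_iff extensional_def)
  have comp: "snd N (d (c div a)) = compose (fst N) (snd N (d (c div b))) (snd N (d (b div a)))"
    if "a > 0" "b > 0" "c > 0" "a dvd b" "b dvd c" for a b c
  proof -
    have pos: "c div b > 0" "b div a > 0"
      using that by (auto simp: dvd_imp_le div_greater_zero_iff)
    have "c div a = (c div b) * (b div a)"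
      using that by (simp add: div_mult_swap)
    then have "snd N (d (c div a)) x = compose (fst N) (snd N (d (c div b))) (snd N (d (b div a))) x"
      for x
      using act d(1,3) pos maps[of "c div b * (b div a)"]
      by (cases "x \<in> fst N") (auto simp: compose_def is_left_action_def PiE_iff extensional_def)
    then show ?thesis by blast
  qed
  have "b div a > 0" if "a > 0" "b > 0" "a dvd b" for a b :: nat
    using that by (auto simp: dvd_imp_le div_greater_zero_iff)
  then show ?thesis
    unfolding is_functor_def
    using category_divisor_cat[of z] category_SetCat[of U] U maps one comp
    by (auto simp: divisor_cat_def divisor_diagram_def SetCat_def Homs_def)
qed

end

theory Submission
  imports Defs "HOL-Number_Theory.Cong"
begin

text \<open>A point of the topos of left \<open>M\<close>-sets is a flat right \<open>M\<close>-set, and for both monoids in question a flat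
right \<open>M\<close>-set is the same thing as a set of positive integers closed under divisors and least common
multiples, up to a change of reference element. Such sets are the divisor sets of profinite integers.

In detail, let \<open>F\<close> be the inverse image functor of a point. The monoid \<open>M\<close>, acting on itself from the
left, is an object whose value \<open>A = F(M)\<close> carries a right action of \<open>M\<close>, and an element \<open>n\<close> of an
\<open>M\<close>-set \<open>N\<close> is a map from \<open>M\<close> to \<open>N\<close>, so that every \<open>x\<close> in \<open>A\<close> has a product \<open>x \<otimes> n\<close> in \<open>F(N)\<close>
(called \<open>tens\<close> below). Because \<open>F\<close> is a left adjoint, these products exhaust \<open>F(N)\<close>
(\<open>left_adjoint_generates\<close>). Because \<open>F\<close> preserves finite limits, any finite compatible family of
elements in values of \<open>F\<close> consists of products with one common \<open>x\<close> (\<open>flat_family\<close>).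

The only facts about \<open>M\<close> that matter are collected in the locale \<open>divisibility_monoid\<close>: there is a
homomorphism \<open>d\<close> from the positive integers to \<open>M\<close> with a multiplicative retraction \<open>nrm\<close>, every
\<open>m\<close> is \<open>u d(nrm m)\<close> for a unit \<open>u\<close>, and multiplication by \<open>d(a)\<close> on the right is injective. For the
affine maps \<open>t \<mapsto> a t + b\<close> the norm is \<open>\<bar>a\<bar>\<close>: translations are units, and so they disappear from the
classification. This is why both monoids have the same points.

Fix \<open>x\<close> in \<open>A\<close> and let \<open>T\<close> be the set of those \<open>a > 0\<close> for which \<open>x = y d(a)\<close> has a solution \<open>y\<close> in \<open>A\<close>;
the solution is then unique. Flatness shows that \<open>T\<close> is closed under divisors and least common
multiples, so \<open>T\<close> is the set of divisors of some profinite integer \<open>z\<close>, and the solutions form a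
family over the divisors of \<open>z\<close> that presents \<open>F\<close> as the filtered colimit defining \<open>p\<^sub>z\<close>
(\<open>flat_basis\<close>). Such a family is called a germ basis. A functor is a divisor colimit for \<open>z\<close>
exactly if it has a germ basis for \<open>z\<close>, and every functor with a germ basis is the inverse image of
a point: filtered colimits of sets commute with finite limits (\<open>basis_preserves_finite_limits\<close>), and
\<open>Y \<mapsto> Y\<^sup>A\<close> is a right adjoint, which stays within the small sets because \<open>A\<close> is countable
(\<open>basis_right_adjoint\<close>).

Replacing \<open>x\<close> by \<open>x m\<close> multiplies the divisor set by \<open>nrm m\<close> (\<open>basis_change_divisors\<close>), and two
profinite integers have the same divisors exactly if they differ by a unit. Hence \<open>z\<close> is determined
by the point up to the relation generated by units and positive integers. The same relation is the
trace of the action on the finite adeles, since each adele is \<open>z \<otimes> (1/n)\<close> and an equality of pure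
tensors can be tested after clearing denominators (\<open>adele_classes\<close>).\<close>

section \<open>Divisibility of profinite integers\<close>

lemma component_padic: "prime p \<Longrightarrow> component z p \<in> padic_ints p"
  using component[of z] component_cases by blast

lemma component_bounds:
  assumes "prime p"
  shows "0 \<le> component z p n" "component z p n < int p ^ n"
  using component_padic[OF assms, of z] by (auto simp: padic_ints_def)

lemma padic_ints_mod_power:
  assumes "x \<in> padic_ints p" "m \<le> n"
  shows "x n mod int p ^ m = x m"
  using assms(2)
proof (induction n rule: dec_induct)
  case base
  show ?case using padic_ints_mod(2)[OF assms(1)] .
next
  case (step n)
  have "x (Suc n) mod int p ^ m = x (Suc n) mod int p ^ n mod int p ^ m"
    using step by (simp add: mod_mod_cancel le_imp_power_dvd)
  then show ?case using step padic_ints_mod(1)[OF assms(1)] by simp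
qed

lemma zhat_eqI:
  assumes "\<And>p n. prime p \<Longrightarrow> component x p n = component y p n"
  shows "x = y"
proof -
  have "component x p = component y p" for p
    using assms component_cases(2)[OF component, of p x] component_cases(2)[OF component, of p y]
    by (cases "prime p") auto
  then show ?thesis by (metis component_inject ext)
qed

lemma component_mult:
  "prime p \<Longrightarrow> component (x * y) p n = component x p n * component y p n mod int p ^ n"
  by (simp add: times_zhat.rep_eq)

lemma component_of_nat: "prime p \<Longrightarrow> component (of_nat a) p n = int a mod int p ^ n"
  by (induction a) (simp_all add: zero_zhat.rep_eq plus_zhat.rep_eq one_zhat.rep_eq mod_simps)

lemma component_one: "prime p \<Longrightarrow> component 1 p n = 1 mod int p ^ n"
  by (simp add: one_zhat.rep_eq)

lemma zhat_with_components:
  assumes "\<And>p. prime p \<Longrightarrow> f p \<in> padic_ints p"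
  obtains z where "\<And>p. prime p \<Longrightarrow> component z p = f p"
proof
  fix p :: nat
  assume "prime p"
  moreover have "component (Abs_zhat (\<lambda>p\<in>{p. prime p}. f p)) = (\<lambda>p\<in>{p. prime p}. f p)"
    using assms by (intro Abs_zhat_inverse) auto
  ultimately show "component (Abs_zhat (\<lambda>p\<in>{p. prime p}. f p)) p = f p" by simp
qed

text \<open>The zeros of \<open>x\<close> are the \<open>n\<close> up to its valuation, so the hypothesis compares valuations. If \<open>x\<close> has
finite valuation \<open>v\<close>, divide both \<open>x\<close> and \<open>y\<close> by \<open>p ^ v\<close>, which is possible after shifting the index
by \<open>v\<close>; the first quotient is then invertible modulo each \<open>p ^ n\<close>. The last clause records that \<open>w\<close> can
be chosen as a unit when the valuations agree; this includes the case \<open>x = y = 0\<close>, where any \<open>w\<close>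
satisfies the equation.\<close>

lemma padic_quotient:
  assumes p: "prime p" and x: "x \<in> padic_ints p" and y: "y \<in> padic_ints p"
    and zeros: "\<And>n. x n = 0 \<Longrightarrow> y n = 0"
  obtains w where "w \<in> padic_ints p" "\<And>n. y n = x n * w n mod int p ^ n"
    "(\<And>n. y n = 0 \<Longrightarrow> x n = 0) \<Longrightarrow> (\<And>n. w n = 0 \<Longrightarrow> n = 0)"
proof (cases "\<forall>n. x n = 0")
  case True
  have one: "(\<lambda>n. 1 mod int p ^ n) \<in> padic_ints p"
    using padic_intsI[OF p, of "\<lambda>_. 1"] by simp
  have nonzero: "n = 0" if "1 mod int p ^ n = 0" for n
  proof (rule ccontr)
    assume "n \<noteq> 0"
    then have "1 < int p ^ n" using prime_gt_1_nat[OF p] by (intro one_less_power) auto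
    then show False using that by simp
  qed
  show thesis
    using True zeros by (intro that[OF one]) (simp, erule nonzero)
next
  case False
  \<comment> \<open>The valuation of \<open>x\<close>: the last index at which \<open>x\<close> vanishes, since \<open>x 0 = 0\<close>.\<close>
  define v where "v = (LEAST n. x (Suc n) \<noteq> 0)"
  have "x 0 \<in> {0..<int p ^ 0}" using x unfolding padic_ints_def by blast
  then have x0: "x 0 = 0" by simp
  with False obtain n where "x (Suc n) \<noteq> 0" by (metis not0_implies_Suc)
  then have xv1: "x (Suc v) \<noteq> 0" unfolding v_def by (rule LeastI)
  have xv: "x v = 0"
  proof (cases v)
    case (Suc k)
    then have "k < (LEAST n. x (Suc n) \<noteq> 0)" by (simp flip: v_def)
    from not_less_Least[OF this] show ?thesis by (simp add: Suc)
  qed (simp add: x0)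
  have pp: "prime (int p)" and p0: "int p > 0" using p by (auto simp: prime_gt_0_nat)
  have split: "int p ^ v * (a (n + v) div int p ^ v) = a (n + v)"
    if "a \<in> padic_ints p" "a v = 0" for a n
    using padic_ints_mod_power[OF that(1), of v "n + v"] that(2) by (simp add: mod_eq_0_iff_dvd)
  \<comment> \<open>\<open>s\<close> and \<open>t\<close> represent \<open>x / p ^ v\<close> and \<open>y / p ^ v\<close>; being residues modulo \<open>p ^ n\<close>, they need the index \<open>n + v\<close>.\<close>
  define s t where "s n = x (n + v) div int p ^ v" and "t n = y (n + v) div int p ^ v" for n
  have s: "int p ^ v * s n = x (n + v)" and t: "int p ^ v * t n = y (n + v)" for n
    using split[OF x xv] split[OF y zeros[OF xv]] by (simp_all add: s_def t_def)
  have shift: "a (Suc n) mod int p ^ n = a n mod int p ^ n"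
    if "b \<in> padic_ints p" "\<And>n. int p ^ v * a n = b (n + v)" for a b n
  proof -
    have "b (Suc n + v) mod int p ^ (n + v) = b (n + v) mod int p ^ (n + v)"
      using padic_ints_mod_power[OF that(1)] by simp
    then have "int p ^ (v + n) dvd int p ^ v * a (Suc n) - int p ^ v * a n"
      by (simp only: mod_eq_dvd_iff that(2) add.commute[of v])
    then have "int p ^ n dvd a (Suc n) - a n"
      unfolding power_add right_diff_distrib[symmetric] using p0 by simp
    then show ?thesis by (simp add: mod_eq_dvd_iff)
  qed
  have ndvd: "\<not> int p dvd a n"
    if "b \<in> padic_ints p" "\<And>n. int p ^ v * a n = b (n + v)" "b (Suc v) \<noteq> 0" "n > 0" for a b n
  proof
    assume "int p dvd a n"
    then have "int p ^ Suc v dvd b (n + v)"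
      unfolding that(2)[symmetric] power_Suc2 by (rule mult_dvd_mono[OF dvd_refl])
    then show False
      using padic_ints_mod_power[OF that(1), of "Suc v" "n + v"] that(3,4) by simp
  qed
  have cop: "coprime (s n) (int p ^ n)" for n
  proof (cases "n > 0")
    case True
    then have "coprime (int p) (s n)"
      using ndvd[OF x s xv1, of n] pp by (intro prime_imp_coprime)
    then show ?thesis by (simp add: coprime_commute)
  qed simp
  then have "\<exists>r. [s n * r = 1] (mod int p ^ n)" for n by (rule cong_solve_coprime_int)
  then obtain r where r: "\<And>n. [s n * r n = 1] (mod int p ^ n)" by metis
  define w where "w n = t n * r n" for n
  have sw: "[s n * w n = t n] (mod int p ^ n)" for n
    using cong_scalar_left[OF r, of "t n" n] by (simp add: w_def mult_ac)
  have "[w (Suc n) = w n] (mod int p ^ n)" for n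
  proof -
    have "[s n * w (Suc n) = s (Suc n) * w (Suc n)] (mod int p ^ n)"
      using shift[OF x s, of n] by (intro cong_mult) (auto simp: cong_def)
    also have "[s (Suc n) * w (Suc n) = t (Suc n)] (mod int p ^ n)"
      using sw[of "Suc n"] by (rule cong_dvd_modulus) simp
    also have "[t (Suc n) = t n] (mod int p ^ n)"
      using shift[OF y t, of n] by (simp add: cong_def)
    also have "[t n = s n * w n] (mod int p ^ n)" using sw by (rule cong_sym)
    finally show ?thesis using cop cong_mult_lcancel by blast
  qed
  then have w: "(\<lambda>n. w n mod int p ^ n) \<in> padic_ints p"
    by (intro padic_intsI[OF p]) (simp add: cong_def)
  have "[y n = x n * (w n mod int p ^ n)] (mod int p ^ n)" for n
  proof -
    have "[y n = int p ^ v * t n] (mod int p ^ n)"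
      unfolding t using padic_ints_mod_power[OF y, of n "n + v"] padic_ints_mod(2)[OF y]
      by (simp add: cong_def)
    also have "[int p ^ v * t n = int p ^ v * (s n * w n)] (mod int p ^ n)"
      by (rule cong_scalar_left[OF cong_sym[OF sw]])
    also have "int p ^ v * (s n * w n) = x (n + v) * w n" by (simp flip: s)
    also have "[x (n + v) * w n = x n * (w n mod int p ^ n)] (mod int p ^ n)"
      using padic_ints_mod_power[OF x, of n "n + v"] padic_ints_mod(2)[OF x]
      by (intro cong_mult) (auto simp: cong_def)
    finally show ?thesis .
  qed
  then have prod: "y n = x n * (w n mod int p ^ n) mod int p ^ n" for n
    using padic_ints_mod(2)[OF y] by (simp add: cong_def)
  have nonzero: "n = 0" if "\<And>n. y n = 0 \<Longrightarrow> x n = 0" "w n mod int p ^ n = 0" for n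
  proof (rule ccontr)
    assume n: "n \<noteq> 0"
    have "int p ^ n dvd t n"
      using sw[of n] that(2) mod_mult_right_eq[of "s n" "w n" "int p ^ n"]
      by (simp add: cong_def mod_eq_0_iff_dvd)
    moreover have "int p dvd int p ^ n" using n by simp
    ultimately have "int p dvd t n" by (rule dvd_trans[rotated])
    moreover have "y (Suc v) \<noteq> 0" using that(1) xv1 by blast
    ultimately show False using ndvd[OF y t _, of n] n by simp
  qed
  show thesis
  proof (rule that[OF w prod])
    fix n assume "\<And>n. y n = 0 \<Longrightarrow> x n = 0" "w n mod int p ^ n = 0"
    then show "n = 0" by (rule nonzero)
  qed
qed

lemma zhat_dvdI:
  assumes "\<And>p n. prime p \<Longrightarrow> component x p n = 0 \<Longrightarrow> component y p n = 0"
  shows "x dvd y"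
proof -
  have "\<exists>w. w \<in> padic_ints p \<and> (\<forall>n. component y p n = component x p n * w n mod int p ^ n)"
    if p: "prime p" for p
    by (rule padic_quotient[OF p component_padic[OF p, of x] component_padic[OF p, of y] assms[OF p]]) auto
  then obtain w where w: "\<And>p. prime p \<Longrightarrow> w p \<in> padic_ints p"
    "\<And>p n. prime p \<Longrightarrow> component y p n = component x p n * w p n mod int p ^ n"
    by metis
  obtain z where "\<And>p. prime p \<Longrightarrow> component z p = w p"
    using zhat_with_components[OF w(1)] by blast
  then have "y = x * z" by (intro zhat_eqI) (simp add: component_mult w)
  then show ?thesis by simp
qed

text \<open>Mutual divisibility does not give a unit by cancellation, because \<open>zhat\<close> has zero divisors. The
unit is chosen prime by prime instead.\<close>

lemma zhat_associated:
  assumes zeros: "\<And>p n. prime p \<Longrightarrow> component x p n = 0 \<longleftrightarrow> component y p n = 0"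
  obtains u where "u dvd 1" "y = u * x"
proof -
  have "\<exists>w. w \<in> padic_ints p \<and> (\<forall>n. component y p n = component x p n * w n mod int p ^ n) \<and>
    (\<forall>n. w n = 0 \<longrightarrow> n = 0)" if p: "prime p" for p
    using zeros[OF p]
    by (rule_tac padic_quotient[OF p component_padic[OF p, of x] component_padic[OF p, of y]]) auto
  then obtain w where w: "\<And>p. prime p \<Longrightarrow> w p \<in> padic_ints p"
    "\<And>p n. prime p \<Longrightarrow> component y p n = component x p n * w p n mod int p ^ n"
    "\<And>p n. prime p \<Longrightarrow> w p n = 0 \<Longrightarrow> n = 0"
    by metis
  obtain u where u: "\<And>p. prime p \<Longrightarrow> component u p = w p"
    using zhat_with_components[OF w(1)] by blast
  have "y = x * u" by (intro zhat_eqI) (simp add: component_mult w u)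
  moreover have "u dvd 1"
  proof (rule zhat_dvdI)
    fix p n assume "prime p" "component u p n = 0"
    then show "component 1 p n = 0" using w(3)[of p n] u by (simp add: component_one)
  qed
  ultimately show thesis using that by (simp add: mult.commute)
qed

lemma of_nat_dvd_zhat_iff:
  assumes "a > 0"
  shows "of_nat a dvd z \<longleftrightarrow> (\<forall>p n. prime p \<longrightarrow> p ^ n dvd a \<longrightarrow> component z p n = 0)"
proof
  assume "of_nat a dvd z"
  then obtain w where "z = of_nat a * w" ..
  moreover have "int a * y mod int p ^ n = 0" if "p ^ n dvd a" for p n y
    using that by (metis dvd_mult2 mod_eq_0_iff_dvd of_nat_dvd_iff of_nat_power)
  ultimately show "\<forall>p n. prime p \<longrightarrow> p ^ n dvd a \<longrightarrow> component z p n = 0"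
    by (auto simp: component_mult component_of_nat mod_simps)
next
  assume "\<forall>p n. prime p \<longrightarrow> p ^ n dvd a \<longrightarrow> component z p n = 0"
  then show "of_nat a dvd z"
    by (intro zhat_dvdI) (auto simp: component_of_nat mod_eq_0_iff_dvd simp flip: of_nat_power)
qed

text \<open>The divisor set plays the role of the supernatural number of \<open>z\<close>: it records all valuations of \<open>z\<close>,
including infinite ones.\<close>

definition divs :: "zhat \<Rightarrow> nat set" where
  "divs z = {a. a > 0 \<and> of_nat a dvd z}"

lemma divs_pos: "a \<in> divs z \<Longrightarrow> a > 0"
  by (simp add: divs_def)

lemma one_in_divs [simp]: "1 \<in> divs z" "Suc 0 \<in> divs z"
  by (simp_all add: divs_def)

lemma divs_dvd:
  assumes "a \<in> divs z" "b dvd a"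
  shows "b \<in> divs z"
proof -
  from assms(2) obtain c where "a = b * c" ..
  then show ?thesis using assms(1) dvd_mult_left[of "of_nat b" "of_nat c" z] by (simp add: divs_def)
qed

lemma divs_lcm:
  assumes "a \<in> divs z" "b \<in> divs z"
  shows "lcm a b \<in> divs z"
proof -
  have pos: "a > 0" "b > 0" using assms by (auto simp: divs_def)
  have "p ^ n dvd a \<or> p ^ n dvd b" if "prime p" "p ^ n dvd lcm a b" for p n
  proof -
    have "p ^ n dvd x \<longleftrightarrow> n \<le> multiplicity p x" if "x > 0" for x
      using that \<open>prime p\<close> by (intro power_dvd_iff_le_multiplicity) (auto simp: prime_gt_1_nat)
    then show ?thesis
      using that pos multiplicity_lcm[of a b p] by (simp add: lcm_pos_nat le_max_iff_disj)
  qed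
  moreover have "component z p n = 0" if "prime p" "p ^ n dvd a \<or> p ^ n dvd b" for p n
    using assms pos that of_nat_dvd_zhat_iff[of a z] of_nat_dvd_zhat_iff[of b z]
    unfolding divs_def by blast
  moreover have "lcm a b > 0" using pos by (simp add: lcm_pos_nat)
  ultimately show ?thesis
    using of_nat_dvd_zhat_iff[of "lcm a b" z] unfolding divs_def by blast
qed

lemma prime_power_in_divs:
  assumes "prime p"
  shows "p ^ n \<in> divs z \<longleftrightarrow> component z p n = 0"
proof -
  have "component z q m = 0" if "component z p n = 0" "prime q" "q ^ m dvd p ^ n" for q m
  proof (cases "m = 0")
    case True
    then show ?thesis using component_bounds[OF that(2), of z 0] by simp
  next
    case False
    then have "q dvd p" using that assms by (meson dvd_power dvd_trans neq0_conv prime_dvd_power)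
    then have "q = p" using that(2) assms primes_dvd_imp_eq by blast
    moreover from this have "m \<le> n" using that assms prime_gt_1_nat by (metis power_dvd_imp_le)
    ultimately show ?thesis
      using padic_ints_mod_power[OF component_padic[OF assms], of m n z] that by simp
  qed
  then show ?thesis
    using assms of_nat_dvd_zhat_iff[of "p ^ n" z] prime_gt_0_nat[OF assms] by (auto simp: divs_def)
qed

lemma divs_eq_imp_associated:
  assumes "divs x = divs y"
  obtains u where "u dvd 1" "y = u * x"
  using zhat_associated[of x y] assms prime_power_in_divs by metis

text \<open>Multiplication by \<open>k\<close> raises the valuation at \<open>p\<close> by \<open>v = multiplicity p k\<close>, so a component of \<open>w\<close>
at \<open>n\<close> can be read off from the component of \<open>k * w\<close> at \<open>n + v\<close>.\<close>

lemma of_nat_mult_cancel: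
  assumes k: "k > 0" and eq: "of_nat k * x = of_nat k * (y :: zhat)"
  shows "x = y"
proof -
  define w where "w = x - y"
  have w0: "of_nat k * w = 0" using eq by (simp add: w_def algebra_simps)
  have "component w p n = component 0 p n" if p: "prime p" for p n
  proof -
    define v where "v = multiplicity (int p) (int k)"
    define c where "c = component w p (n + v)"
    have pp: "prime (int p)" using p by simp
    have "int k * c mod int p ^ (n + v) = 0"
      using arg_cong[OF w0, of "\<lambda>x. component x p (n + v)"] p
      by (simp add: component_mult component_of_nat zero_zhat.rep_eq c_def mod_simps)
    then have dvd: "int p ^ (n + v) dvd int k * c" by (simp add: mod_eq_0_iff_dvd)
    have "int p ^ n dvd c"
    proof (cases "c = 0")
      case False
      have "multiplicity (int p) (int k * c) = v + multiplicity (int p) c"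
        using False k pp by (simp add: prime_elem_multiplicity_mult_distrib v_def)
      then have "n \<le> multiplicity (int p) c"
        using multiplicity_geI[OF _ _ dvd] False k prime_gt_1_nat[OF p] by simp
      then show ?thesis by (rule multiplicity_dvd')
    qed simp
    then have "component w p n = 0"
      using padic_ints_mod_power[OF component_padic[OF p], of n "n + v" w] by (simp add: c_def)
    then show ?thesis using p by (simp add: zero_zhat.rep_eq)
  qed
  then have "w = 0" by (rule zhat_eqI)
  then show ?thesis by (simp add: w_def)
qed

lemma in_divs_mult_iff:
  assumes "k > 0"
  shows "k * a \<in> divs (of_nat k * z) \<longleftrightarrow> a \<in> divs z"
proof
  assume "k * a \<in> divs (of_nat k * z)"
  then obtain w where "a > 0" "of_nat k * z = of_nat k * (of_nat a * w)"
    by (auto simp: divs_def mult.assoc elim!: dvdE)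
  moreover from this have "z = of_nat a * w" using of_nat_mult_cancel[OF assms] by blast
  ultimately show "a \<in> divs z" by (simp add: divs_def)
next
  assume "a \<in> divs z"
  then show "k * a \<in> divs (of_nat k * z)" using assms by (auto simp: divs_def mult_dvd_mono)
qed

text \<open>After cancelling \<open>gcd a t\<close>, a divisor of a multiple of \<open>y\<close> that is coprime to the multiplier divides
\<open>y\<close>, by a Bezout identity.\<close>

lemma divs_of_nat_multD:
  assumes "a \<in> divs (of_nat t * y)" "t > 0"
  shows "a div gcd a t \<in> divs y"
proof -
  define g where "g = gcd a t"
  have g: "g > 0" using assms(2) by (simp add: g_def)
  obtain a' t' where a': "a = g * a'" and t': "t = g * t'" by (metis dvd_def g_def gcd_dvd1 gcd_dvd2)
  have cop: "coprime a' t'"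
    using g a' t' by (metis g_def div_gcd_coprime less_numeral_extra(3) nonzero_mult_div_cancel_left gcd_eq_0_iff)
  have "g * a' \<in> divs (of_nat g * (of_nat t' * y))" using assms(1) by (simp add: a' t' mult.assoc)
  then have dvd: "of_nat a' dvd of_nat t' * y" and pos: "a' > 0"
    unfolding in_divs_mult_iff[OF g] by (auto simp: divs_def)
  obtain r s where "r * int a' + s * int t' = 1"
    using cop bezout_int[of "int a'" "int t'"] by (metis coprime_imp_gcd_eq_1 coprime_int_iff)
  then have "of_int (r * int a' + s * int t') = (1 :: zhat)" by simp
  then have "y = (of_int r * of_nat a' + of_int s * of_nat t') * y" by simp
  then have "y = of_nat a' * (of_int r * y) + of_int s * (of_nat t' * y)" by (simp add: algebra_simps)
  moreover have "of_nat a' dvd of_nat a' * (of_int r * y) + of_int s * (of_nat t' * y)"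
    by (intro dvd_add[OF dvd_triv_left dvd_mult[OF dvd]])
  ultimately have "of_nat a' dvd y" by metis
  moreover have "a div gcd a t = a'" using g a' by (metis g_def nonzero_mult_div_cancel_left less_numeral_extra(3))
  ultimately show ?thesis using pos by (simp add: divs_def)
qed

lemma in_set_if_prime_powers_in_set:
  fixes S :: "nat set"
  assumes "1 \<in> S" and lcm: "\<And>a b. a \<in> S \<Longrightarrow> b \<in> S \<Longrightarrow> lcm a b \<in> S"
  shows "a > 0 \<Longrightarrow> (\<And>p n. prime p \<Longrightarrow> p ^ n dvd a \<Longrightarrow> p ^ n \<in> S) \<Longrightarrow> a \<in> S"
proof (induction a rule: less_induct)
  case (less a)
  show ?case
  proof (cases "a = 1")
    case False
    then obtain p where p: "prime p" "p dvd a" using prime_factor_nat by blast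
    obtain b where b: "a = p ^ multiplicity p a * b" "\<not> p dvd b"
      using multiplicity_decompose'[of a p] less.prems(1) p(1) by (metis not_prime_unit bot_nat_0.not_eq_extremum)
    have mpos: "multiplicity p a > 0"
      using p less.prems(1) by (metis b dvd_mult gr0I mult_1 power_0)
    have "b > 0" using b less.prems(1) by (metis gr0I mult_0_right less_irrefl)
    moreover from this have "b < a"
      using b(1) p(1) mpos
      by (metis mult_less_cancel2 mult_1 one_less_power prime_gt_1_nat)
    moreover have "q ^ n \<in> S" if "prime q" "q ^ n dvd b" for q n
      using that b(1) less.prems(2) by (metis dvd_mult)
    ultimately have "b \<in> S" using less.IH by blast
    moreover have "p ^ multiplicity p a \<in> S" using less.prems(2) p(1) multiplicity_dvd by blast
    moreover have "coprime (p ^ multiplicity p a) b"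
      using p(1) b(2) by (simp add: prime_imp_coprime)
    ultimately show ?thesis
      using lcm b(1) by (metis lcm_coprime normalize_nat_def id_apply)
  qed (use assms in simp)
qed

text \<open>At each prime, take the power of \<open>p\<close> whose exponent is the number of positive \<open>i\<close> with \<open>p ^ i \<in> S\<close>. Cutting this
count off at \<open>n\<close> changes nothing modulo \<open>p ^ n\<close> and makes sense also when all powers of \<open>p\<close> belong
to \<open>S\<close>, where the component is \<open>0\<close>.\<close>

lemma exists_zhat_with_divs:
  assumes one: "1 \<in> S" and pos: "\<And>a. a \<in> S \<Longrightarrow> a > 0"
    and dvd: "\<And>a b. a \<in> S \<Longrightarrow> b dvd a \<Longrightarrow> b \<in> S"
    and lcm: "\<And>a b. a \<in> S \<Longrightarrow> b \<in> S \<Longrightarrow> lcm a b \<in> S"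
  obtains z where "divs z = S"
proof -
  define e where "e p n = card {i \<in> {1..n}. p ^ i \<in> S}" for p n :: nat
  define f where "f p n = int p ^ e p n mod int p ^ n" for p n
  have e_full: "e p n = n" if "p ^ n \<in> S" for p n
  proof -
    have "p ^ i \<in> S" if "i \<le> n" for i
      using dvd[OF \<open>p ^ n \<in> S\<close>] that by (simp add: le_imp_power_dvd)
    then have "{i \<in> {1..n}. p ^ i \<in> S} = {1..n}" by auto
    then show ?thesis by (simp add: e_def)
  qed
  have e_le: "e p n \<le> n" for p n
  proof -
    have "e p n \<le> card {1..n}" unfolding e_def by (intro card_mono) auto
    then show ?thesis by simp
  qed
  have e_less: "e p n < n" if "p ^ n \<notin> S" for p n
  proof -
    have "n \<noteq> 0" using that one by (metis power_0)
    then have "n \<in> {1..n} - {i \<in> {1..n}. p ^ i \<in> S}" using that by simp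
    then have "{i \<in> {1..n}. p ^ i \<in> S} \<subset> {1..n}" by blast
    then have "card {i \<in> {1..n}. p ^ i \<in> S} < card {1..n}" by (intro psubset_card_mono) auto
    then show ?thesis by (simp add: e_def)
  qed
  have e_Suc: "e p (Suc n) = e p n" if "p ^ Suc n \<notin> S" for p n
  proof -
    have "{i \<in> {1..Suc n}. p ^ i \<in> S} = {i \<in> {1..n}. p ^ i \<in> S}"
      using that by (auto simp: le_Suc_eq simp del: power_Suc)
    then show ?thesis by (simp add: e_def)
  qed
  have "f p \<in> padic_ints p" if p: "prime p" for p
    unfolding f_def
  proof (rule padic_intsI[OF p])
    fix n
    show "int p ^ e p (Suc n) mod int p ^ n = int p ^ e p n mod int p ^ n"
    proof (cases "p ^ Suc n \<in> S")
      case True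
      then have "p ^ n \<in> S" by (rule dvd) simp
      then show ?thesis using True by (simp only: e_full) simp
    qed (simp add: e_Suc)
  qed
  then obtain z where z: "\<And>p. prime p \<Longrightarrow> component z p = f p"
    using zhat_with_components[of f] by blast
  have zero: "component z p n = 0 \<longleftrightarrow> p ^ n \<in> S" if p: "prime p" for p n
  proof
    assume "component z p n = 0"
    then have "int p ^ n dvd int p ^ e p n" using z[OF p] by (simp add: f_def mod_eq_0_iff_dvd)
    then have "p ^ n dvd p ^ e p n" by (simp flip: of_nat_power)
    then have "n \<le> e p n" using prime_gt_1_nat[OF p] by (rule power_dvd_imp_le)
    then show "p ^ n \<in> S" using e_less[of p n] by (meson not_less)
  next
    assume "p ^ n \<in> S"
    then have "e p n = n" by (rule e_full)
    then show "component z p n = 0" by (simp add: z p f_def)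
  qed
  have "divs z = S"
  proof (intro equalityI subsetI)
    fix a assume a: "a \<in> divs z"
    show "a \<in> S"
    proof (rule in_set_if_prime_powers_in_set[OF one lcm])
      show "p ^ n \<in> S" if "prime p" "p ^ n dvd a" for p n
        using divs_dvd[OF a that(2)] prime_power_in_divs[OF that(1)] zero[OF that(1)] by simp
    qed (use divs_pos[OF a] in simp_all)
  next
    fix a assume "a \<in> S"
    then show "a \<in> divs z"
      using pos[of a] dvd[of a] zero of_nat_dvd_zhat_iff[of a z] unfolding divs_def by blast
  qed
  then show thesis using that by blast
qed

section \<open>Classes of profinite integers\<close>

lemma equiv_zhat_rel: "equiv UNIV zhat_rel"
  unfolding zhat_rel_def
  by (auto intro!: equivI refl_onI symI transI intro: equivclp_sym equivclp_trans)

lemma zhat_relI: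
  assumes "b > 0" "t > 0" "u dvd 1" "of_nat b * z = u * (of_nat t * z')"
  shows "(z, z') \<in> zhat_rel"
proof -
  have "zhat_step z (of_nat b * z)" "zhat_step z' (of_nat t * z')"
    "zhat_step (of_nat t * z') (of_nat b * z)"
    using assms by (auto simp: zhat_step_def mult.commute)
  then show ?thesis
    unfolding zhat_rel_def mem_Collect_eq prod.case
    by (meson equivclp_sym equivclp_trans r_into_equivclp)
qed

lemma zhat_rel_invariant:
  assumes "(z, z') \<in> zhat_rel"
    and unit: "\<And>u z. u dvd 1 \<Longrightarrow> h (u * z) = h z" and mult: "\<And>n z. n > 0 \<Longrightarrow> h (of_nat n * z) = h z"
  shows "h z = h z'"
proof -
  have "equivclp zhat_step z z'" using assms(1) by (simp add: zhat_rel_def)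
  then show ?thesis
  proof (induction rule: equivclp_induct)
    case (step y x)
    have "h a = h b" if "zhat_step a b" for a b
      using that unit mult by (auto simp: zhat_step_def mult.commute)
    then show ?case using step by metis
  qed simp
qed

lemma bij_betw_quotient:
  assumes iff: "\<And>z z'. (z, z') \<in> r \<longleftrightarrow> g z = g z'" and Q: "range g = Q"
  shows "\<exists>\<Theta>. bij_betw \<Theta> (UNIV // r) Q \<and> (\<forall>z. \<Theta> (r `` {z}) = g z)"
proof (intro exI conjI allI)
  define \<Theta> where "\<Theta> C = g (SOME z. z \<in> C)" for C
  have \<Theta>: "\<Theta> (r `` {z}) = g z" for z
  proof -
    have "z \<in> r `` {z}" using iff by blast
    then have "(SOME y. y \<in> r `` {z}) \<in> r `` {z}" by (rule someI)
    then show ?thesis using iff by (auto simp: \<Theta>_def)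
  qed
  then show "\<Theta> (r `` {z}) = g z" for z .
  have quot: "UNIV // r = range (\<lambda>z. r `` {z})" by (auto simp: quotient_def)
  have "C = C'" if "C \<in> UNIV // r" "C' \<in> UNIV // r" "\<Theta> C = \<Theta> C'" for C C'
    using that by (auto simp: quotient_def \<Theta> iff)
  moreover have "\<Theta> ` (UNIV // r) = Q"
    using \<Theta> Q by (simp add: quot image_image)
  ultimately show "bij_betw \<Theta> (UNIV // r) Q" by (auto simp: bij_betw_def inj_on_def)
qed

section \<open>Finite adeles up to units and rationals\<close>

text \<open>For \<open>N\<close> divisible by all denominators that occur, this is the image of \<open>N\<close> times the given formal
sum of pairs under \<open>(z, k) \<mapsto> z k\<close>, and so it vanishes on the bilinearity relations.\<close>

definition scaled_total :: "int \<Rightarrow> ((zhat \<times> rat) \<Rightarrow>\<^sub>0 int) \<Rightarrow> zhat" where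
  "scaled_total N x =
     (\<Sum>k\<in>Poly_Mapping.keys x. of_int (Poly_Mapping.lookup x k) * (fst k * of_int \<lfloor>of_int N * snd k\<rfloor>))"

lemma scaled_total_superset:
  assumes "finite K" "Poly_Mapping.keys x \<subseteq> K"
  shows "scaled_total N x =
     (\<Sum>k\<in>K. of_int (Poly_Mapping.lookup x k) * (fst k * of_int \<lfloor>of_int N * snd k\<rfloor>))"
  unfolding scaled_total_def using assms
  by (intro sum.mono_neutral_left) (auto simp: in_keys_iff)

lemma scaled_total_diff: "scaled_total N (x - y) = scaled_total N x - scaled_total N y"
proof -
  let ?K = "Poly_Mapping.keys x \<union> Poly_Mapping.keys y"
  have "Poly_Mapping.keys (x - y) \<subseteq> ?K" by (rule keys_diff)
  then show ?thesis
    by (simp add: scaled_total_superset[of ?K] lookup_minus left_diff_distrib sum_subtractf)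
qed

lemma scaled_total_of: "scaled_total N (frag_of (z, q)) = z * of_int \<lfloor>of_int N * q\<rfloor>"
  by (simp add: scaled_total_def)

lemma rat_denominator:
  obtains n m :: int where "n > 0" "of_int n * (q :: rat) = of_int m"
proof (cases q rule: Rat_cases_nonzero)
  case (Fract a b)
  then show thesis using that[of b a] by (simp add: Fract_of_int_quotient)
next
  case 0
  then show thesis using that[of 1 0] by simp
qed

lemma floor_of_multiple:
  assumes "of_int n * (q :: rat) = of_int m" "n dvd N"
  obtains k where "of_int N * q = of_int k"
proof -
  obtain c where "N = n * c" using assms(2) ..
  then have "of_int N * q = of_int (c * m)" using assms(1) by (simp add: mult_ac)
  then show thesis by (rule that)
qed

text \<open>Bilinearity in the second argument is lost by rounding down, but only for those \<open>N\<close> that fail to clear the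
denominators.\<close>

lemma scaled_total_tensor_relation:
  assumes "x \<in> tensor_relations"
  shows "\<exists>n>0. \<forall>N. n dvd N \<longrightarrow> scaled_total N x = 0"
  using assms
proof induction
  case zero
  show ?case by (intro exI[of _ 1]) (simp add: scaled_total_def)
next
  case (left z z' q)
  have "scaled_total N (frag_of (z + z', q) - frag_of (z, q) - frag_of (z', q)) = 0" for N
    unfolding scaled_total_diff scaled_total_of by (simp only: distrib_right add_diff_cancel_left' diff_self)
  then show ?case by (intro exI[of _ 1]) simp
next
  case (right z q q')
  obtain n m where n: "n > 0" "of_int n * q = of_int m" by (rule rat_denominator)
  obtain n' m' where n': "n' > 0" "of_int n' * q' = of_int m'" by (rule rat_denominator)
  have "scaled_total N (frag_of (z, q + q') - frag_of (z, q) - frag_of (z, q')) = 0"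
    if N: "n * n' dvd N" for N
  proof -
    obtain k where k: "of_int N * q = of_int k"
      by (rule floor_of_multiple[OF n(2) dvd_mult_left[OF N]])
    obtain k' where k': "of_int N * q' = of_int k'"
      by (rule floor_of_multiple[OF n'(2) dvd_mult_right[OF N]])
    have "of_int N * (q + q') = of_int (k + k')" using k k' by (simp add: distrib_left)
    then show ?thesis
      by (simp only: scaled_total_diff scaled_total_of k k' floor_of_int) (simp add: algebra_simps)
  qed
  moreover have "n * n' > 0" using n(1) n'(1) by simp
  ultimately show ?case by blast
next
  case (diff x y)
  then obtain n n' where "n > 0" "\<And>N. n dvd N \<Longrightarrow> scaled_total N x = 0"
    "n' > 0" "\<And>N. n' dvd N \<Longrightarrow> scaled_total N y = 0" by blast
  then show ?case
    by (intro exI[of _ "n * n'"]) (auto simp: scaled_total_diff dest: dvd_mult_left dvd_mult_right)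
qed

lemma pure_tensor_eqD:
  assumes "pure_tensor z q = pure_tensor z' q'"
  obtains n where "n > 0" "\<And>N. n dvd N \<Longrightarrow> z * of_int \<lfloor>of_int N * q\<rfloor> = z' * of_int \<lfloor>of_int N * q'\<rfloor>"
proof -
  have "frag_of (z, q) - frag_of (z', q') \<in> tensor_relations"
    using assms by (simp add: pure_tensor.abs_eq finite_adele.abs_eq_iff tensor_eq_def)
  then obtain n where "n > 0"
    "\<And>N. n dvd N \<Longrightarrow> scaled_total N (frag_of (z, q) - frag_of (z', q')) = 0"
    using scaled_total_tensor_relation by blast
  then show thesis by (intro that) (auto simp: scaled_total_diff scaled_total_of)
qed

lemma tensor_eq_sym: "tensor_eq x y \<Longrightarrow> tensor_eq y x"
  unfolding tensor_eq_def using tensor_relations_uminus by fastforce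

lemma tensor_eq_trans [trans]: "tensor_eq x y \<Longrightarrow> tensor_eq y z \<Longrightarrow> tensor_eq x z"
  unfolding tensor_eq_def using tensor_relations_add by fastforce

lemma tensor_eq_diff:
  assumes "tensor_eq x y" "tensor_eq x' y'"
  shows "tensor_eq (x - x') (y - y')"
  using tensor_relations.diff[OF assms[unfolded tensor_eq_def]]
  by (simp add: tensor_eq_def algebra_simps)

lemma tensor_eq_diff_left: "tensor_eq (frag_of (z, q) - frag_of (z', q)) (frag_of (z - z', q))"
proof -
  have "frag_of (z - z' + z', q) - frag_of (z - z', q) - frag_of (z', q) \<in> tensor_relations"
    by (rule tensor_relations.left)
  then show ?thesis by (simp add: tensor_eq_def algebra_simps)
qed

lemma tensor_eq_diff_right: "tensor_eq (frag_of (z, q) - frag_of (z, q')) (frag_of (z, q - q'))"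
proof -
  have "frag_of (z, q - q' + q') - frag_of (z, q - q') - frag_of (z, q') \<in> tensor_relations"
    by (rule tensor_relations.right)
  then show ?thesis by (simp add: tensor_eq_def algebra_simps)
qed

lemma tensor_eq_0: "tensor_eq (frag_of (z, 0)) 0" "tensor_eq (frag_of (0, q)) 0"
  using tensor_eq_diff_right[of z 0 0] tensor_eq_diff_left[of 0 q 0]
  by (auto simp: intro: tensor_eq_sym)

lemma tensor_eq_nat_swap: "tensor_eq (frag_of (of_nat n * z, q)) (frag_of (z, of_nat n * q))"
proof (induction n)
  case 0
  show ?case using tensor_eq_trans[OF tensor_eq_0(2) tensor_eq_sym[OF tensor_eq_0(1)]] by simp
next
  case (Suc n)
  have 1: "tensor_eq (frag_of (of_nat (Suc n) * z, q) - frag_of (z, q)) (frag_of (of_nat n * z, q))"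
    using tensor_eq_diff_left[of "of_nat (Suc n) * z" q z] by (simp add: algebra_simps)
  have 2: "tensor_eq (frag_of (z, of_nat (Suc n) * q) - frag_of (z, q)) (frag_of (z, of_nat n * q))"
    using tensor_eq_diff_right[of z "of_nat (Suc n) * q" q] by (simp add: algebra_simps)
  show ?case
    using tensor_eq_trans[OF tensor_eq_trans[OF 1 Suc] tensor_eq_sym[OF 2]]
    by (simp add: tensor_eq_def)
qed

lemma tensor_eq_common_denominator:
  assumes "n > 0"
  shows "tensor_eq (frag_of (z, 1 / of_nat m)) (frag_of (of_nat n * z, 1 / of_nat (n * m)))"
  using tensor_eq_sym[OF tensor_eq_nat_swap[of n z "1 / of_nat (n * m)"]] assms by simp

text \<open>Common denominators: an integer factor can be moved across the tensor sign, so a pure tensor is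
\<open>z \<otimes> (1/n)\<close>, and two of these with the same \<open>n\<close> can be subtracted.\<close>

lemma adele_pure:
  obtains z n where "n > 0" "x = pure_tensor z (1 / of_nat n)"
proof -
  have single: "\<exists>z' n. n > 0 \<and> tensor_eq (frag_of (z, q)) (frag_of (z', 1 / of_nat n))" for z q
  proof -
    obtain b a :: int where b: "b > 0" and a: "of_int b * q = of_int a" by (rule rat_denominator)
    define n where "n = nat b"
    have n: "n > 0" "q = of_int a / of_nat n" using b a by (auto simp: n_def field_simps)
    show ?thesis
    proof (cases a)
      case (nonneg k)
      then have "tensor_eq (frag_of (z, q)) (frag_of (of_nat k * z, 1 / of_nat n))"
        using tensor_eq_sym[OF tensor_eq_nat_swap[of k z "1 / of_nat n"]] n(2) by simp
      then show ?thesis using n(1) by blast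
    next
      case (neg k)
      have "tensor_eq (frag_of (z, 0 - of_nat (Suc k) * (1 / of_nat n)))
          (frag_of (z, 0) - frag_of (z, of_nat (Suc k) * (1 / of_nat n)))"
        by (rule tensor_eq_sym[OF tensor_eq_diff_right])
      also have "tensor_eq \<dots> (frag_of (0, 1 / of_nat n) - frag_of (of_nat (Suc k) * z, 1 / of_nat n))"
        by (intro tensor_eq_diff tensor_eq_sym[OF tensor_eq_nat_swap]
            tensor_eq_trans[OF tensor_eq_0(1) tensor_eq_sym[OF tensor_eq_0(2)]])
      also have "tensor_eq \<dots> (frag_of (0 - of_nat (Suc k) * z, 1 / of_nat n))"
        by (rule tensor_eq_diff_left)
      also have "0 - of_nat (Suc k) * (1 / of_nat n) = q"
        using n neg by (simp add: divide_simps)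
      finally have "tensor_eq (frag_of (z, q)) (frag_of (0 - of_nat (Suc k) * z, 1 / of_nat n))" .
      then show ?thesis using n(1) by blast
    qed
  qed
  have "\<exists>z n. n > 0 \<and> tensor_eq c (frag_of (z, 1 / of_nat n))" for c
  proof (induction c rule: frag_induction[OF subset_UNIV])
    case 1
    show ?case using tensor_eq_sym[OF tensor_eq_0(1)] tensor_eq_sym[OF tensor_eq_0(2)[of 1]]
      by (intro exI[of _ 0] exI[of _ 1]) simp
  next
    case (2 x)
    show ?case using single[of "fst x" "snd x"] by simp
  next
    case (3 a b)
    then obtain z n z' n' where n: "n > 0" "n' > 0"
      and a: "tensor_eq a (frag_of (z, 1 / of_nat n))" and b: "tensor_eq b (frag_of (z', 1 / of_nat n'))"
      by blast
    have "tensor_eq (a - b) (frag_of (of_nat n' * z, 1 / of_nat (n' * n)) - frag_of (of_nat n * z', 1 / of_nat (n' * n)))"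
      using tensor_eq_trans[OF a tensor_eq_common_denominator[OF n(2)]]
        tensor_eq_trans[OF b tensor_eq_common_denominator[OF n(1)]]
      by (intro tensor_eq_diff) (simp_all add: mult.commute)
    from tensor_eq_trans[OF this tensor_eq_diff_left] show ?case
      using n by (intro exI[of _ "of_nat n' * z - of_nat n * z'"] exI[of _ "n' * n"]) simp
  qed
  moreover obtain c where "x = abs_finite_adele c"
    by (metis Quotient_abs_rep[OF Quotient_finite_adele])
  ultimately show thesis
    by (metis finite_adele.abs_eq_iff pure_tensor.abs_eq that)
qed

lemma adele_scale_pure: "adele_scale u q (pure_tensor z r) = pure_tensor (u * z) (r * q)"
  by (simp add: pure_tensor.abs_eq adele_scale.abs_eq)

lemma pure_tensor_nat_swap: "pure_tensor (of_nat n * z) q = pure_tensor z (of_nat n * q)"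
  using tensor_eq_nat_swap by (simp add: pure_tensor.abs_eq finite_adele.abs_eq_iff)

lemma adele_scale_rel: "u dvd 1 \<Longrightarrow> q \<noteq> 0 \<Longrightarrow> (x, adele_scale u q x) \<in> adele_rel"
  unfolding adele_rel_def by blast

lemma equiv_adele_rel: "equiv UNIV adele_rel"
proof (rule equivI)
  have 1: "adele_scale 1 1 x = x" for x
    by (rule adele_pure[of x]) (simp add: adele_scale_pure)
  have comp: "adele_scale u q (adele_scale u' q' x) = adele_scale (u * u') (q * q') x" for u q u' q' x
    by (rule adele_pure[of x]) (simp add: adele_scale_pure mult_ac)
  show "adele_rel \<subseteq> UNIV \<times> UNIV" by simp
  show "refl adele_rel"
    using adele_scale_rel[of 1 1] by (auto intro!: refl_onI simp: 1)
  show "sym adele_rel"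
  proof (rule symI)
    fix x y assume "(x, y) \<in> adele_rel"
    then obtain u q where uq: "u dvd 1" "q \<noteq> 0" "y = adele_scale u q x" by (auto simp: adele_rel_def)
    from uq(1) obtain v where v: "1 = u * v" ..
    then have "x = adele_scale v (inverse q) y" using uq(2,3) by (simp add: comp 1 mult.commute)
    moreover have "v dvd 1" using v by (metis dvd_triv_right)
    ultimately show "(y, x) \<in> adele_rel"
      using adele_scale_rel[of v "inverse q" y] uq(2) by simp
  qed
  show "trans adele_rel"
  proof (rule transI)
    fix x y z assume "(x, y) \<in> adele_rel" "(y, z) \<in> adele_rel"
    then obtain u q u' q' where "u dvd 1" "q \<noteq> 0" "u' dvd 1" "q' \<noteq> 0"
      "z = adele_scale u' q' (adele_scale u q x)" by (auto simp: adele_rel_def)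
    then show "(x, z) \<in> adele_rel"
      using adele_scale_rel[of "u' * u" "q' * q" x] mult_dvd_mono[of u' 1 u 1] by (simp add: comp)
  qed
qed

lemma pure_tensor_scaled_rel:
  assumes "u dvd 1" "q \<noteq> 0"
  shows "(pure_tensor z r, pure_tensor (u * z) (r * q)) \<in> adele_rel"
  using adele_scale_rel[OF assms, of "pure_tensor z r"] by (simp only: adele_scale_pure)

text \<open>A rational factor is a quotient of integers, and its sign is a unit of \<open>zhat\<close>. Clearing
denominators therefore leaves a unit and two positive integers.\<close>

lemma pure_tensor_rel_iff:
  "(pure_tensor z 1, pure_tensor z' 1) \<in> adele_rel \<longleftrightarrow> (z, z') \<in> zhat_rel"
proof
  assume "(z, z') \<in> zhat_rel"
  then have "adele_rel `` {pure_tensor z 1} = adele_rel `` {pure_tensor z' 1}"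
  proof (rule zhat_rel_invariant[where h = "\<lambda>z. adele_rel `` {pure_tensor z 1}"])
    show "adele_rel `` {pure_tensor (u * z) 1} = adele_rel `` {pure_tensor z 1}" if "u dvd 1" for u z
      using pure_tensor_scaled_rel[OF that one_neq_zero, of z 1]
      by (intro equiv_class_eq[OF equiv_adele_rel, symmetric]) (simp only: mult_1_right)
    show "adele_rel `` {pure_tensor (of_nat n * z) 1} = adele_rel `` {pure_tensor z 1}" if "n > 0" for n z
    proof (intro equiv_class_eq[OF equiv_adele_rel, symmetric])
      have "(pure_tensor z 1, pure_tensor (1 * z) (1 * of_nat n)) \<in> adele_rel"
        using that by (intro pure_tensor_scaled_rel) auto
      then show "(pure_tensor z 1, pure_tensor (of_nat n * z) 1) \<in> adele_rel"
        by (simp only: pure_tensor_nat_swap mult_1_left mult_1_right)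
    qed
  qed
  then show "(pure_tensor z 1, pure_tensor z' 1) \<in> adele_rel"
    by (rule eq_equiv_class_iff[OF equiv_adele_rel UNIV_I UNIV_I, THEN iffD1])
next
  assume "(pure_tensor z 1, pure_tensor z' 1) \<in> adele_rel"
  then obtain u q where uq: "u dvd 1" "q \<noteq> 0" "pure_tensor z' 1 = pure_tensor (u * z) q"
    unfolding adele_rel_def mem_Collect_eq prod.case adele_scale_pure mult_1_left by blast
  obtain n where n: "n > 0"
    "\<And>N. n dvd N \<Longrightarrow> z' * of_int \<lfloor>of_int N * (1 :: rat)\<rfloor> = u * z * of_int \<lfloor>of_int N * q\<rfloor>"
    by (rule pure_tensor_eqD[OF uq(3)]) simp
  obtain b a :: int where b: "b > 0" and a: "of_int b * q = of_int a" by (rule rat_denominator)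
  have "a \<noteq> 0" using a b uq(2) by auto
  have "of_int (n * b) * q = of_int (n * a)" using a by (simp add: mult.assoc)
  then have eq: "of_int (n * b) * z' = u * (of_int (n * a) * z)"
    using n(2)[of "n * b"] by (simp only: floor_of_int mult_1_right dvd_triv_left) (simp add: mult_ac)
  have "\<exists>v. v dvd 1 \<and> of_int (n * b) * z' = v * (of_int \<bar>n * a\<bar> * z)"
  proof (cases "n * a \<ge> 0")
    case True
    then show ?thesis using eq uq(1) by (intro exI[of _ u]) simp
  next
    case False
    then show ?thesis using eq uq(1) by (intro exI[of _ "- u"]) simp
  qed
  then obtain v where v: "v dvd 1" "of_int (n * b) * z' = v * (of_int \<bar>n * a\<bar> * z)" by blast
  have "of_int (n * b) = (of_nat (nat (n * b)) :: zhat)"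
    "of_int \<bar>n * a\<bar> = (of_nat (nat \<bar>n * a\<bar>) :: zhat)"
    using n(1) b by (simp_all only: of_nat_nat abs_ge_zero mult_nonneg_nonneg order_less_imp_le)
  with v(2) have eq': "of_nat (nat (n * b)) * z' = v * (of_nat (nat \<bar>n * a\<bar>) * z)" by argo
  have "nat (n * b) > 0" "nat \<bar>n * a\<bar> > 0" using n(1) b \<open>a \<noteq> 0\<close> by auto
  then have "(z', z) \<in> zhat_rel" using v(1) eq' by (rule zhat_relI)
  then show "(z, z') \<in> zhat_rel" using equiv_zhat_rel by (meson equivE symD)
qed

lemma adele_classes:
  "\<exists>\<Theta>. bij_betw \<Theta> (UNIV // zhat_rel) (UNIV // adele_rel) \<and>
     (\<forall>z. \<Theta> (zhat_rel `` {z}) = adele_rel `` {pure_tensor z 1})"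
proof (rule bij_betw_quotient)
  show "(z, z') \<in> zhat_rel \<longleftrightarrow> adele_rel `` {pure_tensor z 1} = adele_rel `` {pure_tensor z' 1}" for z z'
    by (simp only: eq_equiv_class_iff[OF equiv_adele_rel UNIV_I UNIV_I] pure_tensor_rel_iff)
  have "\<exists>z. adele_rel `` {x} = adele_rel `` {pure_tensor z 1}" for x
  proof -
    obtain z n where n: "n > 0" "x = pure_tensor z (1 / of_nat n)" by (rule adele_pure)
    then have "(pure_tensor z 1, x) \<in> adele_rel"
      using pure_tensor_scaled_rel[of 1 "1 / of_nat n" z 1] by simp
    from equiv_class_eq[OF equiv_adele_rel this] show ?thesis by (intro exI[of _ z]) simp
  qed
  moreover have "UNIV // adele_rel = range (\<lambda>x. adele_rel `` {x})"
    by (auto simp: quotient_def)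
  ultimately show "range (\<lambda>z. adele_rel `` {pure_tensor z 1}) = UNIV // adele_rel"
    by (simp only:) blast
qed

section \<open>Small sets\<close>

lemma universe_subset:
  assumes "set_universe U" "X \<in> U" "Y \<subseteq> X"
  shows "Y \<in> U"
  using assms subset_imp_lepoll unfolding set_universe_def by blast

lemma universe_code:
  fixes U :: "'u set set"
  assumes "set_universe U" "X \<in> U" "A \<lesssim> X"
  shows "\<exists>f :: 'a \<Rightarrow> 'u. inj_on f A \<and> f ` A \<in> U"
proof -
  obtain f where "inj_on f A" "f ` A \<subseteq> X" using assms(3) unfolding lepoll_def by blast
  then show ?thesis using universe_subset[OF assms(1,2)] by blast
qed

lemma universe_nat:
  assumes "set_universe U"
  obtains X where "X \<in> U" "(UNIV :: nat set) \<lesssim> X"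
proof -
  from assms obtain X where "X \<in> U" "infinite X" unfolding set_universe_def by blast
  then show thesis using that infinite_le_lepoll by blast
qed

lemma universe_code_countable:
  fixes U :: "'u set set"
  assumes "set_universe U" "countable A"
  shows "\<exists>f :: 'a \<Rightarrow> 'u. inj_on f A \<and> f ` A \<in> U"
proof -
  obtain X where X: "X \<in> U" "(UNIV :: nat set) \<lesssim> X" by (rule universe_nat[OF assms(1)])
  have "A \<lesssim> (UNIV :: nat set)"
    using assms(2) unfolding countable_def lepoll_def by blast
  then show ?thesis using universe_code[OF assms(1) X(1)] lepoll_trans X(2) by blast
qed

lemma universe_times:
  assumes "set_universe U" "X \<in> U" "A \<lesssim> X" "Y \<in> U" "B \<lesssim> Y"
  obtains Z where "Z \<in> U" "A \<times> B \<lesssim> Z"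
proof -
  obtain Z where Z: "Z \<in> U" "X \<times> Y \<lesssim> Z"
    using assms(1,2,4) unfolding set_universe_def by blast
  then show thesis using that lepoll_trans[OF times_lepoll_mono[OF assms(3,5)]] by blast
qed

lemma universe_code_nat_times:
  fixes U :: "'u set set"
  assumes "set_universe U" "X \<in> U"
  shows "\<exists>f :: nat \<times> 'u \<Rightarrow> 'u. inj_on f (UNIV \<times> X) \<and> f ` (UNIV \<times> X) \<in> U"
proof -
  obtain Y where Y: "Y \<in> U" "(UNIV :: nat set) \<lesssim> Y" by (rule universe_nat[OF assms(1)])
  obtain Z where "Z \<in> U" "(UNIV :: nat set) \<times> X \<lesssim> Z"
    by (rule universe_times[OF assms(1) Y assms(2) lepoll_refl])
  then show ?thesis by (rule universe_code[OF assms(1)])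
qed

lemma universe_finite_product:
  assumes U: "set_universe U" and "finite I" "\<And>i. i \<in> I \<Longrightarrow> X i \<in> U"
  shows "\<exists>Z\<in>U. (\<Pi>\<^sub>E i\<in>I. X i) \<lesssim> Z"
  using assms(2,3)
proof (induction I)
  case empty
  obtain Y where Y: "Y \<in> U" "(UNIV :: nat set) \<lesssim> Y" by (rule universe_nat[OF U])
  obtain g :: "nat \<Rightarrow> _" where "range g \<subseteq> Y" using Y(2) unfolding lepoll_def by blast
  then have "(\<Pi>\<^sub>E i\<in>{}. X i) \<lesssim> Y"
    unfolding lepoll_def by (intro exI[of _ "\<lambda>_. g 0"]) auto
  then show ?case using Y(1) by blast
next
  case (insert i I)
  then obtain Z where Z: "Z \<in> U" "(\<Pi>\<^sub>E i\<in>I. X i) \<lesssim> Z" by blast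
  obtain W where W: "W \<in> U" "X i \<times> (\<Pi>\<^sub>E i\<in>I. X i) \<lesssim> W"
    by (rule universe_times[OF U insert.prems[OF insertI1] lepoll_refl Z])
  have "(\<Pi>\<^sub>E i\<in>insert i I. X i) \<lesssim> X i \<times> (\<Pi>\<^sub>E i\<in>I. X i)"
    unfolding lepoll_def
  proof (intro exI conjI)
    show "inj_on (\<lambda>f. (f i, restrict f I)) (\<Pi>\<^sub>E i\<in>insert i I. X i)"
    proof (rule inj_onI)
      fix f g
      assume f: "f \<in> (\<Pi>\<^sub>E i\<in>insert i I. X i)" and g: "g \<in> (\<Pi>\<^sub>E i\<in>insert i I. X i)"
        and eq: "(f i, restrict f I) = (g i, restrict g I)"
      show "f = g"
      proof (rule PiE_ext[OF f g])
        fix j assume "j \<in> insert i I"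
        then show "f j = g j" using eq by (metis Pair_inject insertE restrict_apply')
      qed
    qed
  qed auto
  then show ?case using W lepoll_trans by blast
qed

text \<open>Closure under powers is assumed for the exponent \<open>nat\<close>. Precomposition with an enumeration embeds
the powers with a countable nonempty exponent into those.\<close>

lemma universe_code_power:
  fixes U :: "'u set set" and A :: "'u set"
  assumes "set_universe U" "X \<in> U" "countable A" "A \<noteq> {}"
  shows "\<exists>f :: ('u \<Rightarrow> 'u) \<Rightarrow> 'u. inj_on f (A \<rightarrow>\<^sub>E X) \<and> f ` (A \<rightarrow>\<^sub>E X) \<in> U"
proof -
  obtain Z where Z: "Z \<in> U" "((UNIV :: nat set) \<rightarrow>\<^sub>E X) \<lesssim> Z"
    using assms(1,2) unfolding set_universe_def by blast
  have range: "range (from_nat_into A) = A" using assms(3,4) by (rule range_from_nat_into[rotated])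
  have "(A \<rightarrow>\<^sub>E X) \<lesssim> ((UNIV :: nat set) \<rightarrow>\<^sub>E X)"
    unfolding lepoll_def
  proof (intro exI conjI)
    show "inj_on (\<lambda>f n. f (from_nat_into A n)) (A \<rightarrow>\<^sub>E X)"
    proof (rule inj_onI)
      fix f g
      assume f: "f \<in> A \<rightarrow>\<^sub>E X" and g: "g \<in> A \<rightarrow>\<^sub>E X"
        and eq: "(\<lambda>n. f (from_nat_into A n)) = (\<lambda>n. g (from_nat_into A n))"
      show "f = g"
      proof (rule PiE_ext[OF f g])
        fix x assume "x \<in> A"
        then obtain n where "x = from_nat_into A n" using range by blast
        then show "f x = g x" using fun_cong[OF eq, of n] by simp
      qed
    qed
    show "(\<lambda>f n. f (from_nat_into A n)) ` (A \<rightarrow>\<^sub>E X) \<subseteq> UNIV \<rightarrow>\<^sub>E X"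
      using range by (auto simp: PiE_iff)
  qed
  then show ?thesis using universe_code[OF assms(1) Z(1)] lepoll_trans Z(2) by blast
qed

section \<open>Sets and sets with an action, elementwise\<close>

definition arr_fun :: "'x \<times> ('u \<Rightarrow> 'v) \<times> 'y \<Rightarrow> 'u \<Rightarrow> 'v" where
  "arr_fun a = fst (snd a)"

lemma arr_fun_triple [simp]: "arr_fun (X, f, Y) = f"
  by (simp add: arr_fun_def)

lemma SetCat_simps [simp]:
  "Obj (SetCat U) = U" "Dom (SetCat U) = fst" "Cod (SetCat U) = (\<lambda>a. snd (snd a))"
  "Idn (SetCat U) X = (X, \<lambda>x\<in>X. x, X)"
  "Cmp (SetCat U) (Y, g, Z) (X, f, Y') = (X, compose X g f, Z)"
  "(X, f, Y) \<in> Arr (SetCat U) \<longleftrightarrow> X \<in> U \<and> Y \<in> U \<and> f \<in> X \<rightarrow>\<^sub>E Y"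
  by (simp_all add: SetCat_def)

lemma in_Homs_SetCat:
  "h \<in> Homs (SetCat U) X Y \<longleftrightarrow> X \<in> U \<and> Y \<in> U \<and> (\<exists>f \<in> X \<rightarrow>\<^sub>E Y. h = (X, f, Y))"
  by (cases h) (auto simp: Homs_def)

lemma SetCat_Homs_eq:
  "h \<in> Homs (SetCat U) X Y \<Longrightarrow> h = (X, arr_fun h, Y)"
  "h \<in> Homs (SetCat U) X Y \<Longrightarrow> arr_fun h \<in> X \<rightarrow>\<^sub>E Y"
  "h \<in> Homs (SetCat U) X Y \<Longrightarrow> X \<in> U \<and> Y \<in> U"
  by (auto simp: in_Homs_SetCat)

lemma Cmp_SetCat_eq_iff:
  assumes h: "h \<in> Homs (SetCat U) X Y" and k: "k \<in> Homs (SetCat U) Y Z" and l: "l \<in> Homs (SetCat U) X Z"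
  shows "Cmp (SetCat U) k h = l \<longleftrightarrow> (\<forall>x\<in>X. arr_fun k (arr_fun h x) = arr_fun l x)"
proof -
  have "Cmp (SetCat U) k h = l \<longleftrightarrow> compose X (arr_fun k) (arr_fun h) = arr_fun l"
    by (subst SetCat_Homs_eq(1)[OF h], subst SetCat_Homs_eq(1)[OF k], subst SetCat_Homs_eq(1)[OF l]) simp
  also have "\<dots> \<longleftrightarrow> (\<forall>x\<in>X. arr_fun k (arr_fun h x) = arr_fun l x)"
  proof
    assume "\<forall>x\<in>X. arr_fun k (arr_fun h x) = arr_fun l x"
    then show "compose X (arr_fun k) (arr_fun h) = arr_fun l"
      using SetCat_Homs_eq(2)[OF l] by (intro extensionalityI[of _ X]) (auto simp: compose_def PiE_iff)
  next
    assume "compose X (arr_fun k) (arr_fun h) = arr_fun l"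
    from this[symmetric] show "\<forall>x\<in>X. arr_fun k (arr_fun h x) = arr_fun l x"
      by (simp add: compose_def)
  qed
  finally show ?thesis .
qed

lemma MSetCat_simps [simp]:
  "Dom (MSetCat U M) = fst" "Cod (MSetCat U M) = (\<lambda>a. snd (snd a))"
  "Idn (MSetCat U M) N = (N, \<lambda>x\<in>fst N. x, N)"
  "Cmp (MSetCat U M) (N', g, N'') (N, f, L) = (N, compose (fst N) g f, N'')"
  by (simp_all add: MSetCat_def)

lemma in_Arr_MSetCat:
  "(N, f, N') \<in> Arr (MSetCat U M) \<longleftrightarrow> N \<in> Obj (MSetCat U M) \<and> N' \<in> Obj (MSetCat U M) \<and>
     f \<in> fst N \<rightarrow>\<^sub>E fst N' \<and> (\<forall>m\<in>carrier M. \<forall>x\<in>fst N. f (snd N m x) = snd N' m (f x))"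
  by (auto simp: MSetCat_def)

lemma in_Homs_MSetCat:
  "h \<in> Homs (MSetCat U M) N N' \<longleftrightarrow> (\<exists>f. h = (N, f, N') \<and> (N, f, N') \<in> Arr (MSetCat U M))"
  by (cases h) (auto simp: Homs_def)

lemma Arr_MSetCat_cases:
  assumes "a \<in> Arr (MSetCat U M)"
  obtains N f N' where "a = (N, f, N')" "(N, f, N') \<in> Arr (MSetCat U M)"
  using assms by (cases a) auto

lemma divisor_cat_simps [simp]:
  "Obj (divisor_cat z) = divs z"
  "Arr (divisor_cat z) = {(a, a'). a \<in> divs z \<and> a' \<in> divs z \<and> a dvd a'}"
  "Dom (divisor_cat z) = fst" "Cod (divisor_cat z) = snd"
  by (auto simp: divisor_cat_def divs_def)

lemma isomorphism_SetCatI: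
  assumes "X \<in> U" "Y \<in> U" "h \<in> X \<rightarrow>\<^sub>E Y" "k \<in> Y \<rightarrow>\<^sub>E X"
    "\<And>x. x \<in> X \<Longrightarrow> k (h x) = x" "\<And>y. y \<in> Y \<Longrightarrow> h (k y) = y"
  shows "isomorphism (SetCat U) (X, h, Y)"
  unfolding isomorphism_def
proof (intro conjI bexI[of _ "(Y, k, X)"])
  show "(Y, k, X) \<in> Homs (SetCat U) (Cod (SetCat U) (X, h, Y)) (Dom (SetCat U) (X, h, Y))"
    using assms by (simp add: in_Homs_SetCat)
qed (use assms in \<open>auto simp: compose_def fun_eq_iff\<close>)

lemma isomorphism_SetCat_bij:
  assumes "isomorphism (SetCat U) (X, h, Y)"
  shows "bij_betw h X Y"
proof -
  have h: "h \<in> X \<rightarrow>\<^sub>E Y" using assms by (simp add: isomorphism_def)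
  from assms obtain k where k: "k \<in> Y \<rightarrow>\<^sub>E X" "compose X k h = (\<lambda>x\<in>X. x)" "compose Y h k = (\<lambda>x\<in>Y. x)"
    unfolding isomorphism_def by (auto simp: in_Homs_SetCat)
  have "k (h x) = x" if "x \<in> X" for x using fun_cong[OF k(2), of x] that by (simp add: compose_def)
  moreover have "h (k y) = y" if "y \<in> Y" for y
    using fun_cong[OF k(3), of y] that by (simp add: compose_def)
  ultimately show ?thesis using h k(1) by (intro bij_betw_byWitness[of _ k]) auto
qed

lemma functor_Cmp:
  assumes "is_functor C D F" "f \<in> Arr C" "g \<in> Arr C" "Cod C f = Dom C g"
  shows "AMap F (Cmp C g f) = Cmp D (AMap F g) (AMap F f)"
  using assms unfolding is_functor_def by blast

lemma functor_Homs:
  assumes "is_functor C D F" "f \<in> Arr C"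
  shows "AMap F f \<in> Homs D (OMap F (Dom C f)) (OMap F (Cod C f))"
  using assms unfolding is_functor_def by blast

section \<open>Products with elements of the value at the regular object\<close>

text \<open>The properties shared by the positive integers, with \<open>d\<close> and \<open>nrm\<close> the identity, and by the affine
maps \<open>t \<mapsto> a t + b\<close>, with \<open>d\<close> the dilations and \<open>nrm = \<bar>a\<bar>\<close>. Note that \<open>unit_times_d\<close> lets units be
moved past \<open>d\<close>: as \<open>d a \<otimes> u\<close> has norm \<open>a\<close>, it equals \<open>u' \<otimes> d a\<close> for some unit \<open>u'\<close>.\<close>

locale divisibility_monoid = monoid M for M :: "('m, 'r) monoid_scheme" (structure) +
  fixes U :: "'u set set" and d :: "nat \<Rightarrow> 'm" and nrm :: "'m \<Rightarrow> nat"
  assumes universe: "set_universe U"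
    and countable_carrier: "countable (carrier M)"
    and d_closed: "a > 0 \<Longrightarrow> d a \<in> carrier M"
    and d_one: "d 1 = \<one>"
    and d_mult: "a > 0 \<Longrightarrow> b > 0 \<Longrightarrow> d (a * b) = d a \<otimes> d b"
    and nrm_pos: "m \<in> carrier M \<Longrightarrow> nrm m > 0"
    and nrm_mult: "m \<in> carrier M \<Longrightarrow> k \<in> carrier M \<Longrightarrow> nrm (m \<otimes> k) = nrm m * nrm k"
    and nrm_d: "a > 0 \<Longrightarrow> nrm (d a) = a"
    and unit_times_d: "m \<in> carrier M \<Longrightarrow> \<exists>u\<in>Units M. m = u \<otimes> d (nrm m)"
    and d_cancel: "a > 0 \<Longrightarrow> m \<in> carrier M \<Longrightarrow> k \<in> carrier M \<Longrightarrow> m \<otimes> d a = k \<otimes> d a \<Longrightarrow> m = k"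
begin

abbreviation "MSets \<equiv> MSetCat U M"
abbreviation "Sets \<equiv> SetCat U"

lemma nrm_one: "nrm \<one> = 1"
  using nrm_d[of 1] by (simp add: d_one[simplified])

lemma nrm_unit:
  assumes "u \<in> Units M"
  shows "nrm u = 1"
proof -
  have "nrm u * nrm (inv u) = 1"
    using assms nrm_mult[of u "inv u"] by (simp add: Units_closed Units_r_inv nrm_one)
  then show ?thesis by simp
qed

lemma Obj_MSets: "N \<in> Obj MSets \<longleftrightarrow> fst N \<in> U \<and> is_left_action M N"
  by (simp add: MSetCat_def)

lemma act_closed: "N \<in> Obj MSets \<Longrightarrow> m \<in> carrier M \<Longrightarrow> n \<in> fst N \<Longrightarrow> snd N m n \<in> fst N"
  by (auto simp: Obj_MSets is_left_action_def PiE_iff)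

lemma act_one: "N \<in> Obj MSets \<Longrightarrow> n \<in> fst N \<Longrightarrow> snd N \<one> n = n"
  by (auto simp: Obj_MSets is_left_action_def)

lemma act_mult:
  "N \<in> Obj MSets \<Longrightarrow> m \<in> carrier M \<Longrightarrow> k \<in> carrier M \<Longrightarrow> n \<in> fst N \<Longrightarrow>
     snd N (m \<otimes> k) n = snd N m (snd N k n)"
  by (auto simp: Obj_MSets is_left_action_def)

lemma act_d_mult:
  "N \<in> Obj MSets \<Longrightarrow> a > 0 \<Longrightarrow> b > 0 \<Longrightarrow> n \<in> fst N \<Longrightarrow> snd N (d (a * b)) n = snd N (d a) (snd N (d b) n)"
  by (simp add: d_mult act_mult d_closed)

lemma Arr_apply: "(N, f, N') \<in> Arr MSets \<Longrightarrow> n \<in> fst N \<Longrightarrow> f n \<in> fst N'"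
  by (auto simp: in_Arr_MSetCat)

lemma Arr_equivariant:
  "(N, f, N') \<in> Arr MSets \<Longrightarrow> m \<in> carrier M \<Longrightarrow> n \<in> fst N \<Longrightarrow> f (snd N m n) = snd N' m (f n)"
  by (auto simp: in_Arr_MSetCat)

definition code :: "'m \<Rightarrow> 'u" where
  "code = (SOME f. inj_on f (carrier M) \<and> f ` carrier M \<in> U)"

definition decode :: "'u \<Rightarrow> 'm" where
  "decode = inv_into (carrier M) code"

lemma code: "inj_on code (carrier M)" "code ` carrier M \<in> U"
  using someI_ex[OF universe_code_countable[OF universe countable_carrier]]
  unfolding code_def by blast+

lemma decode_code [simp]: "m \<in> carrier M \<Longrightarrow> decode (code m) = m"
  by (simp add: decode_def code(1))

text \<open>The monoid acting on itself from the left. It represents the forgetful functor; its elements have to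
be encoded in the type that the small sets live in.\<close>

definition regular :: "('m, 'u) mset" where
  "regular = (code ` carrier M,
     \<lambda>m\<in>carrier M. \<lambda>x\<in>code ` carrier M. code (m \<otimes> decode x))"

lemma fst_regular: "fst regular = code ` carrier M"
  by (simp add: regular_def)

lemma code_in_regular [simp]: "m \<in> carrier M \<Longrightarrow> code m \<in> fst regular"
  by (simp add: fst_regular)

lemma regular_act [simp]:
  "m \<in> carrier M \<Longrightarrow> k \<in> carrier M \<Longrightarrow> snd regular m (code k) = code (m \<otimes> k)"
  by (simp add: regular_def)

lemma regular_Obj [simp]: "regular \<in> Obj MSets"
  unfolding Obj_MSets is_left_action_def
  by (auto simp: fst_regular code(2) m_assoc) (auto simp: regular_def)

definition orbit_map :: "('m, 'u) mset \<Rightarrow> 'u \<Rightarrow> ('m, 'u) mset_arr" where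
  "orbit_map N n = (regular, \<lambda>x\<in>fst regular. snd N (decode x) n, N)"

lemma orbit_map_Arr [simp]:
  assumes "N \<in> Obj MSets" "n \<in> fst N"
  shows "orbit_map N n \<in> Arr MSets"
  unfolding orbit_map_def in_Arr_MSetCat
  using assms by (auto simp: fst_regular act_closed act_mult)

abbreviation ap :: "(('m, 'u) mset, ('m, 'u) mset_arr, 'u set, 'u set_arr) fctr \<Rightarrow>
    ('m, 'u) mset_arr \<Rightarrow> 'u \<Rightarrow> 'u" where
  "ap F a \<equiv> arr_fun (AMap F a)"

lemma functor_obj: "is_functor MSets Sets F \<Longrightarrow> N \<in> Obj MSets \<Longrightarrow> OMap F N \<in> U"
  by (simp add: is_functor_def)

lemma functor_arr:
  assumes "is_functor MSets Sets F" "(N, f, N') \<in> Arr MSets"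
  shows "AMap F (N, f, N') = (OMap F N, ap F (N, f, N'), OMap F N')"
    "ap F (N, f, N') \<in> OMap F N \<rightarrow>\<^sub>E OMap F N'"
proof -
  have "AMap F (N, f, N') \<in> Homs Sets (OMap F N) (OMap F N')"
    using functor_Homs[OF assms] by simp
  then show "AMap F (N, f, N') = (OMap F N, ap F (N, f, N'), OMap F N')"
    "ap F (N, f, N') \<in> OMap F N \<rightarrow>\<^sub>E OMap F N'"
    by (auto simp: in_Homs_SetCat)
qed

lemma functor_closed:
  "is_functor MSets Sets F \<Longrightarrow> (N, f, N') \<in> Arr MSets \<Longrightarrow> x \<in> OMap F N \<Longrightarrow> ap F (N, f, N') x \<in> OMap F N'"
  using functor_arr(2) by blast

lemma functor_id:
  assumes "is_functor MSets Sets F" "N \<in> Obj MSets" "x \<in> OMap F N"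
  shows "ap F (N, \<lambda>x\<in>fst N. x, N) x = x"
proof -
  have "AMap F (Idn MSets N) = Idn Sets (OMap F N)"
    using assms(1,2) by (simp only: is_functor_def)
  then show ?thesis using assms(3) by simp
qed

lemma functor_comp:
  assumes "is_functor MSets Sets F" "(N, f, N') \<in> Arr MSets" "(N', g, N'') \<in> Arr MSets" "x \<in> OMap F N"
  shows "ap F (N, compose (fst N) g f, N'') x = ap F (N', g, N'') (ap F (N, f, N') x)"
proof -
  have "AMap F (Cmp MSets (N', g, N'') (N, f, N')) = Cmp Sets (AMap F (N', g, N'')) (AMap F (N, f, N'))"
    by (rule functor_Cmp[OF assms(1-3)]) simp
  moreover obtain p where "AMap F (N, f, N') = (OMap F N, p, OMap F N')"
    using functor_arr(1)[OF assms(1,2)] by blast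
  moreover obtain q where "AMap F (N', g, N'') = (OMap F N', q, OMap F N'')"
    using functor_arr(1)[OF assms(1,3)] by blast
  ultimately show ?thesis using assms(4) by (simp add: compose_eq)
qed

text \<open>The product \<open>x \<otimes> n\<close>, for \<open>x\<close> in the value of \<open>F\<close> at the regular object and \<open>n\<close> in \<open>N\<close>: an element of the
tensor product of right and left \<open>M\<close>-sets if \<open>F\<close> is tensoring with a right \<open>M\<close>-set.\<close>

definition tens ::
  "(('m, 'u) mset, ('m, 'u) mset_arr, 'u set, 'u set_arr) fctr \<Rightarrow> ('m, 'u) mset \<Rightarrow> 'u \<Rightarrow> 'u \<Rightarrow> 'u" where
  "tens F N x n = ap F (orbit_map N n) x"

abbreviation right_mul ::
  "(('m, 'u) mset, ('m, 'u) mset_arr, 'u set, 'u set_arr) fctr \<Rightarrow> 'u \<Rightarrow> 'm \<Rightarrow> 'u" where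
  "right_mul F x m \<equiv> tens F regular x (code m)"

lemma tens_closed:
  "is_functor MSets Sets F \<Longrightarrow> N \<in> Obj MSets \<Longrightarrow> n \<in> fst N \<Longrightarrow> x \<in> OMap F regular \<Longrightarrow> tens F N x n \<in> OMap F N"
  using functor_closed orbit_map_Arr unfolding tens_def orbit_map_def by blast

lemma compose_orbit_map:
  assumes "(N, f, N') \<in> Arr MSets" "n \<in> fst N"
  shows "compose (fst regular) f (\<lambda>x\<in>fst regular. snd N (decode x) n) =
    (\<lambda>x\<in>fst regular. snd N' (decode x) (f n))"
  using Arr_equivariant[OF assms(1) _ assms(2)] by (auto simp: compose_def fst_regular fun_eq_iff)

lemma tens_map:
  assumes F: "is_functor MSets Sets F" and f: "(N, f, N') \<in> Arr MSets" and n: "n \<in> fst N"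
    and x: "x \<in> OMap F regular"
  shows "ap F (N, f, N') (tens F N x n) = tens F N' x (f n)"
proof -
  have N: "N \<in> Obj MSets" using f by (simp add: in_Arr_MSetCat)
  have orb: "(regular, \<lambda>x\<in>fst regular. snd N (decode x) n, N) \<in> Arr MSets"
    using orbit_map_Arr[OF N n] by (simp add: orbit_map_def)
  show ?thesis
    using functor_comp[OF F orb f x] by (simp add: tens_def orbit_map_def compose_orbit_map[OF f n])
qed

lemma tens_right_mul:
  assumes F: "is_functor MSets Sets F" and N: "N \<in> Obj MSets" "n \<in> fst N"
    and x: "x \<in> OMap F regular" and m: "m \<in> carrier M"
  shows "tens F N (right_mul F x m) n = tens F N x (snd N m n)"
  using tens_map[OF F orbit_map_Arr[OF N, unfolded orbit_map_def] _ x, of "code m"] m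
  by (simp add: tens_def[of F N "right_mul F x m"] orbit_map_def)

lemma right_mul_mult:
  assumes "is_functor MSets Sets F" "x \<in> OMap F regular" "m \<in> carrier M" "k \<in> carrier M"
  shows "right_mul F (right_mul F x m) k = right_mul F x (m \<otimes> k)"
  using tens_right_mul[OF assms(1) regular_Obj _ assms(2,3), of "code k"] assms by simp

lemma right_mul_one:
  assumes "is_functor MSets Sets F" "x \<in> OMap F regular"
  shows "right_mul F x \<one> = x"
proof -
  have "(\<lambda>x\<in>fst regular. snd regular (decode x) (code \<one>)) = (\<lambda>x\<in>fst regular. x)"
    by (auto simp: fst_regular fun_eq_iff)
  then show ?thesis
    using functor_id[OF assms(1) regular_Obj assms(2)] by (simp add: tens_def orbit_map_def)
qed

lemma right_mul_closed:
  "is_functor MSets Sets F \<Longrightarrow> x \<in> OMap F regular \<Longrightarrow> m \<in> carrier M \<Longrightarrow> right_mul F x m \<in> OMap F regular"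
  by (simp add: tens_closed)

section \<open>Germ bases\<close>

text \<open>This says that \<open>F\<close>, with the maps \<open>n \<mapsto> x a \<otimes> n\<close>, is the filtered colimit over the divisors of \<open>z\<close>, in
terms of elements: the maps are compatible, jointly surjective, and identify only what the
transition maps identify.\<close>

definition germ_basis ::
  "(('m, 'u) mset, ('m, 'u) mset_arr, 'u set, 'u set_arr) fctr \<Rightarrow> zhat \<Rightarrow> (nat \<Rightarrow> 'u) \<Rightarrow> bool" where
  "germ_basis F z x \<longleftrightarrow>
     (\<forall>a\<in>divs z. x a \<in> OMap F regular) \<and>
     (\<forall>a b. a * b \<in> divs z \<longrightarrow> right_mul F (x (a * b)) (d b) = x a) \<and>
     (\<forall>N\<in>Obj MSets. \<forall>w\<in>OMap F N. \<exists>a\<in>divs z. \<exists>n\<in>fst N. w = tens F N (x a) n) \<and>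
     (\<forall>N\<in>Obj MSets. \<forall>a\<in>divs z. \<forall>n\<in>fst N. \<forall>n'\<in>fst N.
        tens F N (x a) n = tens F N (x a) n' \<longrightarrow> (\<exists>b. a * b \<in> divs z \<and> snd N (d b) n = snd N (d b) n'))"

context
  fixes F z x
  assumes F: "is_functor MSets Sets F" and basis: "germ_basis F z x"
begin

lemma basis_in: "a \<in> divs z \<Longrightarrow> x a \<in> OMap F regular"
  using basis by (simp add: germ_basis_def)

lemma basis_transition: "a * b \<in> divs z \<Longrightarrow> right_mul F (x (a * b)) (d b) = x a"
  using basis by (simp add: germ_basis_def)

lemma basis_generates:
  assumes "N \<in> Obj MSets" "w \<in> OMap F N"
  obtains a n where "a \<in> divs z" "n \<in> fst N" "w = tens F N (x a) n"
  using basis assms unfolding germ_basis_def by blast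

lemma basis_generates_regular:
  assumes "w \<in> OMap F regular"
  obtains a m where "a \<in> divs z" "m \<in> carrier M" "w = right_mul F (x a) m"
  using basis_generates[OF regular_Obj assms] unfolding fst_regular by blast

lemma basis_origin: "a \<in> divs z \<Longrightarrow> right_mul F (x a) (d a) = x 1"
  using basis_transition[of 1 a] by simp

lemma basis_eqD:
  assumes "N \<in> Obj MSets" "a \<in> divs z" "n \<in> fst N" "n' \<in> fst N" "tens F N (x a) n = tens F N (x a) n'"
  obtains b where "a * b \<in> divs z" "snd N (d b) n = snd N (d b) n'"
  using basis assms unfolding germ_basis_def by blast

text \<open>Equal products become equal elements of the monoid after multiplication by some \<open>d b\<close>, which
contributes the same factor to both norms.\<close>

lemma basis_norm_eq:
  assumes c: "c \<in> divs z" and m: "m \<in> carrier M" and k: "k \<in> carrier M"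
    and eq: "right_mul F (x c) m = right_mul F (x c) k"
  shows "nrm m = nrm k"
proof -
  obtain b where b: "c * b \<in> divs z" "snd regular (d b) (code m) = snd regular (d b) (code k)"
    by (rule basis_eqD[OF regular_Obj c code_in_regular[OF m] code_in_regular[OF k] eq])
  have bpos: "b > 0" using divs_pos[OF b(1)] by simp
  have "code (d b \<otimes> m) = code (d b \<otimes> k)" using b(2) m k d_closed[OF bpos] by simp
  then have "d b \<otimes> m = d b \<otimes> k" using inj_onD[OF code(1)] m k d_closed[OF bpos] by blast
  then have "nrm (d b \<otimes> m) = nrm (d b \<otimes> k)" by simp
  then have "b * nrm m = b * nrm k"
    using nrm_mult[OF d_closed[OF bpos] m] nrm_mult[OF d_closed[OF bpos] k] nrm_d[OF bpos] by simp
  then show ?thesis using bpos by simp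
qed

lemma basis_shift:
  assumes "N \<in> Obj MSets" "n \<in> fst N" "a * b \<in> divs z"
  shows "tens F N (x a) n = tens F N (x (a * b)) (snd N (d b) n)"
proof -
  have "b > 0" using divs_pos[OF assms(3)] by simp
  from tens_right_mul[OF F assms(1,2) basis_in[OF assms(3)] d_closed[OF this]] show ?thesis
    unfolding basis_transition[OF assms(3)] .
qed

lemma basis_shift_dvd:
  assumes "N \<in> Obj MSets" "n \<in> fst N" "c \<in> divs z" "a dvd c"
  shows "tens F N (x a) n = tens F N (x c) (snd N (d (c div a)) n)"
  using basis_shift[of N n a "c div a"] assms by simp

lemma basis_eq_common:
  assumes "finite I" "a \<in> divs z"
    and "\<And>i. i \<in> I \<Longrightarrow> N i \<in> Obj MSets \<and> n i \<in> fst (N i) \<and> n' i \<in> fst (N i) \<and>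
      tens F (N i) (x a) (n i) = tens F (N i) (x a) (n' i)"
  shows "\<exists>b. a * b \<in> divs z \<and> (\<forall>i\<in>I. snd (N i) (d b) (n i) = snd (N i) (d b) (n' i))"
  using assms(1,3)
proof (induction I)
  case empty
  show ?case using assms(2) by (intro exI[of _ 1]) simp
next
  case (insert i I)
  then obtain b where b: "a * b \<in> divs z" "\<forall>i\<in>I. snd (N i) (d b) (n i) = snd (N i) (d b) (n' i)"
    by blast
  have i: "N i \<in> Obj MSets" "n i \<in> fst (N i)" "n' i \<in> fst (N i)"
    "tens F (N i) (x a) (n i) = tens F (N i) (x a) (n' i)" using insert.prems by blast+
  obtain c where c: "a * c \<in> divs z" "snd (N i) (d c) (n i) = snd (N i) (d c) (n' i)"
    using basis_eqD[OF i(1) assms(2) i(2-)] by blast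
  define l where "l = lcm b c"
  have pos: "b > 0" "c > 0" using divs_pos[OF b(1)] divs_pos[OF c(1)] by auto
  then have lpos: "l > 0" by (simp add: l_def lcm_pos_nat)
  have "a * l \<in> divs z" using divs_lcm[OF b(1) c(1)] by (simp add: l_def lcm_mult_left)
  moreover have lift: "snd (N j) (d l) (n j) = snd (N j) (d l) (n' j)"
    if j: "j \<in> insert i I" and e: "e dvd l" "snd (N j) (d e) (n j) = snd (N j) (d e) (n' j)" for j e
  proof -
    obtain f where f: "l = f * e" using e(1) by (metis dvd_def mult.commute)
    then have "f > 0" "e > 0" using lpos by auto
    then show ?thesis using insert.prems[OF j] e(2) unfolding f by (simp add: act_d_mult)
  qed
  have "snd (N j) (d l) (n j) = snd (N j) (d l) (n' j)" if "j \<in> insert i I" for j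
  proof (cases "j = i")
    case True
    then show ?thesis using lift[of i c] c(2) by (simp add: l_def)
  next
    case False
    then show ?thesis using lift[of j b] b(2) that by (simp add: l_def)
  qed
  ultimately show ?case by blast
qed

lemma basis_generates_common:
  assumes "finite I" and "\<And>i. i \<in> I \<Longrightarrow> N i \<in> Obj MSets \<and> w i \<in> OMap F (N i)"
  shows "\<exists>a\<in>divs z. \<exists>n. \<forall>i\<in>I. n i \<in> fst (N i) \<and> w i = tens F (N i) (x a) (n i)"
  using assms
proof (induction I)
  case empty
  show ?case using one_in_divs(1) by blast
next
  case (insert i I)
  then obtain a n where a: "a \<in> divs z" "\<forall>i\<in>I. n i \<in> fst (N i) \<and> w i = tens F (N i) (x a) (n i)"
    by blast
  have i: "N i \<in> Obj MSets" "w i \<in> OMap F (N i)" using insert.prems by blast+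
  obtain a' k where k: "a' \<in> divs z" "k \<in> fst (N i)" "w i = tens F (N i) (x a') k"
    by (rule basis_generates[OF i])
  define c where "c = lcm a a'"
  have c: "c \<in> divs z" unfolding c_def by (rule divs_lcm[OF a(1) k(1)])
  define n' where "n' j = snd (N j) (d (c div (if j = i then a' else a))) (if j = i then k else n j)" for j
  have "n' j \<in> fst (N j) \<and> w j = tens F (N j) (x c) (n' j)" if j: "j \<in> insert i I" for j
  proof -
    have Nj: "N j \<in> Obj MSets" using insert.prems[OF j] by blast
    have lift: "snd (N j) (d (c div e)) y \<in> fst (N j) \<and> tens F (N j) (x e) y = tens F (N j) (x c) (snd (N j) (d (c div e)) y)"
      if "e dvd c" "y \<in> fst (N j)" for e y
    proof -
      have "c div e > 0" using that(1) divs_pos[OF c] by (auto simp: dvd_imp_le div_greater_zero_iff elim!: dvdE)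
      then show ?thesis using basis_shift_dvd[OF Nj that(2) c that(1)] act_closed[OF Nj d_closed that(2)]
        by blast
    qed
    show ?thesis
    proof (cases "j = i")
      case True
      then show ?thesis using lift[of a' k] k by (simp add: n'_def c_def)
    next
      case False
      then show ?thesis using lift[of a "n j"] a(2) j by (simp add: n'_def c_def)
    qed
  qed
  then show ?case using c by blast
qed

text \<open>The universal property of the colimit, for functions. It is stated without codomain because it is
used both for maps out of the colimit and, pointwise, for functions into a power.\<close>

lemma basis_factor:
  assumes N: "N \<in> Obj MSets"
    and r: "\<And>a b n. a * b \<in> divs z \<Longrightarrow> n \<in> fst N \<Longrightarrow> r (a * b) (snd N (d b) n) = (r a n :: 'u)"
  obtains h where "\<And>a n. a \<in> divs z \<Longrightarrow> n \<in> fst N \<Longrightarrow> h (tens F N (x a) n) = r a n"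
proof -
  have welldef: "r a n = r a' n'"
    if a: "a \<in> divs z" and a': "a' \<in> divs z" and n: "n \<in> fst N" and n': "n' \<in> fst N"
      and eq: "tens F N (x a) n = tens F N (x a') n'" for a a' n n'
  proof -
    define c where "c = lcm a a'"
    have c: "c \<in> divs z" unfolding c_def by (rule divs_lcm[OF a a'])
    define e e' where "e = c div a" and "e' = c div a'"
    have e: "c = a * e" "c = a' * e'" by (simp_all add: e_def e'_def c_def)
    have epos: "e > 0" "e' > 0" using divs_pos[OF c] e by (metis gr0I mult_0_right less_irrefl)+
    have in_N: "snd N (d e) n \<in> fst N" "snd N (d e') n' \<in> fst N"
      using act_closed[OF N] d_closed epos n n' by auto
    have "tens F N (x c) (snd N (d e) n) = tens F N (x c) (snd N (d e') n')"
      using eq basis_shift[OF N n, of a e] basis_shift[OF N n', of a' e'] c e by simp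
    then obtain b where b: "c * b \<in> divs z" "snd N (d b) (snd N (d e) n) = snd N (d b) (snd N (d e') n')"
      using basis_eqD[OF N c in_N] by blast
    have "r a n = r (c * b) (snd N (d b) (snd N (d e) n))"
      using r[OF b(1) in_N(1)] r[of a e n] c e n by simp
    also have "\<dots> = r a' n'"
      using r[OF b(1) in_N(2)] r[of a' e' n'] c e n' b(2) by simp
    finally show ?thesis .
  qed
  define h where "h w = (SOME y. \<exists>a\<in>divs z. \<exists>n\<in>fst N. w = tens F N (x a) n \<and> y = r a n)" for w
  have "h (tens F N (x a) n) = r a n" if "a \<in> divs z" "n \<in> fst N" for a n
    unfolding h_def
  proof (rule some_equality)
    fix y
    assume "\<exists>a'\<in>divs z. \<exists>n'\<in>fst N. tens F N (x a) n = tens F N (x a') n' \<and> y = r a' n'"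
    then show "y = r a n" using welldef that by metis
  qed (use that in blast)
  then show thesis by (rule that)
qed

end

section \<open>Divisor colimits\<close>

lemma divisor_cocone_iff:
  assumes N: "N \<in> Obj MSets"
  shows "cocone (divisor_cat z) Sets (divisor_diagram d N) X \<iota> \<longleftrightarrow>
    X \<in> U \<and> (\<forall>a\<in>divs z. \<iota> a \<in> Homs Sets (fst N) X) \<and>
    (\<forall>a b. a * b \<in> divs z \<longrightarrow>
      (\<forall>n\<in>fst N. arr_fun (\<iota> (a * b)) (snd N (d b) n) = arr_fun (\<iota> a) n))"
    (is "?L \<longleftrightarrow> ?R")
proof -
  have step: "Cmp Sets (\<iota> (a * b)) (AMap (divisor_diagram d N) (a, a * b)) = \<iota> a \<longleftrightarrow>
      (\<forall>n\<in>fst N. arr_fun (\<iota> (a * b)) (snd N (d b) n) = arr_fun (\<iota> a) n)"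
    if hom: "\<forall>a\<in>divs z. \<iota> a \<in> Homs Sets (fst N) X" and ab: "a * b \<in> divs z" for a b
  proof -
    have a: "a \<in> divs z" by (rule divs_dvd[OF ab]) simp
    have pos: "a > 0" "b > 0" using divs_pos[OF ab] by auto
    have "(fst N, snd N (d b), fst N) \<in> Homs Sets (fst N) (fst N)"
      using N d_closed[OF pos(2)] by (auto simp: in_Homs_SetCat Obj_MSets is_left_action_def)
    then show ?thesis
      using Cmp_SetCat_eq_iff[of _ U "fst N" "fst N" _ X] hom ab a pos(1)
      by (simp add: divisor_diagram_def)
  qed
  show ?thesis
  proof
    assume L: ?L
    then have hom: "\<forall>a\<in>divs z. \<iota> a \<in> Homs Sets (fst N) X" and X: "X \<in> U"
      by (auto simp: cocone_def divisor_diagram_def)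
    have "Cmp Sets (\<iota> (a * b)) (AMap (divisor_diagram d N) (a, a * b)) = \<iota> a"
      if ab: "a * b \<in> divs z" for a b
    proof -
      have "a \<in> divs z" by (rule divs_dvd[OF ab]) simp
      then have "(a, a * b) \<in> Arr (divisor_cat z)" using ab by simp
      then have "Cmp Sets (\<iota> (Cod (divisor_cat z) (a, a * b))) (AMap (divisor_diagram d N) (a, a * b)) =
          \<iota> (Dom (divisor_cat z) (a, a * b))"
        using L unfolding cocone_def by blast
      then show ?thesis by simp
    qed
    then show ?R using step[OF hom] hom X by blast
  next
    assume R: ?R
    then have hom: "\<forall>a\<in>divs z. \<iota> a \<in> Homs Sets (fst N) X" by blast
    have "Cmp Sets (\<iota> (Cod (divisor_cat z) u)) (AMap (divisor_diagram d N) u) = \<iota> (Dom (divisor_cat z) u)"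
      if "u \<in> Arr (divisor_cat z)" for u
    proof -
      from that obtain a b where u: "u = (a, a * b)" and ab: "a * b \<in> divs z"
        by (auto elim!: dvdE)
      show ?thesis using step[OF hom ab] R ab by (simp add: u)
    qed
    then show ?L using R by (simp add: cocone_def divisor_diagram_def)
  qed
qed

lemma basis_imp_divisor_colimit:
  assumes F: "is_functor MSets Sets F" and basis: "germ_basis F z x"
  shows "is_divisor_colimit U M d z F"
proof -
  define \<iota> where "\<iota> N a = (fst N, \<lambda>n\<in>fst N. tens F N (x a) n, OMap F N)" for N :: "('m, 'u) mset" and a
  have \<iota>_fun: "arr_fun (\<iota> N a) n = tens F N (x a) n" if "n \<in> fst N" for N a n
    using that by (simp add: \<iota>_def)
  have tens_in: "tens F N (x a) n \<in> OMap F N" if "N \<in> Obj MSets" "a \<in> divs z" "n \<in> fst N" for N a n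
    using tens_closed[OF F that(1,3) basis_in[OF F basis that(2)]] .
  have hom: "\<iota> N a \<in> Homs Sets (fst N) (OMap F N)" if N: "N \<in> Obj MSets" and a: "a \<in> divs z" for N a
    unfolding in_Homs_SetCat \<iota>_def
    using N functor_obj[OF F N] tens_in[OF N a] by (auto simp: Obj_MSets)
  have "colimit_cocone (divisor_cat z) Sets (divisor_diagram d N) (OMap F N) (\<iota> N)"
    if N: "N \<in> Obj MSets" for N
    unfolding colimit_cocone_def
  proof (intro conjI allI impI)
    have "arr_fun (\<iota> N (a * b)) (snd N (d b) n) = arr_fun (\<iota> N a) n"
      if ab: "a * b \<in> divs z" and n: "n \<in> fst N" for a b n
    proof -
      have "b > 0" using divs_pos[OF ab] by simp
      then show ?thesis
        using basis_shift[OF F basis N n ab] \<iota>_fun[OF n] \<iota>_fun[OF act_closed[OF N d_closed n]]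
        by simp
    qed
    then show "cocone (divisor_cat z) Sets (divisor_diagram d N) (OMap F N) (\<iota> N)"
      unfolding divisor_cocone_iff[OF N] using functor_obj[OF F N] hom[OF N] by blast
  next
    fix Y \<rho>
    assume "cocone (divisor_cat z) Sets (divisor_diagram d N) Y \<rho>"
    then have Y: "Y \<in> U" and \<rho>: "\<And>a. a \<in> divs z \<Longrightarrow> \<rho> a \<in> Homs Sets (fst N) Y"
      and comp: "\<And>a b n. a * b \<in> divs z \<Longrightarrow> n \<in> fst N \<Longrightarrow>
        arr_fun (\<rho> (a * b)) (snd N (d b) n) = arr_fun (\<rho> a) n"
      unfolding divisor_cocone_iff[OF N] by blast+
    have \<rho>_eq: "\<rho> a = (fst N, arr_fun (\<rho> a), Y)" "arr_fun (\<rho> a) \<in> fst N \<rightarrow>\<^sub>E Y" if "a \<in> divs z" for a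
      using SetCat_Homs_eq[OF \<rho>[OF that]] by auto
    obtain h where h: "\<And>a n. a \<in> divs z \<Longrightarrow> n \<in> fst N \<Longrightarrow> h (tens F N (x a) n) = arr_fun (\<rho> a) n"
      using basis_factor[OF F basis N, of "\<lambda>a. arr_fun (\<rho> a)"] comp by blast
    have commute: "Cmp Sets k (\<iota> N a) = \<rho> a \<longleftrightarrow>
        (\<forall>n\<in>fst N. arr_fun k (tens F N (x a) n) = arr_fun (\<rho> a) n)"
      if k: "k \<in> Homs Sets (OMap F N) Y" and a: "a \<in> divs z" for k a
      using Cmp_SetCat_eq_iff[OF hom[OF N a] k \<rho>[OF a]] \<iota>_fun by simp
    show "\<exists>!k. k \<in> Homs Sets (OMap F N) Y \<and> (\<forall>a\<in>Obj (divisor_cat z). Cmp Sets k (\<iota> N a) = \<rho> a)"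
    proof (rule ex1I)
      have "h w \<in> Y" if w: "w \<in> OMap F N" for w
      proof -
        obtain a n where "a \<in> divs z" "n \<in> fst N" "w = tens F N (x a) n"
          by (rule basis_generates[OF F basis N w])
        then show ?thesis using h \<rho>_eq(2) by (metis PiE_mem)
      qed
      then have "(OMap F N, restrict h (OMap F N), Y) \<in> Homs Sets (OMap F N) Y"
        unfolding in_Homs_SetCat using functor_obj[OF F N] Y by auto
      moreover from this have
        "\<forall>a\<in>divs z. Cmp Sets (OMap F N, restrict h (OMap F N), Y) (\<iota> N a) = \<rho> a"
        using commute h tens_in[OF N] by simp
      ultimately show "(OMap F N, restrict h (OMap F N), Y) \<in> Homs Sets (OMap F N) Y \<and>
        (\<forall>a\<in>Obj (divisor_cat z). Cmp Sets (OMap F N, restrict h (OMap F N), Y) (\<iota> N a) = \<rho> a)"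
        by simp
    next
      fix k
      assume k: "k \<in> Homs Sets (OMap F N) Y \<and> (\<forall>a\<in>Obj (divisor_cat z). Cmp Sets k (\<iota> N a) = \<rho> a)"
      then obtain g where g: "k = (OMap F N, g, Y)" "g \<in> OMap F N \<rightarrow>\<^sub>E Y"
        unfolding in_Homs_SetCat by blast
      have "g w = h w" if w: "w \<in> OMap F N" for w
      proof -
        obtain a n where "a \<in> divs z" "n \<in> fst N" "w = tens F N (x a) n"
          by (rule basis_generates[OF F basis N w])
        then show ?thesis using k commute[of k a] h by (simp add: g)
      qed
      then have "g = restrict h (OMap F N)"
        using g(2) by (intro extensionalityI[of _ "OMap F N"]) (auto simp: PiE_iff)
      then show "k = (OMap F N, restrict h (OMap F N), Y)" by (simp add: g)
    qed
  qed
  moreover have "Cmp Sets (AMap F f) (\<iota> (Dom MSets f) a) = Cmp Sets (\<iota> (Cod MSets f) a) (AMap forgetful f)"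
    if arr: "f \<in> Arr MSets" and div: "a \<in> Obj (divisor_cat z)" for f a
  proof -
    obtain N g N' where f: "f = (N, g, N')" "(N, g, N') \<in> Arr MSets"
      using arr by (rule Arr_MSetCat_cases)
    have a: "a \<in> divs z" using div by simp
    obtain p where p: "AMap F (N, g, N') = (OMap F N, p, OMap F N')"
      using functor_arr(1)[OF F f(2)] by blast
    have "compose (fst N) p (\<lambda>n\<in>fst N. tens F N (x a) n) =
        compose (fst N) (\<lambda>n\<in>fst N'. tens F N' (x a) n) g"
      using tens_map[OF F f(2) _ basis_in[OF F basis a]] Arr_apply[OF f(2)]
      by (auto simp: compose_def fun_eq_iff p)
    then show ?thesis by (simp add: f(1) p \<iota>_def forgetful_def)
  qed
  ultimately show ?thesis using F unfolding is_divisor_colimit_def by blast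
qed

text \<open>Two pairs define the same germ if they agree over a common multiple \<open>fst p * e\<close> in the divisor set.\<close>

definition germ_rel :: "zhat \<Rightarrow> ('m, 'u) mset \<Rightarrow> nat \<times> 'u \<Rightarrow> nat \<times> 'u \<Rightarrow> bool" where
  "germ_rel z N p q \<longleftrightarrow> (\<exists>e e'. fst p * e \<in> divs z \<and> fst p * e = fst q * e' \<and>
     snd N (d e) (snd p) = snd N (d e') (snd q))"

lemma germ_rel_refl: "fst p \<in> divs z \<Longrightarrow> germ_rel z N p p"
  unfolding germ_rel_def by (intro exI[of _ 1]) simp

lemma germ_rel_sym: "germ_rel z N p q \<Longrightarrow> germ_rel z N q p"
  unfolding germ_rel_def by metis

lemma germ_rel_trans:
  assumes N: "N \<in> Obj MSets" and p: "snd p \<in> fst N" and q: "snd q \<in> fst N" and r: "snd r \<in> fst N"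
    and pq: "germ_rel z N p q" and qr: "germ_rel z N q r"
  shows "germ_rel z N p r"
proof -
  obtain e e' where e: "fst p * e \<in> divs z" "fst p * e = fst q * e'"
      "snd N (d e) (snd p) = snd N (d e') (snd q)" using pq unfolding germ_rel_def by blast
  obtain f f' where f: "fst q * f \<in> divs z" "fst q * f = fst r * f'"
      "snd N (d f) (snd q) = snd N (d f') (snd r)" using qr unfolding germ_rel_def by blast
  obtain s where s: "lcm e' f = s * e'" by (metis dvd_def dvd_lcm1 mult.commute)
  obtain t where t: "lcm e' f = t * f" by (metis dvd_def dvd_lcm2 mult.commute)
  have "fst q * lcm e' f \<in> divs z"
    using divs_lcm[OF e(1) f(1)] unfolding e(2) by (simp add: lcm_mult_left)
  then have c: "fst q * (s * e') \<in> divs z" "fst q * (s * e') = fst q * (t * f)" by (simp_all flip: s t)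
  have eqs: "fst p * (s * e) = fst q * (s * e')" "fst q * (t * f) = fst r * (t * f')"
    using e(2) f(2) by (metis mult.left_commute)+
  have pos: "s > 0" "e' > 0" "t > 0" "f > 0" "e > 0" "f' > 0"
    using divs_pos[OF c(1)] divs_pos[OF c(1)[unfolded c(2)]] divs_pos[OF e(1)] divs_pos[OF f(1)[unfolded f(2)]]
    by auto
  have "snd N (d (s * e)) (snd p) = snd N (d (s * e')) (snd q)"
    using act_d_mult[OF N] pos p q e(3) by simp
  also have "\<dots> = snd N (d (t * f)) (snd q)" using s t by simp
  also have "\<dots> = snd N (d (t * f')) (snd r)" using act_d_mult[OF N] pos q r f(3) by simp
  finally show ?thesis
    unfolding germ_rel_def using c eqs by (intro exI[of _ "s * e"] exI[of _ "t * f'"]) simp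
qed

definition germ_code :: "('m, 'u) mset \<Rightarrow> nat \<times> 'u \<Rightarrow> 'u" where
  "germ_code N = (SOME f. inj_on f (UNIV \<times> fst N) \<and> f ` (UNIV \<times> fst N) \<in> U)"

lemma germ_code:
  assumes "N \<in> Obj MSets"
  shows "inj_on (germ_code N) (UNIV \<times> fst N)" "germ_code N ` (UNIV \<times> fst N) \<in> U"
  using someI_ex[OF universe_code_nat_times[OF universe, of "fst N"]] assms
  unfolding germ_code_def Obj_MSets by blast+

text \<open>The class of \<open>(a, n)\<close> must be an element of a small set, and is represented by the code of a chosen
representative.\<close>

definition germ :: "zhat \<Rightarrow> ('m, 'u) mset \<Rightarrow> nat \<Rightarrow> 'u \<Rightarrow> 'u" where
  "germ z N a n = germ_code N (SOME q. snd q \<in> fst N \<and> germ_rel z N q (a, n))"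

definition germs :: "zhat \<Rightarrow> ('m, 'u) mset \<Rightarrow> 'u set" where
  "germs z N = {germ z N a n | a n. a \<in> divs z \<and> n \<in> fst N}"

lemma germ_in: "a \<in> divs z \<Longrightarrow> n \<in> fst N \<Longrightarrow> germ z N a n \<in> germs z N"
  unfolding germs_def by blast

lemma germ_representative:
  assumes "a \<in> divs z" "n \<in> fst N"
  shows "snd (SOME q. snd q \<in> fst N \<and> germ_rel z N q (a, n)) \<in> fst N"
    "germ_rel z N (SOME q. snd q \<in> fst N \<and> germ_rel z N q (a, n)) (a, n)"
proof -
  have "snd (a, n) \<in> fst N \<and> germ_rel z N (a, n) (a, n)"
    using assms by (simp add: germ_rel_refl)
  from someI[of "\<lambda>q. snd q \<in> fst N \<and> germ_rel z N q (a, n)", OF this]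
  show "snd (SOME q. snd q \<in> fst N \<and> germ_rel z N q (a, n)) \<in> fst N"
    "germ_rel z N (SOME q. snd q \<in> fst N \<and> germ_rel z N q (a, n)) (a, n)" by blast+
qed

lemma germs_in_universe:
  assumes "N \<in> Obj MSets"
  shows "germs z N \<in> U"
proof (rule universe_subset[OF universe germ_code(2)[OF assms]])
  show "germs z N \<subseteq> germ_code N ` (UNIV \<times> fst N)"
  proof
    fix w assume "w \<in> germs z N"
    then obtain a n where "a \<in> divs z" "n \<in> fst N" "w = germ z N a n" unfolding germs_def by blast
    then show "w \<in> germ_code N ` (UNIV \<times> fst N)"
      using germ_representative(1)[of a z n N]
      by (simp only: germ_def) (intro imageI, simp add: mem_Times_iff)
  qed
qed

lemma germ_eq_iff:
  assumes N: "N \<in> Obj MSets" and a: "a \<in> divs z" "n \<in> fst N" and b: "b \<in> divs z" "k \<in> fst N"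
  shows "germ z N a n = germ z N b k \<longleftrightarrow> germ_rel z N (a, n) (b, k)"
proof
  define p q where "p = (SOME q. snd q \<in> fst N \<and> germ_rel z N q (a, n))"
    and "q = (SOME q. snd q \<in> fst N \<and> germ_rel z N q (b, k))"
  have p: "snd p \<in> fst N" "germ_rel z N p (a, n)" using germ_representative[OF a] by (auto simp: p_def)
  have q: "snd q \<in> fst N" "germ_rel z N q (b, k)" using germ_representative[OF b] by (auto simp: q_def)
  assume "germ z N a n = germ z N b k"
  then have "germ_code N p = germ_code N q" by (simp add: germ_def p_def q_def)
  then have "p = q"
    using p(1) q(1) by (intro inj_onD[OF germ_code(1)[OF N]]) (auto simp: mem_Times_iff)
  then show "germ_rel z N (a, n) (b, k)"
    using germ_rel_trans[OF N _ p(1) _ germ_rel_sym[OF p(2)]] q(2) a b by simp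
next
  assume rel: "germ_rel z N (a, n) (b, k)"
  have "(\<lambda>q. snd q \<in> fst N \<and> germ_rel z N q (a, n)) = (\<lambda>q. snd q \<in> fst N \<and> germ_rel z N q (b, k))"
  proof (intro ext conj_cong refl iffI)
    fix q :: "nat \<times> 'u" assume q: "snd q \<in> fst N"
    show "germ_rel z N q (b, k)" if "germ_rel z N q (a, n)"
      using germ_rel_trans[OF N q _ _ that rel] a b by simp
    show "germ_rel z N q (a, n)" if "germ_rel z N q (b, k)"
      using germ_rel_trans[OF N q _ _ that germ_rel_sym[OF rel]] a b by simp
  qed
  then show "germ z N a n = germ z N b k" by (simp add: germ_def)
qed

lemma germ_transition:
  assumes N: "N \<in> Obj MSets" and ab: "a * b \<in> divs z" and n: "n \<in> fst N"
  shows "germ z N (a * b) (snd N (d b) n) = germ z N a n"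
proof -
  have pos: "b > 0" using divs_pos[OF ab] by simp
  have "a \<in> divs z" by (rule divs_dvd[OF ab]) simp
  moreover have "snd N (d b) n \<in> fst N" using act_closed[OF N d_closed[OF pos] n] .
  moreover from this have "germ_rel z N (a * b, snd N (d b) n) (a, n)"
    unfolding germ_rel_def using ab d_one act_one[OF N] by (intro exI[of _ 1] exI[of _ b]) simp
  ultimately show ?thesis using germ_eq_iff[OF N ab] n by simp
qed

definition germ_map :: "zhat \<Rightarrow> ('m, 'u) mset_arr \<Rightarrow> 'u \<Rightarrow> 'u" where
  "germ_map z = (\<lambda>(N, f, N'). \<lambda>w\<in>germs z N.
     SOME v. \<exists>a\<in>divs z. \<exists>n\<in>fst N. w = germ z N a n \<and> v = germ z N' a (f n))"

definition germ_functor :: "zhat \<Rightarrow> (('m, 'u) mset, ('m, 'u) mset_arr, 'u set, 'u set_arr) fctr" where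
  "germ_functor z = \<lparr>OMap = germs z,
     AMap = (\<lambda>f. (germs z (fst f), germ_map z f, germs z (snd (snd f))))\<rparr>"

lemma germ_map_germ:
  assumes f: "(N, f, N') \<in> Arr MSets" and a: "a \<in> divs z" and n: "n \<in> fst N"
  shows "germ_map z (N, f, N') (germ z N a n) = germ z N' a (f n)"
proof -
  have N: "N \<in> Obj MSets" "N' \<in> Obj MSets" using f by (simp_all add: in_Arr_MSetCat)
  have "germ z N' b (f k) = germ z N' a (f n)"
    if b: "b \<in> divs z" "k \<in> fst N" and eq: "germ z N a n = germ z N b k" for b k
  proof -
    obtain e e' where e: "a * e \<in> divs z" "a * e = b * e'" "snd N (d e) n = snd N (d e') k"
      using eq unfolding germ_eq_iff[OF N(1) a n b] germ_rel_def by auto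
    have "e > 0" "e' > 0" using divs_pos[OF e(1)] divs_pos[OF e(1)[unfolded e(2)]] by auto
    then have "snd N' (d e) (f n) = snd N' (d e') (f k)"
      using e(3) Arr_equivariant[OF f d_closed n, of e] Arr_equivariant[OF f d_closed b(2), of e'] by simp
    then have "germ_rel z N' (a, f n) (b, f k)"
      unfolding germ_rel_def using e by (intro exI[of _ e] exI[of _ e']) simp
    then show ?thesis using germ_eq_iff[OF N(2) a Arr_apply[OF f n] b(1) Arr_apply[OF f b(2)]] by simp
  qed
  then have "(SOME v. \<exists>b\<in>divs z. \<exists>k\<in>fst N. germ z N a n = germ z N b k \<and> v = germ z N' b (f k)) =
      germ z N' a (f n)"
    using a n by (intro some_equality) blast+
  then show ?thesis using germ_in[OF a n] by (simp add: germ_map_def)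
qed

lemma germ_functor: "is_functor MSets Sets (germ_functor z)"
  unfolding is_functor_def
proof (intro conjI ballI impI)
  show "category MSets" "category Sets" by (rule category_MSetCat category_SetCat)+
  show "OMap (germ_functor z) N \<in> Obj Sets" if "N \<in> Obj MSets" for N
    using germs_in_universe[OF that] by (simp add: germ_functor_def)
next
  fix f assume "f \<in> Arr MSets"
  then obtain N g N' where f: "f = (N, g, N')" "(N, g, N') \<in> Arr MSets" by (rule Arr_MSetCat_cases)
  have N: "N \<in> Obj MSets" "N' \<in> Obj MSets" using f by (simp_all add: in_Arr_MSetCat)
  have "germ_map z (N, g, N') w \<in> germs z N'" if "w \<in> germs z N" for w
  proof -
    from that obtain a n where "a \<in> divs z" "n \<in> fst N" "w = germ z N a n"
      unfolding germs_def by blast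
    then show ?thesis using germ_map_germ[OF f(2)] germ_in[OF _ Arr_apply[OF f(2)]] by simp
  qed
  then have "germ_map z (N, g, N') \<in> germs z N \<rightarrow>\<^sub>E germs z N'"
    by (auto simp: germ_map_def)
  then show "AMap (germ_functor z) f \<in> Homs Sets (OMap (germ_functor z) (Dom MSets f)) (OMap (germ_functor z) (Cod MSets f))"
    using germs_in_universe N by (simp add: in_Homs_SetCat germ_functor_def f(1))
next
  fix N assume N: "N \<in> Obj MSets"
  have id: "(N, \<lambda>x\<in>fst N. x, N) \<in> Arr MSets"
    using N act_closed by (auto simp: in_Arr_MSetCat)
  have "germ_map z (N, \<lambda>x\<in>fst N. x, N) w = w" if "w \<in> germs z N" for w
    using that germ_map_germ[OF id] unfolding germs_def by auto
  then have "germ_map z (N, \<lambda>x\<in>fst N. x, N) = (\<lambda>w\<in>germs z N. w)"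
    by (intro extensionalityI[of _ "germs z N"]) (auto simp: germ_map_def)
  then show "AMap (germ_functor z) (Idn MSets N) = Idn Sets (OMap (germ_functor z) N)"
    by (simp add: germ_functor_def)
next
  fix f g assume "f \<in> Arr MSets" "g \<in> Arr MSets" "Cod MSets f = Dom MSets g"
  then obtain N f' N' g' N'' where f: "f = (N, f', N')" "(N, f', N') \<in> Arr MSets"
    and g: "g = (N', g', N'')" "(N', g', N'') \<in> Arr MSets"
    by (metis Arr_MSetCat_cases MSetCat_simps(1,2) fst_conv snd_conv)
  have "Cmp MSets g f \<in> Homs MSets N N''"
    using category_MSetCat[of U M] f g unfolding category_def by fastforce
  then have gf: "(N, compose (fst N) g' f', N'') \<in> Arr MSets" by (simp add: f g in_Homs_MSetCat)
  have "germ_map z (N, compose (fst N) g' f', N'') w = germ_map z (N', g', N'') (germ_map z (N, f', N') w)"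
    if w: "w \<in> germs z N" for w
  proof -
    obtain a n where an: "a \<in> divs z" "n \<in> fst N" "w = germ z N a n" using w unfolding germs_def by blast
    show ?thesis
      using germ_map_germ[OF gf an(1,2)] germ_map_germ[OF f(2) an(1,2)]
        germ_map_germ[OF g(2) an(1) Arr_apply[OF f(2) an(2)]] an
      by (simp add: compose_eq)
  qed
  then have "germ_map z (N, compose (fst N) g' f', N'') =
      compose (germs z N) (germ_map z (N', g', N'')) (germ_map z (N, f', N'))"
    by (intro extensionalityI[of _ "germs z N"]) (auto simp: germ_map_def compose_def)
  then show "AMap (germ_functor z) (Cmp MSets g f) = Cmp Sets (AMap (germ_functor z) g) (AMap (germ_functor z) f)"
    by (simp add: germ_functor_def f(1) g(1))
qed

lemma germ_functor_tens:
  assumes N: "N \<in> Obj MSets" "n \<in> fst N" and a: "a \<in> divs z" and m: "m \<in> carrier M"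
  shows "tens (germ_functor z) N (germ z regular a (code m)) n = germ z N a (snd N m n)"
  using germ_map_germ[OF orbit_map_Arr[OF N, unfolded orbit_map_def] a, of "code m"] m
  by (simp add: tens_def germ_functor_def orbit_map_def)

text \<open>Evaluating the germ of the unit over \<open>a\<close> at \<open>n\<close> gives the germ of \<open>n\<close> over \<open>a\<close>, so the defining
properties of a germ basis are those of germs.\<close>

lemma germ_functor_basis: "germ_basis (germ_functor z) z (\<lambda>a. germ z regular a (code \<one>))"
  unfolding germ_basis_def
proof (intro conjI ballI allI impI)
  show "germ z regular a (code \<one>) \<in> OMap (germ_functor z) regular" if "a \<in> divs z" for a
    using germ_in[OF that] by (simp add: germ_functor_def)
  show "right_mul (germ_functor z) (germ z regular (a * b) (code \<one>)) (d b) = germ z regular a (code \<one>)"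
    if ab: "a * b \<in> divs z" for a b
  proof -
    have "b > 0" using divs_pos[OF ab] by simp
    then show ?thesis
      using germ_functor_tens[OF regular_Obj _ ab one_closed, of "code (d b)"]
        germ_transition[OF regular_Obj ab, of "code \<one>"] d_closed by simp
  qed
  fix N assume N: "N \<in> Obj MSets"
  have tens: "tens (germ_functor z) N (germ z regular a (code \<one>)) n = germ z N a n"
    if "a \<in> divs z" "n \<in> fst N" for a n
    using germ_functor_tens[OF N that(2,1) one_closed] act_one[OF N that(2)] by simp
  show "\<exists>a\<in>divs z. \<exists>n\<in>fst N. w = tens (germ_functor z) N (germ z regular a (code \<one>)) n"
    if "w \<in> OMap (germ_functor z) N" for w
    using that tens by (force simp: germ_functor_def germs_def)
  show "\<exists>b. a * b \<in> divs z \<and> snd N (d b) n = snd N (d b) n'"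
    if a: "a \<in> divs z" and n: "n \<in> fst N" "n' \<in> fst N" and
      eq: "tens (germ_functor z) N (germ z regular a (code \<one>)) n =
        tens (germ_functor z) N (germ z regular a (code \<one>)) n'" for a n n'
  proof -
    have "germ_rel z N (a, n) (a, n')" using eq tens[OF a] n germ_eq_iff[OF N a n(1) a n(2)] by simp
    then show ?thesis using divs_pos[OF a] by (auto simp: germ_rel_def)
  qed
qed

lemma two_element_set:
  obtains p q where "p \<noteq> q" "{p, q} \<in> U"
proof -
  obtain X where X: "X \<in> U" "infinite X" using universe unfolding set_universe_def by blast
  obtain p where "p \<in> X" using X(2) infinite_imp_nonempty by blast
  moreover obtain q where "q \<in> X - {p}" using infinite_imp_nonempty[OF infinite_remove[OF X(2)]] by blast
  ultimately have "p \<noteq> q" "{p, q} \<subseteq> X" by auto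
  then show thesis by (intro that universe_subset[OF universe X(1)])
qed

text \<open>Naturality along the maps from the regular object forces the colimit maps to be \<open>n \<mapsto> x a \<otimes> n\<close>, where
\<open>x a\<close> is the image of the unit. The other two properties come from testing against particular
cocones: into a set of two elements to see that every element is reached, and into the set of germs
to see that only germs are identified.\<close>

lemma divisor_colimit_imp_basis:
  assumes "is_divisor_colimit U M d z F"
  shows "\<exists>x. germ_basis F z x"
proof -
  have F: "is_functor MSets Sets F" using assms by (simp add: is_divisor_colimit_def)
  obtain \<iota> where colim: "\<And>N. N \<in> Obj MSets \<Longrightarrow>
      colimit_cocone (divisor_cat z) Sets (divisor_diagram d N) (OMap F N) (\<iota> N)"
    and nat: "\<And>f a. f \<in> Arr MSets \<Longrightarrow> a \<in> Obj (divisor_cat z) \<Longrightarrow>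
      Cmp Sets (AMap F f) (\<iota> (Dom MSets f) a) = Cmp Sets (\<iota> (Cod MSets f) a) (AMap forgetful f)"
    using assms unfolding is_divisor_colimit_def by blast
  define x where "x a = arr_fun (\<iota> regular a) (code \<one>)" for a
  have cocone: "\<And>a. a \<in> divs z \<Longrightarrow> \<iota> N a \<in> Homs Sets (fst N) (OMap F N)"
    "\<And>a b n. a * b \<in> divs z \<Longrightarrow> n \<in> fst N \<Longrightarrow>
      arr_fun (\<iota> N (a * b)) (snd N (d b) n) = arr_fun (\<iota> N a) n" if N: "N \<in> Obj MSets" for N
    using colim[OF N] unfolding colimit_cocone_def divisor_cocone_iff[OF N] by blast+
  have \<iota>_eq: "\<iota> N a = (fst N, arr_fun (\<iota> N a), OMap F N)" "arr_fun (\<iota> N a) \<in> fst N \<rightarrow>\<^sub>E OMap F N"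
    if "N \<in> Obj MSets" "a \<in> divs z" for N a
    using cocone(1)[OF that] unfolding in_Homs_SetCat by auto
  have x: "x a \<in> OMap F regular" if "a \<in> divs z" for a
    unfolding x_def by (rule PiE_mem[OF \<iota>_eq(2)[OF regular_Obj that] code_in_regular[OF one_closed]])
  have \<iota>_tens: "arr_fun (\<iota> N a) n = tens F N (x a) n"
    if N: "N \<in> Obj MSets" and a: "a \<in> divs z" and n: "n \<in> fst N" for N a n
  proof -
    let ?f = "\<lambda>x\<in>fst regular. snd N (decode x) n"
    have f: "(regular, ?f, N) \<in> Arr MSets" using orbit_map_Arr[OF N n] by (simp add: orbit_map_def)
    obtain p where p: "AMap F (regular, ?f, N) = (OMap F regular, p, OMap F N)"
      using functor_arr(1)[OF F f] by blast
    have "Cmp Sets (AMap F (regular, ?f, N)) (\<iota> regular a) = Cmp Sets (\<iota> N a) (AMap forgetful (regular, ?f, N))"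
      using nat[OF f, of a] a by simp
    then have "compose (fst regular) p (arr_fun (\<iota> regular a)) = compose (fst regular) (arr_fun (\<iota> N a)) ?f"
      by (subst (asm) \<iota>_eq(1)[OF regular_Obj a], subst (asm) \<iota>_eq(1)[OF N a])
        (simp add: p forgetful_def)
    from fun_cong[OF this, of "code \<one>"] show ?thesis
      using act_one[OF N n] by (simp add: compose_eq x_def tens_def orbit_map_def p)
  qed
  have "germ_basis F z x"
    unfolding germ_basis_def
  proof (intro conjI ballI allI impI)
    show "x a \<in> OMap F regular" if "a \<in> divs z" for a by (rule x[OF that])
    show "right_mul F (x (a * b)) (d b) = x a" if ab: "a * b \<in> divs z" for a b
    proof -
      have "b > 0" using divs_pos[OF ab] by simp
      then show ?thesis
        using cocone(2)[OF regular_Obj ab, of "code \<one>"] \<iota>_tens[OF regular_Obj ab, of "code (d b)"] d_closed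
        by (simp add: x_def)
    qed
    fix N assume N: "N \<in> Obj MSets"
    show "\<exists>a\<in>divs z. \<exists>n\<in>fst N. w = tens F N (x a) n" if w: "w \<in> OMap F N" for w
    proof (rule ccontr)
      assume not: "\<not> ?thesis"
      obtain p q where pq: "p \<noteq> q" "{p, q} \<in> U" by (rule two_element_set)
      \<comment> \<open>Two maps that differ only at \<open>w\<close> and so agree on the images of all colimit maps.\<close>
      define k1 where "k1 = (OMap F N, \<lambda>v\<in>OMap F N. p, {p, q})"
      define k2 where "k2 = (OMap F N, \<lambda>v\<in>OMap F N. if v = w then q else p, {p, q})"
      define \<rho> where "\<rho> a = (fst N, \<lambda>n\<in>fst N. p, {p, q})" for a :: nat
      have U: "fst N \<in> U" "OMap F N \<in> U" using N functor_obj[OF F N] by (auto simp: Obj_MSets)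
      have hom: "\<rho> a \<in> Homs Sets (fst N) {p, q}" for a
        unfolding in_Homs_SetCat \<rho>_def using U pq(2) by auto
      have "arr_fun (\<rho> (a * b)) (snd N (d b) n) = arr_fun (\<rho> a) n"
        if ab: "a * b \<in> divs z" and n: "n \<in> fst N" for a b n
        using act_closed[OF N d_closed n, of b] divs_pos[OF ab] n by (simp add: \<rho>_def)
      then have "cocone (divisor_cat z) Sets (divisor_diagram d N) {p, q} \<rho>"
        unfolding divisor_cocone_iff[OF N] using pq(2) hom by blast
      then have "\<exists>!h. h \<in> Homs Sets (OMap F N) {p, q} \<and> (\<forall>j\<in>Obj (divisor_cat z). Cmp Sets h (\<iota> N j) = \<rho> j)"
        using colim[OF N] unfolding colimit_cocone_def by blast
      then have unique: "h = h'" if "h \<in> Homs Sets (OMap F N) {p, q}" "h' \<in> Homs Sets (OMap F N) {p, q}"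
          "\<And>j. j \<in> divs z \<Longrightarrow> Cmp Sets h (\<iota> N j) = \<rho> j \<and> Cmp Sets h' (\<iota> N j) = \<rho> j" for h h'
        using that unfolding divisor_cat_simps by blast
      have "k1 \<in> Homs Sets (OMap F N) {p, q}" "k2 \<in> Homs Sets (OMap F N) {p, q}"
        unfolding in_Homs_SetCat k1_def k2_def using U pq(2) by auto
      moreover have "Cmp Sets k1 (\<iota> N a) = \<rho> a \<and> Cmp Sets k2 (\<iota> N a) = \<rho> a" if a: "a \<in> divs z" for a
      proof -
        have "arr_fun (\<iota> N a) n \<in> OMap F N \<and> arr_fun (\<iota> N a) n \<noteq> w" if n: "n \<in> fst N" for n
          using \<iota>_eq(2)[OF N a] n not a \<iota>_tens[OF N a n] by (metis PiE_mem)
        then show ?thesis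
          by (subst (1 2) \<iota>_eq(1)[OF N a]) (auto simp: k1_def k2_def \<rho>_def compose_def fun_eq_iff)
      qed
      ultimately have "k1 = k2" by (rule unique)
      then have "(\<lambda>v\<in>OMap F N. p) w = (\<lambda>v\<in>OMap F N. if v = w then q else p) w"
        unfolding k1_def k2_def by (metis Pair_inject)
      then show False using pq(1) w by simp
    qed
    show "\<exists>b. a * b \<in> divs z \<and> snd N (d b) n = snd N (d b) n'"
      if a: "a \<in> divs z" and n: "n \<in> fst N" "n' \<in> fst N" and
        eq: "tens F N (x a) n = tens F N (x a) n'" for a n n'
    proof -
      \<comment> \<open>The map out of the colimit induced by this cocone tells apart different germs.\<close>
      define \<rho> where "\<rho> a = (fst N, \<lambda>n\<in>fst N. germ z N a n, germs z N)" for a :: nat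
      have hom: "\<rho> a \<in> Homs Sets (fst N) (germs z N)" if "a \<in> divs z" for a
        unfolding in_Homs_SetCat \<rho>_def using N germs_in_universe[OF N] germ_in[OF that] by (auto simp: Obj_MSets)
      have "arr_fun (\<rho> (a * b)) (snd N (d b) n) = arr_fun (\<rho> a) n"
        if ab: "a * b \<in> divs z" and n: "n \<in> fst N" for a b n
        using act_closed[OF N d_closed n, of b] divs_pos[OF ab] n germ_transition[OF N ab n]
        by (simp add: \<rho>_def)
      then have "cocone (divisor_cat z) Sets (divisor_diagram d N) (germs z N) \<rho>"
        unfolding divisor_cocone_iff[OF N] using germs_in_universe[OF N] hom by blast
      then have "\<exists>!h. h \<in> Homs Sets (OMap F N) (germs z N) \<and>
          (\<forall>j\<in>Obj (divisor_cat z). Cmp Sets h (\<iota> N j) = \<rho> j)"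
        using colim[OF N] unfolding colimit_cocone_def by blast
      then obtain h where h: "h \<in> Homs Sets (OMap F N) (germs z N)"
          "\<And>j. j \<in> divs z \<Longrightarrow> Cmp Sets h (\<iota> N j) = \<rho> j"
        unfolding divisor_cat_simps by blast
      obtain g where g: "h = (OMap F N, g, germs z N)" using h(1) unfolding in_Homs_SetCat by blast
      have "compose (fst N) g (arr_fun (\<iota> N a)) = (\<lambda>n\<in>fst N. germ z N a n)"
        using h(2)[OF a] by (subst (asm) \<iota>_eq(1)[OF N a]) (simp add: g \<rho>_def)
      then have "g (arr_fun (\<iota> N a) k) = germ z N a k" if "k \<in> fst N" for k
        using that by (metis compose_eq restrict_apply')
      then have "germ z N a n = germ z N a n'" using eq n \<iota>_tens[OF N a] by metis
      then have "germ_rel z N (a, n) (a, n')" using germ_eq_iff[OF N a n(1) a n(2)] by simp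
      then show ?thesis using divs_pos[OF a] by (auto simp: germ_rel_def)
    qed
  qed
  then show ?thesis by blast
qed

text \<open>The isomorphism sends \<open>x a \<otimes> n\<close> to \<open>x' a \<otimes> n\<close>.\<close>

lemma bases_imp_naturally_isomorphic:
  assumes F: "is_functor MSets Sets F" and F': "is_functor MSets Sets F'"
    and x: "germ_basis F z x" and x': "germ_basis F' z x'"
  shows "naturally_isomorphic MSets Sets F F'"
proof -
  have ex: "\<exists>h. \<forall>a\<in>divs z. \<forall>n\<in>fst N. h (tens G N (y a) n) = tens G' N (y' a) n"
    if G: "is_functor MSets Sets G" "germ_basis G z y" and G': "is_functor MSets Sets G'" "germ_basis G' z y'"
      and N: "N \<in> Obj MSets" for G y G' y' N
    using basis_factor[OF G N, of "\<lambda>a n. tens G' N (y' a) n"] basis_shift[OF G' N] by metis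
  obtain h where h: "\<And>N a n. N \<in> Obj MSets \<Longrightarrow> a \<in> divs z \<Longrightarrow> n \<in> fst N \<Longrightarrow>
      h N (tens F N (x a) n) = tens F' N (x' a) n"
    using ex[OF F x F' x'] by metis
  obtain k where k: "\<And>N a n. N \<in> Obj MSets \<Longrightarrow> a \<in> divs z \<Longrightarrow> n \<in> fst N \<Longrightarrow>
      k N (tens F' N (x' a) n) = tens F N (x a) n"
    using ex[OF F' x' F x] by metis
  have gen: "\<exists>a\<in>divs z. \<exists>n\<in>fst N. w = tens F N (x a) n" if "N \<in> Obj MSets" "w \<in> OMap F N" for N w
    using basis_generates[OF F x that] by metis
  have gen': "\<exists>a\<in>divs z. \<exists>n\<in>fst N. w = tens F' N (x' a) n" if "N \<in> Obj MSets" "w \<in> OMap F' N" for N w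
    using basis_generates[OF F' x' that] by metis
  have in_F: "tens F N (x a) n \<in> OMap F N" "tens F' N (x' a) n \<in> OMap F' N"
    if "N \<in> Obj MSets" "a \<in> divs z" "n \<in> fst N" for N a n
    using tens_closed[OF F that(1,3) basis_in[OF F x that(2)]]
      tens_closed[OF F' that(1,3) basis_in[OF F' x' that(2)]] by auto
  have hN: "h N w \<in> OMap F' N \<and> k N (h N w) = w" if "N \<in> Obj MSets" "w \<in> OMap F N" for N w
    using gen[OF that] h k in_F that(1) by metis
  have kN: "k N w \<in> OMap F N \<and> h N (k N w) = w" if "N \<in> Obj MSets" "w \<in> OMap F' N" for N w
    using gen'[OF that] h k in_F that(1) by metis
  define \<eta> where "\<eta> N = (OMap F N, restrict (h N) (OMap F N), OMap F' N)" for N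
  show ?thesis
    unfolding naturally_isomorphic_def
  proof (intro exI[of _ \<eta>] conjI ballI)
    fix N assume N: "N \<in> Obj MSets"
    show "\<eta> N \<in> Homs Sets (OMap F N) (OMap F' N)"
      unfolding in_Homs_SetCat \<eta>_def using hN[OF N] functor_obj[OF F N] functor_obj[OF F' N] by auto
    show "isomorphism Sets (\<eta> N)"
      unfolding \<eta>_def using hN[OF N] kN[OF N]
      by (intro isomorphism_SetCatI[where k = "restrict (k N) (OMap F' N)"]
          functor_obj[OF F N] functor_obj[OF F' N]) auto
  next
    fix f assume "f \<in> Arr MSets"
    then obtain N g N' where f: "f = (N, g, N')" "(N, g, N') \<in> Arr MSets" by (rule Arr_MSetCat_cases)
    have N: "N \<in> Obj MSets" "N' \<in> Obj MSets" using f by (simp_all add: in_Arr_MSetCat)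
    obtain p where p: "AMap F (N, g, N') = (OMap F N, p, OMap F N')" "p \<in> OMap F N \<rightarrow>\<^sub>E OMap F N'"
      using functor_arr[OF F f(2)] by (metis arr_fun_triple)
    obtain q where q: "AMap F' (N, g, N') = (OMap F' N, q, OMap F' N')"
      using functor_arr(1)[OF F' f(2)] by blast
    have "q (h N w) = h N' (p w)" if w: "w \<in> OMap F N" for w
    proof -
      obtain a n where an: "a \<in> divs z" "n \<in> fst N" "w = tens F N (x a) n" using gen[OF N(1) w] by blast
      have "q (tens F' N (x' a) n) = tens F' N' (x' a) (g n)"
        using tens_map[OF F' f(2) an(2) basis_in[OF F' x' an(1)]] by (simp add: q)
      moreover have "p (tens F N (x a) n) = tens F N' (x a) (g n)"
        using tens_map[OF F f(2) an(2) basis_in[OF F x an(1)]] by (simp add: p)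
      ultimately show ?thesis
        using h[OF N(1) an(1,2)] h[OF N(2) an(1) Arr_apply[OF f(2) an(2)]] an(3) by simp
    qed
    then have "compose (OMap F N) q (restrict (h N) (OMap F N)) =
        compose (OMap F N) (restrict (h N') (OMap F N')) p"
      using p(2) by (auto simp: compose_def fun_eq_iff)
    then show "Cmp Sets (AMap F' f) (\<eta> (Dom MSets f)) = Cmp Sets (\<eta> (Cod MSets f)) (AMap F f)"
      by (simp add: f(1) p(1) q \<eta>_def)
  qed
qed

text \<open>An isomorphism of functors commutes with all products \<open>x \<otimes> n\<close>, so the image of a germ basis is
one.\<close>

lemma basis_transport:
  assumes F: "is_functor MSets Sets F" and F': "is_functor MSets Sets F'"
    and iso: "naturally_isomorphic MSets Sets F F'" and x: "germ_basis F z x"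
  shows "\<exists>x'. germ_basis F' z x'"
proof -
  obtain \<eta> where \<eta>: "\<And>N. N \<in> Obj MSets \<Longrightarrow> \<eta> N \<in> Homs Sets (OMap F N) (OMap F' N)"
    "\<And>N. N \<in> Obj MSets \<Longrightarrow> isomorphism Sets (\<eta> N)"
    and nat: "\<And>f. f \<in> Arr MSets \<Longrightarrow>
      Cmp Sets (AMap F' f) (\<eta> (Dom MSets f)) = Cmp Sets (\<eta> (Cod MSets f)) (AMap F f)"
    using iso unfolding naturally_isomorphic_def by blast
  define e where "e N = arr_fun (\<eta> N)" for N
  have \<eta>_eq: "\<eta> N = (OMap F N, e N, OMap F' N)" if "N \<in> Obj MSets" for N
    using \<eta>(1)[OF that] unfolding in_Homs_SetCat e_def by auto
  have bij: "bij_betw (e N) (OMap F N) (OMap F' N)" if "N \<in> Obj MSets" for N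
    using \<eta>(2)[OF that] unfolding \<eta>_eq[OF that] by (rule isomorphism_SetCat_bij)
  have e_tens: "e N (tens F N y n) = tens F' N (e regular y) n"
    if N: "N \<in> Obj MSets" and n: "n \<in> fst N" and y: "y \<in> OMap F regular" for N n y
  proof -
    let ?f = "\<lambda>x\<in>fst regular. snd N (decode x) n"
    have f: "(regular, ?f, N) \<in> Arr MSets" using orbit_map_Arr[OF N n] by (simp add: orbit_map_def)
    obtain p where p: "AMap F (regular, ?f, N) = (OMap F regular, p, OMap F N)"
      using functor_arr(1)[OF F f] by blast
    obtain q where q: "AMap F' (regular, ?f, N) = (OMap F' regular, q, OMap F' N)"
      using functor_arr(1)[OF F' f] by blast
    have "compose (OMap F regular) q (e regular) = compose (OMap F regular) (e N) p"
      using nat[OF f] by (simp add: \<eta>_eq[OF N] \<eta>_eq[OF regular_Obj] p q)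
    from fun_cong[OF this, of y] show ?thesis
      using y by (simp add: compose_eq tens_def orbit_map_def p q)
  qed
  have "germ_basis F' z (\<lambda>a. e regular (x a))"
    unfolding germ_basis_def
  proof (intro conjI ballI allI impI)
    show "e regular (x a) \<in> OMap F' regular" if "a \<in> divs z" for a
      using bij_betwE[OF bij[OF regular_Obj]] basis_in[OF F x that] by blast
    show "right_mul F' (e regular (x (a * b))) (d b) = e regular (x a)" if ab: "a * b \<in> divs z" for a b
    proof -
      have "b > 0" using divs_pos[OF ab] by simp
      then show ?thesis
        using e_tens[OF regular_Obj _ basis_in[OF F x ab], of "code (d b)"] basis_transition[OF F x ab] d_closed
        by simp
    qed
    fix N assume N: "N \<in> Obj MSets"
    show "\<exists>a\<in>divs z. \<exists>n\<in>fst N. w = tens F' N (e regular (x a)) n" if w: "w \<in> OMap F' N" for w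
    proof -
      obtain v where v: "v \<in> OMap F N" "w = e N v" using bij[OF N] w unfolding bij_betw_def by blast
      obtain a n where an: "a \<in> divs z" "n \<in> fst N" "v = tens F N (x a) n"
        by (rule basis_generates[OF F x N v(1)])
      then have "w = tens F' N (e regular (x a)) n"
        using e_tens[OF N an(2) basis_in[OF F x an(1)]] v(2) by simp
      then show ?thesis using an by blast
    qed
    show "\<exists>b. a * b \<in> divs z \<and> snd N (d b) n = snd N (d b) n'"
      if a: "a \<in> divs z" and n: "n \<in> fst N" "n' \<in> fst N" and
        eq: "tens F' N (e regular (x a)) n = tens F' N (e regular (x a)) n'" for a n n'
    proof -
      have "tens F N (x a) n = tens F N (x a) n'"
      proof (rule inj_onD[OF bij_betw_imp_inj_on[OF bij[OF N]]])
        show "e N (tens F N (x a) n) = e N (tens F N (x a) n')"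
          using eq e_tens[OF N n(1) basis_in[OF F x a]] e_tens[OF N n(2) basis_in[OF F x a]] by simp
      qed (use tens_closed[OF F N _ basis_in[OF F x a]] n in auto)
      then show ?thesis using basis_eqD[OF F x N a n] by blast
    qed
  qed
  then show ?thesis by blast
qed

end

section \<open>Functors with a germ basis come from points\<close>

text \<open>A cone of sets is universal as soon as it is universal for families of single elements.\<close>

lemma limit_cone_SetI:
  assumes cone: "cone J (SetCat U) D X \<pi>"
    and D: "\<And>u. u \<in> Arr J \<Longrightarrow> AMap D u \<in> Homs (SetCat U) (OMap D (Dom J u)) (OMap D (Cod J u))"
    and J: "\<And>u. u \<in> Arr J \<Longrightarrow> Dom J u \<in> Obj J \<and> Cod J u \<in> Obj J"
    and elements: "\<And>w. (\<And>j. j \<in> Obj J \<Longrightarrow> w j \<in> OMap D j) \<Longrightarrow>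
      (\<And>u. u \<in> Arr J \<Longrightarrow> arr_fun (AMap D u) (w (Dom J u)) = w (Cod J u)) \<Longrightarrow>
      \<exists>!y. y \<in> X \<and> (\<forall>j\<in>Obj J. arr_fun (\<pi> j) y = w j)"
  shows "limit_cone J (SetCat U) D X \<pi>"
  unfolding limit_cone_def
proof (intro conjI cone allI impI)
  fix Y \<rho>
  assume \<rho>: "cone J (SetCat U) D Y \<rho>"
  have X: "X \<in> U" and \<pi>: "\<And>j. j \<in> Obj J \<Longrightarrow> \<pi> j \<in> Homs (SetCat U) X (OMap D j)"
    using cone by (simp_all add: cone_def)
  have Y: "Y \<in> U" and \<rho>_hom: "\<And>j. j \<in> Obj J \<Longrightarrow> \<rho> j \<in> Homs (SetCat U) Y (OMap D j)"
    and \<rho>_comp: "\<And>u. u \<in> Arr J \<Longrightarrow> Cmp (SetCat U) (AMap D u) (\<rho> (Dom J u)) = \<rho> (Cod J u)"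
    using \<rho> by (simp_all add: cone_def)
  have ex: "\<exists>!x. x \<in> X \<and> (\<forall>j\<in>Obj J. arr_fun (\<pi> j) x = arr_fun (\<rho> j) y)" if y: "y \<in> Y" for y
  proof (rule elements)
    show "arr_fun (\<rho> j) y \<in> OMap D j" if "j \<in> Obj J" for j
      using SetCat_Homs_eq(2)[OF \<rho>_hom[OF that]] y by (rule PiE_mem)
    show "arr_fun (AMap D u) (arr_fun (\<rho> (Dom J u)) y) = arr_fun (\<rho> (Cod J u)) y" if u: "u \<in> Arr J" for u
      using \<rho>_comp[OF u] Cmp_SetCat_eq_iff[OF \<rho>_hom D[OF u] \<rho>_hom] J[OF u] y by blast
  qed
  then have "\<exists>h. \<forall>y\<in>Y. h y \<in> X \<and> (\<forall>j\<in>Obj J. arr_fun (\<pi> j) (h y) = arr_fun (\<rho> j) y)"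
    by (intro bchoice ballI) (rule ex1_implies_ex)
  then obtain h where h: "\<And>y. y \<in> Y \<Longrightarrow> h y \<in> X"
    "\<And>y j. y \<in> Y \<Longrightarrow> j \<in> Obj J \<Longrightarrow> arr_fun (\<pi> j) (h y) = arr_fun (\<rho> j) y" by blast
  have hom: "(Y, restrict h Y, X) \<in> Homs (SetCat U) Y X"
    using X Y h(1) by (auto simp: in_Homs_SetCat)
  show "\<exists>!k. k \<in> Homs (SetCat U) Y X \<and> (\<forall>j\<in>Obj J. Cmp (SetCat U) (\<pi> j) k = \<rho> j)"
  proof (rule ex1I[of _ "(Y, restrict h Y, X)"])
    show "(Y, restrict h Y, X) \<in> Homs (SetCat U) Y X \<and>
        (\<forall>j\<in>Obj J. Cmp (SetCat U) (\<pi> j) (Y, restrict h Y, X) = \<rho> j)"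
      using hom h(2) by (simp add: Cmp_SetCat_eq_iff[OF hom \<pi> \<rho>_hom])
  next
    fix k assume k: "k \<in> Homs (SetCat U) Y X \<and> (\<forall>j\<in>Obj J. Cmp (SetCat U) (\<pi> j) k = \<rho> j)"
    then have k_hom: "k \<in> Homs (SetCat U) Y X" by blast
    have "arr_fun k y = h y" if y: "y \<in> Y" for y
    proof -
      have "arr_fun k y \<in> X \<and> (\<forall>j\<in>Obj J. arr_fun (\<pi> j) (arr_fun k y) = arr_fun (\<rho> j) y)"
        using k Cmp_SetCat_eq_iff[OF k_hom \<pi> \<rho>_hom] y PiE_mem[OF SetCat_Homs_eq(2)[OF k_hom] y] by blast
      moreover have "h y \<in> X \<and> (\<forall>j\<in>Obj J. arr_fun (\<pi> j) (h y) = arr_fun (\<rho> j) y)"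
        using h y by blast
      ultimately show ?thesis using ex[OF y] by blast
    qed
    then have "arr_fun k = restrict h Y"
      using SetCat_Homs_eq(2)[OF k_hom] by (intro extensionalityI[of _ Y]) (auto simp: PiE_iff)
    then show "k = (Y, restrict h Y, X)" using SetCat_Homs_eq(1)[OF k_hom] by simp
  qed
qed

text \<open>Test the universal property with a cone whose apex has one element.\<close>

lemma limit_cone_Set_element:
  assumes limit: "limit_cone J (SetCat U) D X \<pi>" and p: "{p} \<in> U"
    and D: "\<And>j. j \<in> Obj J \<Longrightarrow> OMap D j \<in> U"
      "\<And>u. u \<in> Arr J \<Longrightarrow> AMap D u \<in> Homs (SetCat U) (OMap D (Dom J u)) (OMap D (Cod J u))"
    and J: "\<And>u. u \<in> Arr J \<Longrightarrow> Dom J u \<in> Obj J \<and> Cod J u \<in> Obj J"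
    and w: "\<And>j. j \<in> Obj J \<Longrightarrow> w j \<in> OMap D j"
      "\<And>u. u \<in> Arr J \<Longrightarrow> arr_fun (AMap D u) (w (Dom J u)) = w (Cod J u)"
  obtains y where "y \<in> X" "\<And>j. j \<in> Obj J \<Longrightarrow> arr_fun (\<pi> j) y = w j"
proof -
  define \<rho> where "\<rho> j = ({p}, \<lambda>x\<in>{p}. w j, OMap D j)" for j
  have \<rho>: "\<rho> j \<in> Homs (SetCat U) {p} (OMap D j)" if "j \<in> Obj J" for j
    using p D(1) w(1) that by (auto simp: in_Homs_SetCat \<rho>_def)
  have "Cmp (SetCat U) (AMap D u) (\<rho> (Dom J u)) = \<rho> (Cod J u)" if u: "u \<in> Arr J" for u
    using Cmp_SetCat_eq_iff[OF \<rho> D(2)[OF u] \<rho>] J[OF u] w(2)[OF u] by (simp add: \<rho>_def)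
  then have "cone J (SetCat U) D {p} \<rho>" using p \<rho> by (simp add: cone_def)
  then obtain h where h: "h \<in> Homs (SetCat U) {p} X" "\<And>j. j \<in> Obj J \<Longrightarrow> Cmp (SetCat U) (\<pi> j) h = \<rho> j"
    using limit unfolding limit_cone_def by blast
  have \<pi>: "\<And>j. j \<in> Obj J \<Longrightarrow> \<pi> j \<in> Homs (SetCat U) X (OMap D j)"
    using limit by (simp add: limit_cone_def cone_def)
  show thesis
  proof (rule that)
    show "arr_fun h p \<in> X" using PiE_mem[OF SetCat_Homs_eq(2)[OF h(1)]] by simp
    show "arr_fun (\<pi> j) (arr_fun h p) = w j" if j: "j \<in> Obj J" for j
      using h(2)[OF j] unfolding Cmp_SetCat_eq_iff[OF h(1) \<pi>[OF j] \<rho>[OF j]] by (simp add: \<rho>_def)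
  qed
qed

lemma functor_category: "is_functor C D F \<Longrightarrow> category C"
  by (simp add: is_functor_def)

lemma category_Dom_Cod: "category J \<Longrightarrow> u \<in> Arr J \<Longrightarrow> Dom J u \<in> Obj J \<and> Cod J u \<in> Obj J"
  by (simp add: category_def)

context divisibility_monoid
begin

lemma diagram_arr:
  assumes K: "is_functor J MSets K" and u: "u \<in> Arr J"
  shows "AMap K u = (OMap K (Dom J u), arr_fun (AMap K u), OMap K (Cod J u))"
    "(OMap K (Dom J u), arr_fun (AMap K u), OMap K (Cod J u)) \<in> Arr MSets"
  using functor_Homs[OF K u] by (auto simp: in_Homs_MSetCat)

lemma diagram_obj: "is_functor J MSets K \<Longrightarrow> j \<in> Obj J \<Longrightarrow> OMap K j \<in> Obj MSets"
  by (simp add: is_functor_def)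

lemma cone_arr:
  assumes "cone J MSets K X \<pi>" "j \<in> Obj J"
  shows "\<pi> j = (X, arr_fun (\<pi> j), OMap K j)" "(X, arr_fun (\<pi> j), OMap K j) \<in> Arr MSets"
proof -
  have "\<pi> j \<in> Homs MSets X (OMap K j)" using assms by (simp add: cone_def)
  then show "\<pi> j = (X, arr_fun (\<pi> j), OMap K j)" "(X, arr_fun (\<pi> j), OMap K j) \<in> Arr MSets"
    by (auto simp: in_Homs_MSetCat)
qed

lemma orbit_map_Homs: "N \<in> Obj MSets \<Longrightarrow> n \<in> fst N \<Longrightarrow> orbit_map N n \<in> Homs MSets regular N"
  using orbit_map_Arr[of N n] by (auto simp: in_Homs_MSetCat orbit_map_def)

lemma Cmp_orbit_map:
  assumes "(N, f, N') \<in> Arr MSets" "n \<in> fst N"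
  shows "Cmp MSets (N, f, N') (orbit_map N n) = orbit_map N' (f n)"
  using compose_orbit_map[OF assms] by (simp add: orbit_map_def)

lemma orbit_map_apply: "N \<in> Obj MSets \<Longrightarrow> n \<in> fst N \<Longrightarrow> arr_fun (orbit_map N n) (code \<one>) = n"
  by (simp add: orbit_map_def act_one)

text \<open>An element of an \<open>M\<close>-set is a map from the regular object, so a compatible family of elements is a
cone with that apex.\<close>

lemma limit_cone_elements:
  assumes K: "is_functor J MSets K" and limit: "limit_cone J MSets K X \<pi>"
    and n: "\<And>j. j \<in> Obj J \<Longrightarrow> n j \<in> fst (OMap K j)"
      "\<And>u. u \<in> Arr J \<Longrightarrow> arr_fun (AMap K u) (n (Dom J u)) = n (Cod J u)"
  shows "\<exists>!y. y \<in> fst X \<and> (\<forall>j\<in>Obj J. arr_fun (\<pi> j) y = n j)"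
proof -
  have cone: "cone J MSets K X \<pi>" using limit by (simp add: limit_cone_def)
  have X: "X \<in> Obj MSets" using cone by (simp add: cone_def)
  note J = category_Dom_Cod[OF functor_category[OF K]]
  have "Cmp MSets (AMap K u) (orbit_map (OMap K (Dom J u)) (n (Dom J u))) =
      orbit_map (OMap K (Cod J u)) (n (Cod J u))" if u: "u \<in> Arr J" for u
    using Cmp_orbit_map[OF diagram_arr(2)[OF K u] n(1)] J[OF u] n(2)[OF u]
    by (subst diagram_arr(1)[OF K u]) simp
  then have "cone J MSets K regular (\<lambda>j. orbit_map (OMap K j) (n j))"
    using orbit_map_Homs[OF diagram_obj[OF K] n(1)] by (simp add: cone_def)
  then have ex: "\<exists>!h. h \<in> Homs MSets regular X \<and> (\<forall>j\<in>Obj J. Cmp MSets (\<pi> j) h = orbit_map (OMap K j) (n j))"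
    using limit unfolding limit_cone_def by blast
  then obtain h where h: "h \<in> Homs MSets regular X"
    "\<And>j. j \<in> Obj J \<Longrightarrow> Cmp MSets (\<pi> j) h = orbit_map (OMap K j) (n j)" by blast
  obtain g where g: "h = (regular, g, X)" "(regular, g, X) \<in> Arr MSets"
    using h(1) unfolding in_Homs_MSetCat by blast
  have orbit: "Cmp MSets (\<pi> j) (orbit_map X y) = orbit_map (OMap K j) (n j)"
    if "y \<in> fst X" "j \<in> Obj J" "arr_fun (\<pi> j) y = n j" for y j
    using Cmp_orbit_map[OF cone_arr(2)[OF cone that(2)] that(1)] that(3)
    by (subst cone_arr(1)[OF cone that(2)]) simp
  show ?thesis
  proof (rule ex1I[of _ "g (code \<one>)"], intro conjI ballI)
    show "g (code \<one>) \<in> fst X" by (rule Arr_apply[OF g(2)]) simp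
    show "arr_fun (\<pi> j) (g (code \<one>)) = n j" if j: "j \<in> Obj J" for j
    proof -
      have "compose (fst regular) (arr_fun (\<pi> j)) g = arr_fun (orbit_map (OMap K j) (n j))"
        using h(2)[OF j] by (subst (asm) cone_arr(1)[OF cone j]) (simp add: g(1) orbit_map_def)
      from fun_cong[OF this, of "code \<one>"] show ?thesis
        using orbit_map_apply[OF diagram_obj[OF K j] n(1)[OF j]] by (simp add: compose_eq)
    qed
  next
    fix y assume y: "y \<in> fst X \<and> (\<forall>j\<in>Obj J. arr_fun (\<pi> j) y = n j)"
    then have "orbit_map X y \<in> Homs MSets regular X \<and>
        (\<forall>j\<in>Obj J. Cmp MSets (\<pi> j) (orbit_map X y) = orbit_map (OMap K j) (n j))"
      using orbit_map_Homs[OF X] orbit by blast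
    then have "orbit_map X y = h" using ex h by blast
    then show "y = g (code \<one>)" using orbit_map_apply[OF X, of y] y by (simp add: g(1))
  qed
qed

text \<open>Filtered colimits commute with finite limits. The elements of a finite compatible family can be
written over one common divisor; the finitely many compatibility conditions then hold over a
multiple of it, where the family comes from an element of the limit. Uniqueness is the same argument
for two elements with equal components.\<close>

lemma basis_preserves_finite_limits:
  assumes F: "is_functor MSets Sets F" and basis: "germ_basis F z x"
  shows "preserves_finite_limits MSets Sets F"
  unfolding preserves_finite_limits_def
proof (intro allI impI, elim conjE)
  fix J :: "(nat, nat) cat" and K X \<pi>
  assume fin: "finite (Obj J)" "finite (Arr J)" and K: "is_functor J MSets K"
    and limit: "limit_cone J MSets K X \<pi>"
  have cone: "cone J MSets K X \<pi>" using limit by (simp add: limit_cone_def)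
  have X: "X \<in> Obj MSets" and cone_comp: "\<And>u. u \<in> Arr J \<Longrightarrow> Cmp MSets (AMap K u) (\<pi> (Dom J u)) = \<pi> (Cod J u)"
    using cone by (simp_all add: cone_def)
  note J = category_Dom_Cod[OF functor_category[OF K]]
  have cone_elem: "arr_fun (AMap K u) (arr_fun (\<pi> (Dom J u)) y) = arr_fun (\<pi> (Cod J u)) y"
    if u: "u \<in> Arr J" and y: "y \<in> fst X" for u y
  proof -
    have Ju: "Dom J u \<in> Obj J" "Cod J u \<in> Obj J" using J[OF u] by auto
    have "compose (fst X) (arr_fun (AMap K u)) (arr_fun (\<pi> (Dom J u))) = arr_fun (\<pi> (Cod J u))"
      using cone_comp[OF u]
      by (subst (asm) diagram_arr(1)[OF K u], subst (asm) cone_arr(1)[OF cone Ju(1)],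
          subst (asm) cone_arr(1)[OF cone Ju(2)]) simp
    from fun_cong[OF this, of y] show ?thesis using y by (simp add: compose_eq)
  qed
  have ap_tens: "ap F (\<pi> j) (tens F X v n) = tens F (OMap K j) v (arr_fun (\<pi> j) n)"
    if "j \<in> Obj J" "v \<in> OMap F regular" "n \<in> fst X" for j v n
    using tens_map[OF F cone_arr(2)[OF cone that(1)] that(3,2)]
    by (subst cone_arr(1)[OF cone that(1)])
  have hom_F: "AMap F a \<in> Homs Sets (OMap F N) (OMap F N')" if "a = (N, f, N')" "(N, f, N') \<in> Arr MSets" for a N f N'
    using functor_Homs[OF F that(2)] that(1) by simp
  have in_j: "arr_fun (\<pi> j) n \<in> fst (OMap K j)" if "j \<in> Obj J" "n \<in> fst X" for j n
    by (rule Arr_apply[OF cone_arr(2)[OF cone that(1)] that(2)])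
  have equiv_j: "arr_fun (\<pi> j) (snd X (d b) n) = snd (OMap K j) (d b) (arr_fun (\<pi> j) n)"
    if "j \<in> Obj J" "n \<in> fst X" "b > 0" for j n b
    by (rule Arr_equivariant[OF cone_arr(2)[OF cone that(1)] d_closed[OF that(3)] that(2)])
  show "limit_cone J Sets (fcomp F K) (OMap F X) (AMap F \<circ> \<pi>)"
  proof (rule limit_cone_SetI[OF _ _ J])
    show "AMap (fcomp F K) u \<in> Homs Sets (OMap (fcomp F K) (Dom J u)) (OMap (fcomp F K) (Cod J u))"
      if "u \<in> Arr J" for u
      using hom_F[OF diagram_arr[OF K that]] by (simp add: fcomp_def)
    show "cone J Sets (fcomp F K) (OMap F X) (AMap F \<circ> \<pi>)"
      unfolding cone_def
    proof (intro conjI ballI)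
      show "OMap F X \<in> Obj Sets" using functor_obj[OF F X] by simp
      show "(AMap F \<circ> \<pi>) j \<in> Homs Sets (OMap F X) (OMap (fcomp F K) j)" if "j \<in> Obj J" for j
        using hom_F[OF cone_arr[OF cone that]] by (simp add: fcomp_def)
      fix u assume u: "u \<in> Arr J"
      then have Ju: "Dom J u \<in> Obj J" using J by blast
      have "Cod MSets (\<pi> (Dom J u)) = Dom MSets (AMap K u)"
        by (subst cone_arr(1)[OF cone Ju], subst diagram_arr(1)[OF K u]) simp
      moreover have "\<pi> (Dom J u) \<in> Arr MSets" "AMap K u \<in> Arr MSets"
        using cone_arr[OF cone Ju] diagram_arr[OF K u] by simp_all
      ultimately show "Cmp Sets (AMap (fcomp F K) u) ((AMap F \<circ> \<pi>) (Dom J u)) = (AMap F \<circ> \<pi>) (Cod J u)"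
        using functor_Cmp[OF F, of "\<pi> (Dom J u)" "AMap K u"] cone_comp[OF u] by (simp add: fcomp_def)
    qed
  next
    fix w
    assume w_in: "\<And>j. j \<in> Obj J \<Longrightarrow> w j \<in> OMap (fcomp F K) j"
      and w_comp: "\<And>u. u \<in> Arr J \<Longrightarrow> arr_fun (AMap (fcomp F K) u) (w (Dom J u)) = w (Cod J u)"
    have "OMap K j \<in> Obj MSets \<and> w j \<in> OMap F (OMap K j)" if "j \<in> Obj J" for j
      using w_in[OF that] diagram_obj[OF K that] by (simp add: fcomp_def)
    then have "\<exists>a\<in>divs z. \<exists>n. \<forall>j\<in>Obj J. n j \<in> fst (OMap K j) \<and> w j = tens F (OMap K j) (x a) (n j)"
      by (rule basis_generates_common[OF F basis fin(1)])
    then obtain a n where a: "a \<in> divs z"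
      and n: "\<And>j. j \<in> Obj J \<Longrightarrow> n j \<in> fst (OMap K j) \<and> w j = tens F (OMap K j) (x a) (n j)"
      by blast
    have "tens F (OMap K (Cod J u)) (x a) (arr_fun (AMap K u) (n (Dom J u))) =
        tens F (OMap K (Cod J u)) (x a) (n (Cod J u))" if u: "u \<in> Arr J" for u
    proof -
      have "tens F (OMap K (Cod J u)) (x a) (arr_fun (AMap K u) (n (Dom J u))) =
          ap F (AMap K u) (tens F (OMap K (Dom J u)) (x a) (n (Dom J u)))"
        using tens_map[OF F diagram_arr(2)[OF K u] _ basis_in[OF F basis a], of "n (Dom J u)"]
          n[of "Dom J u"] J[OF u] diagram_arr(1)[OF K u] by simp
      also have "\<dots> = w (Cod J u)" using w_comp[OF u] n[of "Dom J u"] J[OF u] by (simp add: fcomp_def)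
      finally show ?thesis using n[of "Cod J u"] J[OF u] by simp
    qed
    then have "\<exists>b. a * b \<in> divs z \<and> (\<forall>u\<in>Arr J. snd (OMap K (Cod J u)) (d b) (arr_fun (AMap K u) (n (Dom J u))) =
        snd (OMap K (Cod J u)) (d b) (n (Cod J u)))"
      using n J Arr_apply[OF diagram_arr(2)[OF K]] diagram_obj[OF K]
      by (intro basis_eq_common[OF F basis fin(2) a]) blast
    then obtain b where b: "a * b \<in> divs z"
      "\<And>u. u \<in> Arr J \<Longrightarrow> snd (OMap K (Cod J u)) (d b) (arr_fun (AMap K u) (n (Dom J u))) =
        snd (OMap K (Cod J u)) (d b) (n (Cod J u))" by blast
    have bpos: "b > 0" using divs_pos[OF b(1)] by simp
    define n' where "n' j = snd (OMap K j) (d b) (n j)" for j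
    have "arr_fun (AMap K u) (n' (Dom J u)) = n' (Cod J u)" if u: "u \<in> Arr J" for u
      using Arr_equivariant[OF diagram_arr(2)[OF K u] d_closed[OF bpos], of "n (Dom J u)"] b(2)[OF u] n J[OF u]
      by (simp add: n'_def)
    moreover have "n' j \<in> fst (OMap K j)" if "j \<in> Obj J" for j
      using act_closed[OF diagram_obj[OF K that] d_closed[OF bpos]] n[OF that] by (simp add: n'_def)
    ultimately obtain y where y: "y \<in> fst X" "\<And>j. j \<in> Obj J \<Longrightarrow> arr_fun (\<pi> j) y = n' j"
      using limit_cone_elements[OF K limit, of n'] by blast
    define v' where "v' = tens F X (x (a * b)) y"
    have v'_in: "v' \<in> OMap F X"
      unfolding v'_def by (rule tens_closed[OF F X y(1) basis_in[OF F basis b(1)]])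
    have v'_w: "ap F (\<pi> j) v' = w j" if j: "j \<in> Obj J" for j
      using ap_tens[OF j basis_in[OF F basis b(1)] y(1)] y(2)[OF j] n[OF j]
        basis_shift[OF F basis diagram_obj[OF K j] _ b(1), of "n j"]
      by (simp add: n'_def v'_def)
    show "\<exists>!v. v \<in> OMap F X \<and> (\<forall>j\<in>Obj J. arr_fun ((AMap F \<circ> \<pi>) j) v = w j)"
    proof (rule ex1I[of _ v'])
      show "v' \<in> OMap F X \<and> (\<forall>j\<in>Obj J. arr_fun ((AMap F \<circ> \<pi>) j) v' = w j)"
        using v'_in v'_w by simp
    next
      fix v assume v: "v \<in> OMap F X \<and> (\<forall>j\<in>Obj J. arr_fun ((AMap F \<circ> \<pi>) j) v = w j)"
      have "X \<in> Obj MSets \<and> i \<in> OMap F X" if "i \<in> {v, v'}" for i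
        using that X v v'_in by blast
      then have "\<exists>c\<in>divs z. \<exists>k. \<forall>i\<in>{v, v'}. k i \<in> fst X \<and> i = tens F X (x c) (k i)"
        by (intro basis_generates_common[OF F basis, of _ "\<lambda>_. X"]) simp
      then obtain c where c: "c \<in> divs z" and "\<exists>k. \<forall>i\<in>{v, v'}. k i \<in> fst X \<and> i = tens F X (x c) (k i)"
        by (rule bexE)
      from this(2) obtain k where k: "\<forall>i\<in>{v, v'}. k i \<in> fst X \<and> i = tens F X (x c) (k i)"
        by (rule exE)
      have k_in: "k i \<in> fst X" and k_tens: "tens F X (x c) (k i) = i" if "i \<in> {v, v'}" for i
        using bspec[OF k that] by (blast, metis)
      have "tens F (OMap K j) (x c) (arr_fun (\<pi> j) (k v)) = tens F (OMap K j) (x c) (arr_fun (\<pi> j) (k v'))"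
        if j: "j \<in> Obj J" for j
      proof -
        have "tens F (OMap K j) (x c) (arr_fun (\<pi> j) (k i)) = ap F (\<pi> j) i" if "i \<in> {v, v'}" for i
          using ap_tens[OF j basis_in[OF F basis c] k_in[OF that]] k_tens[OF that] by simp
        then show ?thesis using v v'_w[OF j] j by simp
      qed
      then have "\<exists>e. c * e \<in> divs z \<and> (\<forall>j\<in>Obj J. snd (OMap K j) (d e) (arr_fun (\<pi> j) (k v)) =
          snd (OMap K j) (d e) (arr_fun (\<pi> j) (k v')))"
        using in_j k_in diagram_obj[OF K] by (intro basis_eq_common[OF F basis fin(1) c]) blast
      then obtain e where e: "c * e \<in> divs z" "\<And>j. j \<in> Obj J \<Longrightarrow> snd (OMap K j) (d e) (arr_fun (\<pi> j) (k v)) =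
          snd (OMap K j) (d e) (arr_fun (\<pi> j) (k v'))" by blast
      have epos: "e > 0" using divs_pos[OF e(1)] by simp
      have kX: "k v \<in> fst X" "k v' \<in> fst X" using k_in by blast+
      define l where "l = snd X (d e) (k v)"
      define l' where "l' = snd X (d e) (k v')"
      have l: "l \<in> fst X" "l' \<in> fst X"
        unfolding l_def l'_def using act_closed[OF X d_closed[OF epos]] kX by blast+
      have "arr_fun (\<pi> j) l' = arr_fun (\<pi> j) l" if j: "j \<in> Obj J" for j
        using equiv_j[OF j _ epos] kX e(2)[OF j] by (simp add: l_def l'_def)
      moreover have "\<exists>!y. y \<in> fst X \<and> (\<forall>j\<in>Obj J. arr_fun (\<pi> j) y = arr_fun (\<pi> j) l)"
        by (rule limit_cone_elements[OF K limit]) (use in_j l cone_elem in auto)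
      ultimately have "l' = l" using l by blast
      moreover have "tens F X (x (c * e)) l = v" "tens F X (x (c * e)) l' = v'"
        using basis_shift[OF F basis X kX(1) e(1)] basis_shift[OF F basis X kX(2) e(1)]
          k_tens[of v] k_tens[of v'] by (simp_all add: l_def l'_def)
      ultimately show "v = v'" by metis
    qed
  qed
qed

text \<open>This is what makes the powers in the right adjoint small.\<close>

lemma basis_countable:
  assumes F: "is_functor MSets Sets F" and basis: "germ_basis F z x"
  shows "countable (OMap F regular)"
proof (rule countable_subset)
  show "OMap F regular \<subseteq> (\<lambda>(a, m). right_mul F (x a) m) ` (UNIV \<times> carrier M)"
  proof
    fix w assume "w \<in> OMap F regular"
    then obtain a m where "m \<in> carrier M" "w = right_mul F (x a) m"
      by (rule basis_generates_regular[OF F basis])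
    then show "w \<in> (\<lambda>(a, m). right_mul F (x a) m) ` (UNIV \<times> carrier M)" by force
  qed
  show "countable ((\<lambda>(a, m). right_mul F (x a) m) ` (UNIV \<times> carrier M))"
    using countable_carrier by simp
qed

text \<open>The right adjoint sends \<open>Y\<close> to the set of functions from \<open>A\<close> to \<open>Y\<close>, where \<open>A\<close> is the value of \<open>F\<close> at
the regular object; \<open>m\<close> acts by precomposition with right multiplication by \<open>m\<close>. The transpose of
\<open>h\<close> is \<open>n \<mapsto> (y \<mapsto> h (y \<otimes> n))\<close>. A transpose determines \<open>h\<close> since products generate, and an
equivariant map into the power is a transpose because its values at the germ basis are compatible
with the transition maps.\<close>

lemma basis_right_adjoint:
  assumes F: "is_functor MSets Sets F" and basis: "germ_basis F z x"
  obtains G where "is_functor Sets MSets G" "adjoint MSets Sets F G"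
proof -
  define A where "A = OMap F regular"
  \<comment> \<open>\<open>pc\<close> encodes functions as elements of a small set, \<open>pd\<close> decodes them.\<close>
  define pc where "pc Y = (SOME f. inj_on f (A \<rightarrow>\<^sub>E Y) \<and> f ` (A \<rightarrow>\<^sub>E Y) \<in> U)" for Y :: "'u set"
  define C where "C Y = pc Y ` (A \<rightarrow>\<^sub>E Y)" for Y :: "'u set"
  define pd where "pd Y = inv_into (A \<rightarrow>\<^sub>E Y) (pc Y)" for Y :: "'u set"
  define G where "G Y = (C Y, \<lambda>m\<in>carrier M. \<lambda>v\<in>C Y. pc Y (\<lambda>x\<in>A. pd Y v (right_mul F x m)))" for Y :: "'u set"
  define Gmap where "Gmap Y g Z = (G Y, \<lambda>v\<in>C Y. pc Z (compose A g (pd Y v)), G Z)" for Y :: "'u set" and g :: "'u \<Rightarrow> 'u" and Z :: "'u set"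
  define GF where "GF = \<lparr>OMap = G, AMap = (\<lambda>(Y, g, Z). Gmap Y g Z)\<rparr>"
  have A: "A \<noteq> {}" "countable A"
    using basis_in[OF F basis one_in_divs(1)] basis_countable[OF F basis] by (auto simp: A_def)
  have pc: "inj_on (pc Y) (A \<rightarrow>\<^sub>E Y)" "C Y \<in> U" if "Y \<in> U" for Y
    using someI_ex[OF universe_code_power[OF universe that A(2,1)]] unfolding pc_def C_def by blast+
  have pd_pc: "pd Y (pc Y f) = f" if "Y \<in> U" "f \<in> A \<rightarrow>\<^sub>E Y" for Y f
    using inv_into_f_f[OF pc(1)[OF that(1)] that(2)] by (simp add: pd_def)
  have pd: "pd Y v \<in> A \<rightarrow>\<^sub>E Y" "pc Y (pd Y v) = v" if "v \<in> C Y" for Y v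
    using that inv_into_into[of v "pc Y" "A \<rightarrow>\<^sub>E Y"] f_inv_into_f[of v "pc Y" "A \<rightarrow>\<^sub>E Y"]
    unfolding C_def pd_def by blast+
  have pc_in: "pc Y f \<in> C Y" if "f \<in> A \<rightarrow>\<^sub>E Y" for Y f
    using that by (simp add: C_def)
  have mul_A: "right_mul F y m \<in> A" if "y \<in> A" "m \<in> carrier M" for y m
    using right_mul_closed[OF F _ that(2)] that(1) by (simp add: A_def)
  have shift: "(\<lambda>y\<in>A. pd Y v (right_mul F y m)) \<in> A \<rightarrow>\<^sub>E Y" if "v \<in> C Y" "m \<in> carrier M" for Y v m
    using PiE_mem[OF pd(1)[OF that(1)] mul_A[OF _ that(2)]] by auto
  have G_act: "snd (G Y) m v = pc Y (\<lambda>y\<in>A. pd Y v (right_mul F y m))" if "v \<in> C Y" "m \<in> carrier M" for Y v m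
    using that by (simp add: G_def)
  have pd_act: "pd Y (snd (G Y) m v) y = pd Y v (right_mul F y m)"
    if "Y \<in> U" "v \<in> C Y" "m \<in> carrier M" "y \<in> A" for Y v m y
    using pd_pc[OF that(1) shift[OF that(2,3)]] that(4) by (simp add: G_act[OF that(2,3)])
  have fst_G: "fst (G Y) = C Y" for Y by (simp add: G_def)
  have pd_inj: "v = v'" if "v \<in> C Y" "v' \<in> C Y" "\<And>y. y \<in> A \<Longrightarrow> pd Y v y = pd Y v' y" for Y v v'
  proof -
    have "pd Y v = pd Y v'" using that by (intro PiE_ext[OF pd(1)[OF that(1)] pd(1)[OF that(2)]])
    then show ?thesis using pd(2)[OF that(1)] pd(2)[OF that(2)] by metis
  qed
  have act_in: "snd (G Y) m v \<in> C Y" if "v \<in> C Y" "m \<in> carrier M" for Y v m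
    using pc_in[OF shift[OF that]] by (simp add: G_act[OF that])
  have G_obj: "G Y \<in> Obj MSets" if Y: "Y \<in> U" for Y
    unfolding Obj_MSets is_left_action_def fst_G
  proof (intro conjI ballI)
    show "C Y \<in> U" by (rule pc(2)[OF Y])
    show "snd (G Y) \<in> carrier M \<rightarrow>\<^sub>E C Y \<rightarrow>\<^sub>E C Y"
      using act_in by (auto simp: G_def)
    show "snd (G Y) \<one> v = v" if v: "v \<in> C Y" for v
      using right_mul_one[OF F] pd_act[OF Y v one_closed] v
      by (intro pd_inj[OF act_in[OF v one_closed] v]) (simp add: A_def)
    show "snd (G Y) (m \<otimes> k) v = snd (G Y) m (snd (G Y) k v)"
      if m: "m \<in> carrier M" and k: "k \<in> carrier M" and v: "v \<in> C Y" for m k v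
    proof (rule pd_inj[OF act_in[OF v m_closed[OF m k]] act_in[OF act_in[OF v k] m]])
      fix y assume y: "y \<in> A"
      show "pd Y (snd (G Y) (m \<otimes> k) v) y = pd Y (snd (G Y) m (snd (G Y) k v)) y"
        using pd_act[OF Y v m_closed[OF m k] y] pd_act[OF Y act_in[OF v k] m y]
          pd_act[OF Y v k mul_A[OF y m]] right_mul_mult[OF F _ m k, of y] y by (simp add: A_def)
    qed
  qed
  have compose_in: "compose A g (pd Y v) \<in> A \<rightarrow>\<^sub>E Z" if "g \<in> Y \<rightarrow>\<^sub>E Z" "v \<in> C Y" for g Y Z v
    using that pd(1)[OF that(2)] by (auto simp: compose_def PiE_iff)
  have pd_map: "pd Z (arr_fun (Gmap Y g Z) v) y = g (pd Y v y)"
    if "Y \<in> U" "Z \<in> U" "g \<in> Y \<rightarrow>\<^sub>E Z" "v \<in> C Y" "y \<in> A" for Y g Z v y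
    using pd_pc[OF that(2) compose_in[OF that(3,4)]] that(4,5) by (simp add: Gmap_def compose_eq)
  have map_in: "arr_fun (Gmap Y g Z) v \<in> C Z" if "g \<in> Y \<rightarrow>\<^sub>E Z" "v \<in> C Y" for Y g Z v
    using pc_in[OF compose_in[OF that]] that(2) by (simp add: Gmap_def)
  have Gmap_eq: "Gmap Y g Z = (G Y, arr_fun (Gmap Y g Z), G Z)" for Y g Z
    by (simp add: Gmap_def)
  have map_ext: "arr_fun (Gmap Y g Z) \<in> extensional (C Y)" for Y g Z
    by (simp add: Gmap_def)
  have Gmap_arr: "Gmap Y g Z \<in> Arr MSets" if YZ: "Y \<in> U" "Z \<in> U" and g: "g \<in> Y \<rightarrow>\<^sub>E Z" for Y g Z
  proof -
    have "arr_fun (Gmap Y g Z) (snd (G Y) m v) = snd (G Z) m (arr_fun (Gmap Y g Z) v)"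
      if m: "m \<in> carrier M" and v: "v \<in> C Y" for m v
    proof (rule pd_inj[OF map_in[OF g act_in[OF v m]] act_in[OF map_in[OF g v] m]])
      fix y assume y: "y \<in> A"
      show "pd Z (arr_fun (Gmap Y g Z) (snd (G Y) m v)) y = pd Z (snd (G Z) m (arr_fun (Gmap Y g Z) v)) y"
        using pd_map[OF YZ g act_in[OF v m] y] pd_act[OF YZ(1) v m y]
          pd_act[OF YZ(2) map_in[OF g v] m y] pd_map[OF YZ g v mul_A[OF y m]] by simp
    qed
    then show ?thesis
      by (subst Gmap_eq)
        (auto simp: in_Arr_MSetCat G_obj[OF YZ(1)] G_obj[OF YZ(2)] fst_G PiE_iff map_ext map_in[OF g])
  qed
  have G_functor: "is_functor Sets MSets GF"
    unfolding is_functor_def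
  proof (intro conjI ballI impI)
    show "category Sets" "category MSets" by (rule category_SetCat category_MSetCat)+
    show "OMap GF Y \<in> Obj MSets" if "Y \<in> Obj Sets" for Y
      using G_obj that by (simp add: GF_def)
    show "AMap GF f \<in> Homs MSets (OMap GF (Dom Sets f)) (OMap GF (Cod Sets f))" if "f \<in> Arr Sets" for f
    proof -
      obtain Y g Z where f: "f = (Y, g, Z)" by (cases f) auto
      then have "Gmap Y g Z \<in> Arr MSets" using that Gmap_arr by simp
      then show ?thesis
        by (simp add: f GF_def in_Homs_MSetCat) (metis Gmap_eq)
    qed
    show "AMap GF (Idn Sets Y) = Idn MSets (OMap GF Y)" if "Y \<in> Obj Sets" for Y
    proof -
      have Y: "Y \<in> U" and id: "(\<lambda>y\<in>Y. y) \<in> Y \<rightarrow>\<^sub>E Y" using that by auto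
      have "arr_fun (Gmap Y (\<lambda>y\<in>Y. y) Y) = (\<lambda>v\<in>C Y. v)"
      proof (rule extensionalityI[OF map_ext])
        fix v assume v: "v \<in> C Y"
        have "arr_fun (Gmap Y (\<lambda>y\<in>Y. y) Y) v = v"
          using pd_map[OF Y Y id v] PiE_mem[OF pd(1)[OF v]] by (intro pd_inj[OF map_in[OF id v] v]) simp
        then show "arr_fun (Gmap Y (\<lambda>y\<in>Y. y) Y) v = (\<lambda>v\<in>C Y. v) v" using v by simp
      qed simp
      then show ?thesis using Gmap_eq[of Y "\<lambda>y\<in>Y. y" Y] by (simp add: GF_def fst_G)
    qed
    show "AMap GF (Cmp Sets g f) = Cmp MSets (AMap GF g) (AMap GF f)"
      if "f \<in> Arr Sets" "g \<in> Arr Sets" "Cod Sets f = Dom Sets g" for f g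
    proof -
      obtain X f' Y where f: "f = (X, f', Y)" by (cases f) auto
      obtain Y' g' Z where g: "g = (Y', g', Z)" by (cases g) auto
      have YY: "Y' = Y" using that(3) f g by simp
      have U: "X \<in> U" "Y \<in> U" "Z \<in> U" and f': "f' \<in> X \<rightarrow>\<^sub>E Y" and g': "g' \<in> Y \<rightarrow>\<^sub>E Z"
        using that f g YY by auto
      have gf: "compose X g' f' \<in> X \<rightarrow>\<^sub>E Z" using f' g' by (auto simp: compose_def PiE_iff)
      have "arr_fun (Gmap X (compose X g' f') Z) = compose (C X) (arr_fun (Gmap Y g' Z)) (arr_fun (Gmap X f' Y))"
      proof (rule extensionalityI[OF map_ext])
        fix v assume v: "v \<in> C X"
        have "arr_fun (Gmap X (compose X g' f') Z) v = arr_fun (Gmap Y g' Z) (arr_fun (Gmap X f' Y) v)"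
        proof (rule pd_inj[OF map_in[OF gf v] map_in[OF g' map_in[OF f' v]]])
          fix y assume y: "y \<in> A"
          show "pd Z (arr_fun (Gmap X (compose X g' f') Z) v) y =
              pd Z (arr_fun (Gmap Y g' Z) (arr_fun (Gmap X f' Y) v)) y"
            using pd_map[OF U(1,3) gf v y] pd_map[OF U(2,3) g' map_in[OF f' v] y] pd_map[OF U(1,2) f' v y]
              PiE_mem[OF pd(1)[OF v] y] by (simp add: compose_eq)
        qed
        then show "arr_fun (Gmap X (compose X g' f') Z) v =
            compose (C X) (arr_fun (Gmap Y g' Z)) (arr_fun (Gmap X f' Y)) v"
          using v by (simp add: compose_eq)
      qed simp
      then have "Gmap X (compose X g' f') Z = Cmp MSets (Gmap Y g' Z) (Gmap X f' Y)"
        by (subst (1 2 3) Gmap_eq) (simp add: fst_G)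
      then show ?thesis by (simp add: GF_def f g YY)
    qed
  qed
  define \<phi> where "\<phi> N Y a = (N, \<lambda>n\<in>fst N. pc Y (\<lambda>y\<in>A. arr_fun a (tens F N y n)), G Y)"
    for N :: "('m, 'u) mset" and Y and a :: "'u set_arr"
  have tens_in: "tens F N y n \<in> OMap F N" if "N \<in> Obj MSets" "n \<in> fst N" "y \<in> A" for N n y
    using tens_closed[OF F that(1,2)] that(3) by (simp add: A_def)
  have row: "(\<lambda>y\<in>A. arr_fun a (tens F N y n)) \<in> A \<rightarrow>\<^sub>E Y"
    if "N \<in> Obj MSets" "a \<in> Homs Sets (OMap F N) Y" "n \<in> fst N" for N a Y n
    using PiE_mem[OF SetCat_Homs_eq(2)[OF that(2)] tens_in[OF that(1,3)]] by auto
  have \<phi>_in: "arr_fun (\<phi> N Y a) n \<in> C Y" "y \<in> A \<Longrightarrow> pd Y (arr_fun (\<phi> N Y a) n) y = arr_fun a (tens F N y n)"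
    if N: "N \<in> Obj MSets" and a: "a \<in> Homs Sets (OMap F N) Y" and n: "n \<in> fst N" for N a Y n y
    using pc_in[OF row[OF N a n]] pd_pc[OF _ row[OF N a n]] SetCat_Homs_eq(3)[OF a] n by (auto simp: \<phi>_def)
  have \<phi>_eq: "\<phi> N Y a = (N, arr_fun (\<phi> N Y a), G Y)" for N Y a by (simp add: \<phi>_def)
  have \<phi>_ext: "arr_fun (\<phi> N Y a) \<in> extensional (fst N)" for N Y a by (simp add: \<phi>_def)
  have \<phi>_hom: "\<phi> N Y a \<in> Homs MSets N (G Y)"
    if N: "N \<in> Obj MSets" and Y: "Y \<in> U" and a: "a \<in> Homs Sets (OMap F N) Y" for N Y a
  proof -
    have "arr_fun (\<phi> N Y a) (snd N m n) = snd (G Y) m (arr_fun (\<phi> N Y a) n)"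
      if m: "m \<in> carrier M" and n: "n \<in> fst N" for m n
    proof (rule pd_inj[OF \<phi>_in(1)[OF N a act_closed[OF N m n]] act_in[OF \<phi>_in(1)[OF N a n] m]])
      fix y assume y: "y \<in> A"
      show "pd Y (arr_fun (\<phi> N Y a) (snd N m n)) y = pd Y (snd (G Y) m (arr_fun (\<phi> N Y a) n)) y"
        using \<phi>_in(2)[OF N a act_closed[OF N m n] y] pd_act[OF Y \<phi>_in(1)[OF N a n] m y]
          \<phi>_in(2)[OF N a n mul_A[OF y m]] tens_right_mul[OF F N n _ m, of y] y by (simp add: A_def)
    qed
    then have "(N, arr_fun (\<phi> N Y a), G Y) \<in> Arr MSets"
      by (auto simp: in_Arr_MSetCat N G_obj[OF Y] fst_G PiE_iff \<phi>_ext \<phi>_in(1)[OF N a])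
    then show ?thesis using \<phi>_eq[of N Y a] by (auto simp: in_Homs_MSetCat)
  qed
  have "adjoint MSets Sets F GF"
    unfolding adjoint_def
  proof (intro exI[of _ \<phi>] conjI ballI)
    fix N Y assume N: "N \<in> Obj MSets" and "Y \<in> Obj Sets"
    then have Y: "Y \<in> U" by simp
    have inj: "inj_on (\<phi> N Y) (Homs Sets (OMap F N) Y)"
    proof (rule inj_onI)
      fix a a' assume a: "a \<in> Homs Sets (OMap F N) Y" and a': "a' \<in> Homs Sets (OMap F N) Y"
        and eq: "\<phi> N Y a = \<phi> N Y a'"
      have "arr_fun a = arr_fun a'"
      proof (rule PiE_ext[OF SetCat_Homs_eq(2)[OF a] SetCat_Homs_eq(2)[OF a']])
        fix w assume w: "w \<in> OMap F N"
        obtain e n where en: "e \<in> divs z" "n \<in> fst N" "w = tens F N (x e) n"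
          by (rule basis_generates[OF F basis N w])
        have xe: "x e \<in> A" using basis_in[OF F basis en(1)] by (simp add: A_def)
        show "arr_fun a w = arr_fun a' w"
          using \<phi>_in(2)[OF N a en(2) xe] \<phi>_in(2)[OF N a' en(2) xe] eq en(3) by simp
      qed
      then show "a = a'" using SetCat_Homs_eq(1)[OF a] SetCat_Homs_eq(1)[OF a'] by simp
    qed
    have surj: "k \<in> \<phi> N Y ` Homs Sets (OMap F N) Y" if k: "k \<in> Homs MSets N (G Y)" for k
    proof -
      obtain g where g: "k = (N, g, G Y)" "(N, g, G Y) \<in> Arr MSets" using k unfolding in_Homs_MSetCat by blast
      have gC: "g n \<in> C Y" if "n \<in> fst N" for n using Arr_apply[OF g(2) that] by (simp add: fst_G)
      have g_act: "pd Y (g (snd N m n)) y = pd Y (g n) (right_mul F y m)"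
        if "m \<in> carrier M" "n \<in> fst N" "y \<in> A" for m n y
        using Arr_equivariant[OF g(2) that(1,2)] pd_act[OF Y gC[OF that(2)] that(1,3)] by simp
      have "pd Y (g (snd N (d b) n)) (x (a * b)) = pd Y (g n) (x a)"
        if ab: "a * b \<in> divs z" and n: "n \<in> fst N" for a b n
        using g_act[OF d_closed n, of b "x (a * b)"] basis_in[OF F basis ab] basis_transition[OF F basis ab]
          divs_pos[OF ab] by (simp add: A_def)
      \<comment> \<open>The only candidate for a preimage of \<open>g\<close>, determined by evaluation at the germ basis.\<close>
      then obtain h where h: "\<And>a n. a \<in> divs z \<Longrightarrow> n \<in> fst N \<Longrightarrow> h (tens F N (x a) n) = pd Y (g n) (x a)"
        using basis_factor[OF F basis N, of "\<lambda>a n. pd Y (g n) (x a)"] by blast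
      have h_all: "h (tens F N y n) = pd Y (g n) y" if n: "n \<in> fst N" and y: "y \<in> A" for n y
      proof -
        obtain a m where a: "a \<in> divs z" and m: "m \<in> carrier M" and ym: "y = right_mul F (x a) m"
          using y unfolding A_def by (rule basis_generates_regular[OF F basis])
        have xa: "x a \<in> OMap F regular" "x a \<in> A" using basis_in[OF F basis a] by (auto simp: A_def)
        show ?thesis
          using tens_right_mul[OF F N n xa(1) m] h[OF a act_closed[OF N m n]] g_act[OF m n xa(2)] ym
          by simp
      qed
      have "h w \<in> Y" if w: "w \<in> OMap F N" for w
      proof -
        obtain e n where en: "e \<in> divs z" "n \<in> fst N" "w = tens F N (x e) n"
          by (rule basis_generates[OF F basis N w])
        then show ?thesis
          using h[OF en(1,2)] PiE_mem[OF pd(1)[OF gC[OF en(2)]], of "x e"] basis_in[OF F basis en(1)]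
          by (simp add: A_def)
      qed
      then have hom: "(OMap F N, restrict h (OMap F N), Y) \<in> Homs Sets (OMap F N) Y"
        using functor_obj[OF F N] Y by (auto simp: in_Homs_SetCat)
      have "arr_fun (\<phi> N Y (OMap F N, restrict h (OMap F N), Y)) = g"
      proof (rule extensionalityI[OF \<phi>_ext])
        show "g \<in> extensional (fst N)" using g(2) by (auto simp: in_Arr_MSetCat PiE_iff)
        fix n assume n: "n \<in> fst N"
        show "arr_fun (\<phi> N Y (OMap F N, restrict h (OMap F N), Y)) n = g n"
          using \<phi>_in(2)[OF N hom n] h_all[OF n] tens_in[OF N n]
          by (intro pd_inj[OF \<phi>_in(1)[OF N hom n] gC[OF n]]) simp
      qed
      then have "\<phi> N Y (OMap F N, restrict h (OMap F N), Y) = k"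
        using \<phi>_eq[of N Y "(OMap F N, restrict h (OMap F N), Y)"] g(1) by simp
      then show ?thesis using hom by blast
    qed
    have "bij_betw (\<phi> N Y) (Homs Sets (OMap F N) Y) (Homs MSets N (G Y))"
      using inj surj \<phi>_hom[OF N Y] by (auto simp: bij_betw_def)
    then show "bij_betw (\<phi> N Y) (Homs Sets (OMap F N) Y) (Homs MSets N (OMap GF Y))"
      by (simp add: GF_def)
  next
    fix h k f
    assume h: "h \<in> Arr MSets" and k: "k \<in> Arr Sets" and f: "f \<in> Homs Sets (OMap F (Cod MSets h)) (Dom Sets k)"
    obtain N h' N' where hh: "h = (N, h', N')" "(N, h', N') \<in> Arr MSets" using h by (rule Arr_MSetCat_cases)
    obtain Y k' Z where kk: "k = (Y, k', Z)" by (cases k) auto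
    have N: "N \<in> Obj MSets" "N' \<in> Obj MSets" using hh(2) by (simp_all add: in_Arr_MSetCat)
    have YZ: "Y \<in> U" "Z \<in> U" and k': "k' \<in> Y \<rightarrow>\<^sub>E Z" using k kk by auto
    have f: "f \<in> Homs Sets (OMap F N') Y" using f hh kk by simp
    obtain q where q: "f = (OMap F N', q, Y)" "q \<in> OMap F N' \<rightarrow>\<^sub>E Y" using f unfolding in_Homs_SetCat by blast
    obtain p where p: "AMap F h = (OMap F N, p, OMap F N')" "p \<in> OMap F N \<rightarrow>\<^sub>E OMap F N'"
      using functor_arr[OF F hh(2)] hh(1) by metis
    let ?a = "Cmp Sets k (Cmp Sets f (AMap F h))"
    have a: "?a \<in> Homs Sets (OMap F N) Z"
      using functor_obj[OF F N(1)] YZ p(2) q(2) k'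
      by (auto simp: in_Homs_SetCat kk q(1) p(1) compose_def PiE_iff)
    have a_apply: "arr_fun ?a (tens F N y n) = k' (q (tens F N' y (h' n)))" if "n \<in> fst N" "y \<in> A" for n y
      using tens_map[OF F hh(2) that(1), of y] that tens_in[OF N(1) that]
      by (simp add: kk q(1) p(1) hh(1)[symmetric] compose_eq A_def)
    have "arr_fun (\<phi> N Z ?a) =
        compose (fst N) (arr_fun (Gmap Y k' Z)) (compose (fst N) (arr_fun (\<phi> N' Y f)) h')"
    proof (rule extensionalityI[OF \<phi>_ext])
      fix n assume n: "n \<in> fst N"
      have n': "h' n \<in> fst N'" by (rule Arr_apply[OF hh(2) n])
      have "arr_fun (\<phi> N Z ?a) n = arr_fun (Gmap Y k' Z) (arr_fun (\<phi> N' Y f) (h' n))"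
      proof (rule pd_inj[OF \<phi>_in(1)[OF N(1) a n] map_in[OF k' \<phi>_in(1)[OF N(2) f n']]])
        fix y assume y: "y \<in> A"
        show "pd Z (arr_fun (\<phi> N Z ?a) n) y = pd Z (arr_fun (Gmap Y k' Z) (arr_fun (\<phi> N' Y f) (h' n))) y"
          using \<phi>_in(2)[OF N(1) a n y] a_apply[OF n y] pd_map[OF YZ k' \<phi>_in(1)[OF N(2) f n'] y]
            \<phi>_in(2)[OF N(2) f n' y] by (simp add: q(1))
      qed
      then show "arr_fun (\<phi> N Z ?a) n =
          compose (fst N) (arr_fun (Gmap Y k' Z)) (compose (fst N) (arr_fun (\<phi> N' Y f)) h') n"
        using n by (simp add: compose_eq)
    qed simp
    then have "\<phi> N Z ?a = Cmp MSets (Gmap Y k' Z) (Cmp MSets (\<phi> N' Y f) (N, h', N'))"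
      by (subst Gmap_eq, subst (2) \<phi>_eq, subst \<phi>_eq) simp
    then show "\<phi> (Dom MSets h) (Cod Sets k) ?a =
        Cmp MSets (AMap GF k) (Cmp MSets (\<phi> (Cod MSets h) (Dom Sets k) f) h)"
      by (simp add: hh(1) kk GF_def)
  qed
  then show thesis using G_functor that by blast
qed

lemma Cmp_MSets_eq_iff:
  assumes "(N, f, N') \<in> Arr MSets" "(N', g, N'') \<in> Arr MSets" "(N, l, N'') \<in> Arr MSets"
  shows "Cmp MSets (N', g, N'') (N, f, N') = (N, l, N'') \<longleftrightarrow> (\<forall>n\<in>fst N. g (f n) = l n)"
proof
  assume "\<forall>n\<in>fst N. g (f n) = l n"
  then have "compose (fst N) g f = l"
    using assms(3) by (intro extensionalityI[of _ "fst N"]) (auto simp: compose_def in_Arr_MSetCat PiE_iff)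
  then show "Cmp MSets (N', g, N'') (N, f, N') = (N, l, N'')" by simp
next
  assume "Cmp MSets (N', g, N'') (N, f, N') = (N, l, N'')"
  then have "l = compose (fst N) g f" by simp
  then show "\<forall>n\<in>fst N. g (f n) = l n" by (simp add: compose_def)
qed

section \<open>Inverse image functors of points have a germ basis\<close>

text \<open>The concrete limit: compatible families with the componentwise action.\<close>

lemma finite_limit_exists:
  assumes K: "is_functor J MSets K" and fin: "finite (Obj J)"
  obtains X \<pi> where "limit_cone J MSets K X \<pi>"
    "\<And>y u. y \<in> fst X \<Longrightarrow> u \<in> Arr J \<Longrightarrow> arr_fun (AMap K u) (arr_fun (\<pi> (Dom J u)) y) = arr_fun (\<pi> (Cod J u)) y"
    "\<And>j. j \<in> Obj J \<Longrightarrow> (X, arr_fun (\<pi> j), OMap K j) \<in> Arr MSets"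
proof -
  define P where "P = {v \<in> (\<Pi>\<^sub>E j\<in>Obj J. fst (OMap K j)). \<forall>u\<in>Arr J. arr_fun (AMap K u) (v (Dom J u)) = v (Cod J u)}"
  note J = category_Dom_Cod[OF functor_category[OF K]]
  have Kj: "OMap K j \<in> Obj MSets" if "j \<in> Obj J" for j by (rule diagram_obj[OF K that])
  have "fst (OMap K j) \<in> U" if "j \<in> Obj J" for j using Kj[OF that] by (simp add: Obj_MSets)
  then obtain Z where Z: "Z \<in> U" "(\<Pi>\<^sub>E j\<in>Obj J. fst (OMap K j)) \<lesssim> Z"
    using universe_finite_product[OF universe fin] by meson
  have "P \<lesssim> Z" using lepoll_trans[OF subset_imp_lepoll Z(2)] by (auto simp: P_def)
  then obtain enc where enc: "inj_on enc P" "enc ` P \<in> U"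
    using universe_code[OF universe Z(1)] by blast
  define dec where "dec = inv_into P enc"
  have dec_enc: "dec (enc v) = v" if "v \<in> P" for v using inv_into_f_f[OF enc(1) that] by (simp add: dec_def)
  define act where "act m v = (\<lambda>j\<in>Obj J. snd (OMap K j) m (v j))" for m and v :: "'a \<Rightarrow> 'u"
  define L where "L = (enc ` P, \<lambda>m\<in>carrier M. \<lambda>y\<in>enc ` P. enc (act m (dec y)))"
  have P_in: "v j \<in> fst (OMap K j)" if "v \<in> P" "j \<in> Obj J" for v j using that by (auto simp: P_def)
  have P_comp: "arr_fun (AMap K u) (v (Dom J u)) = v (Cod J u)" if "v \<in> P" "u \<in> Arr J" for v u
    using that by (simp add: P_def)
  have P_ext: "v = v'" if "v \<in> P" "v' \<in> P" "\<And>j. j \<in> Obj J \<Longrightarrow> v j = v' j" for v v'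
    using that unfolding P_def by (intro PiE_ext[of v "Obj J" "\<lambda>j. fst (OMap K j)" v']) auto
  have act_P: "act m v \<in> P" if m: "m \<in> carrier M" and v: "v \<in> P" for m v
  proof -
    have "arr_fun (AMap K u) (act m v (Dom J u)) = act m v (Cod J u)" if u: "u \<in> Arr J" for u
      using Arr_equivariant[OF diagram_arr(2)[OF K u] m P_in[OF v]] J[OF u] P_comp[OF v u]
      by (simp add: act_def)
    moreover have "act m v \<in> (\<Pi>\<^sub>E j\<in>Obj J. fst (OMap K j))"
      using act_closed[OF Kj m P_in[OF v]] by (auto simp: act_def)
    ultimately show ?thesis by (simp add: P_def)
  qed
  have fst_L: "fst L = enc ` P" by (simp add: L_def)
  have L_act: "snd L m (enc v) = enc (act m v)" if "m \<in> carrier M" "v \<in> P" for m v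
    using that dec_enc by (simp add: L_def)
  have L: "L \<in> Obj MSets"
    unfolding Obj_MSets is_left_action_def fst_L
  proof (intro conjI ballI)
    show "enc ` P \<in> U" by (rule enc(2))
    show "snd L \<in> carrier M \<rightarrow>\<^sub>E enc ` P \<rightarrow>\<^sub>E enc ` P"
      using act_P dec_enc by (auto simp: L_def)
    show "snd L \<one> y = y" if y: "y \<in> enc ` P" for y
    proof -
      from y obtain v where v: "v \<in> P" "y = enc v" by blast
      have "act \<one> v = v"
        by (rule P_ext[OF act_P[OF one_closed v(1)] v(1)]) (simp add: act_def act_one[OF Kj P_in[OF v(1)]])
      then show ?thesis using L_act[OF one_closed v(1)] v(2) by simp
    qed
    show "snd L (m \<otimes> k) y = snd L m (snd L k y)"
      if m: "m \<in> carrier M" and k: "k \<in> carrier M" and y: "y \<in> enc ` P" for m k y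
    proof -
      from y obtain v where v: "v \<in> P" "y = enc v" by blast
      have "act (m \<otimes> k) v = act m (act k v)"
        by (rule P_ext[OF act_P[OF m_closed[OF m k] v(1)] act_P[OF m act_P[OF k v(1)]]])
          (simp add: act_def act_mult[OF Kj m k P_in[OF v(1)]])
      then show ?thesis using L_act[OF m_closed[OF m k] v(1)] L_act[OF k v(1)] L_act[OF m act_P[OF k v(1)]] v(2)
        by simp
    qed
  qed
  define \<pi> where "\<pi> j = (L, \<lambda>y\<in>enc ` P. dec y j, OMap K j)" for j
  have \<pi>_enc: "arr_fun (\<pi> j) (enc v) = v j" if "v \<in> P" for j v
    using that dec_enc by (simp add: \<pi>_def)
  have \<pi>_eq: "\<pi> j = (L, arr_fun (\<pi> j), OMap K j)" for j by (simp add: \<pi>_def)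
  have \<pi>_arr: "(L, arr_fun (\<pi> j), OMap K j) \<in> Arr MSets" if j: "j \<in> Obj J" for j
  proof -
    have "arr_fun (\<pi> j) \<in> enc ` P \<rightarrow>\<^sub>E fst (OMap K j)"
      using P_in[OF _ j] dec_enc by (auto simp: \<pi>_def)
    moreover have "arr_fun (\<pi> j) (snd L m y) = snd (OMap K j) m (arr_fun (\<pi> j) y)"
      if m: "m \<in> carrier M" and y: "y \<in> enc ` P" for m y
      using y L_act[OF m] \<pi>_enc act_P[OF m] j by (auto simp: act_def)
    ultimately show ?thesis by (simp add: in_Arr_MSetCat L Kj[OF j] fst_L)
  qed
  have \<pi>_comp: "arr_fun (AMap K u) (arr_fun (\<pi> (Dom J u)) y) = arr_fun (\<pi> (Cod J u)) y"
    if "y \<in> fst L" "u \<in> Arr J" for y u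
    using that \<pi>_enc P_comp by (auto simp: fst_L)
  have \<pi>_hom: "\<pi> j \<in> Homs MSets L (OMap K j)" if "j \<in> Obj J" for j
    using \<pi>_arr[OF that] \<pi>_eq[of j] by (auto simp: in_Homs_MSetCat)
  have "limit_cone J MSets K L \<pi>"
    unfolding limit_cone_def
  proof (intro conjI allI impI)
    have "Cmp MSets (AMap K u) (\<pi> (Dom J u)) = \<pi> (Cod J u)" if u: "u \<in> Arr J" for u
      using Cmp_MSets_eq_iff[OF \<pi>_arr diagram_arr(2)[OF K u] \<pi>_arr] J[OF u] \<pi>_comp[OF _ u]
      by (subst diagram_arr(1)[OF K u], subst (1 2) \<pi>_eq) blast
    then show "cone J MSets K L \<pi>" using L \<pi>_hom by (simp add: cone_def)
  next
    fix Y \<rho> assume \<rho>: "cone J MSets K Y \<rho>"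
    have Y: "Y \<in> Obj MSets" using \<rho> by (simp add: cone_def)
    note \<rho>_eq = cone_arr(1)[OF \<rho>] and \<rho>_arr = cone_arr(2)[OF \<rho>]
    define tup where "tup y = (\<lambda>j\<in>Obj J. arr_fun (\<rho> j) y)" for y
    have \<rho>_comp: "arr_fun (AMap K u) (arr_fun (\<rho> (Dom J u)) y) = arr_fun (\<rho> (Cod J u)) y"
      if u: "u \<in> Arr J" and y: "y \<in> fst Y" for u y
    proof -
      have Ju: "Dom J u \<in> Obj J" "Cod J u \<in> Obj J" using J[OF u] by auto
      have "Cmp MSets (AMap K u) (\<rho> (Dom J u)) = \<rho> (Cod J u)" using \<rho> u by (simp add: cone_def)
      then show ?thesis
        using Cmp_MSets_eq_iff[OF \<rho>_arr[OF Ju(1)] diagram_arr(2)[OF K u] \<rho>_arr[OF Ju(2)]] y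
        by (subst (asm) diagram_arr(1)[OF K u], subst (asm) \<rho>_eq[OF Ju(1)], subst (asm) \<rho>_eq[OF Ju(2)]) blast
    qed
    have tup_P: "tup y \<in> P" if y: "y \<in> fst Y" for y
      unfolding P_def using Arr_apply[OF \<rho>_arr y] \<rho>_comp[OF _ y] J by (auto simp: tup_def)
    define h where "h = (\<lambda>y\<in>fst Y. enc (tup y))"
    have h_arr: "(Y, h, L) \<in> Arr MSets"
    proof -
      have "h (snd Y m y) = snd L m (h y)" if m: "m \<in> carrier M" and y: "y \<in> fst Y" for m y
      proof -
        have "tup (snd Y m y) = act m (tup y)"
          by (rule P_ext[OF tup_P[OF act_closed[OF Y m y]] act_P[OF m tup_P[OF y]]])
            (simp add: tup_def act_def Arr_equivariant[OF \<rho>_arr m y])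
        then show ?thesis using L_act[OF m tup_P[OF y]] act_closed[OF Y m y] y by (simp add: h_def)
      qed
      moreover have "h \<in> fst Y \<rightarrow>\<^sub>E fst L" using tup_P by (auto simp: h_def fst_L)
      ultimately show ?thesis using Y L by (simp add: in_Arr_MSetCat)
    qed
    have commute: "Cmp MSets (\<pi> j) (Y, k, L) = \<rho> j \<longleftrightarrow> (\<forall>y\<in>fst Y. arr_fun (\<pi> j) (k y) = arr_fun (\<rho> j) y)"
      if k: "(Y, k, L) \<in> Arr MSets" and j: "j \<in> Obj J" for k j
      using Cmp_MSets_eq_iff[OF k \<pi>_arr[OF j] \<rho>_arr[OF j]]
      by (subst \<pi>_eq, subst \<rho>_eq[OF j])
    show "\<exists>!k. k \<in> Homs MSets Y L \<and> (\<forall>j\<in>Obj J. Cmp MSets (\<pi> j) k = \<rho> j)"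
    proof (rule ex1I[of _ "(Y, h, L)"])
      show "(Y, h, L) \<in> Homs MSets Y L \<and> (\<forall>j\<in>Obj J. Cmp MSets (\<pi> j) (Y, h, L) = \<rho> j)"
        using h_arr commute[OF h_arr] \<pi>_enc[OF tup_P] by (simp add: in_Homs_MSetCat h_def tup_def)
    next
      fix k assume k: "k \<in> Homs MSets Y L \<and> (\<forall>j\<in>Obj J. Cmp MSets (\<pi> j) k = \<rho> j)"
      then obtain k' where k': "k = (Y, k', L)" "(Y, k', L) \<in> Arr MSets" unfolding in_Homs_MSetCat by blast
      have "k' y = h y" if y: "y \<in> fst Y" for y
      proof -
        from Arr_apply[OF k'(2) y] obtain v where v: "v \<in> P" "k' y = enc v" by (auto simp: fst_L)
        have "v = tup y"
        proof (rule P_ext[OF v(1) tup_P[OF y]])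
          fix j assume j: "j \<in> Obj J"
          then have "arr_fun (\<pi> j) (k' y) = arr_fun (\<rho> j) y"
            using k commute[OF k'(2) j] y by (simp add: k'(1))
          then show "v j = tup y j" using \<pi>_enc[OF v(1)] v(2) j by (simp add: tup_def)
        qed
        then show ?thesis using v(2) y by (simp add: h_def)
      qed
      then have "k' = h"
        using k'(2) by (intro extensionalityI[of _ "fst Y"]) (auto simp: h_def in_Arr_MSetCat PiE_iff)
      then show "k = (Y, h, L)" by (simp add: k'(1))
    qed
  qed
  then show thesis using that \<pi>_comp \<pi>_arr by blast
qed

text \<open>Two functions on \<open>F(N)\<close> that agree on all products have transposes that agree on all elements of \<open>N\<close>,
hence are equal. Apply this to a constant function and to a function differing from it
only at \<open>w\<close>.\<close>

lemma left_adjoint_generates: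
  assumes F: "is_functor MSets Sets F" and G: "is_functor Sets MSets G" and adj: "adjoint MSets Sets F G"
    and N: "N \<in> Obj MSets" and w: "w \<in> OMap F N"
  shows "\<exists>y\<in>OMap F regular. \<exists>n\<in>fst N. w = tens F N y n"
proof (rule ccontr)
  assume not: "\<not> ?thesis"
  obtain \<phi> where bij: "\<And>X Y. X \<in> Obj MSets \<Longrightarrow> Y \<in> Obj Sets \<Longrightarrow>
      bij_betw (\<phi> X Y) (Homs Sets (OMap F X) Y) (Homs MSets X (OMap G Y))"
    and nat: "\<And>h k f. h \<in> Arr MSets \<Longrightarrow> k \<in> Arr Sets \<Longrightarrow> f \<in> Homs Sets (OMap F (Cod MSets h)) (Dom Sets k) \<Longrightarrow>
      \<phi> (Dom MSets h) (Cod Sets k) (Cmp Sets k (Cmp Sets f (AMap F h))) =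
      Cmp MSets (AMap G k) (Cmp MSets (\<phi> (Cod MSets h) (Dom Sets k) f) h)"
    using adj unfolding adjoint_def by blast
  obtain p q where pq: "p \<noteq> q" "{p, q} \<in> U" by (rule two_element_set)
  define k1 where "k1 = (OMap F N, \<lambda>v\<in>OMap F N. p, {p, q})"
  define k2 where "k2 = (OMap F N, \<lambda>v\<in>OMap F N. if v = w then q else p, {p, q})"
  have FN: "OMap F N \<in> U" by (rule functor_obj[OF F N])
  have k: "k1 \<in> Homs Sets (OMap F N) {p, q}" "k2 \<in> Homs Sets (OMap F N) {p, q}"
    unfolding in_Homs_SetCat k1_def k2_def using FN pq(2) by auto
  have \<phi>k: "\<phi> N {p, q} k1 \<in> Homs MSets N (OMap G {p, q})" "\<phi> N {p, q} k2 \<in> Homs MSets N (OMap G {p, q})"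
    using bij_betwE[OF bij[OF N, of "{p, q}"]] pq(2) k by auto
  then obtain g1 g2 where g: "\<phi> N {p, q} k1 = (N, g1, OMap G {p, q})" "(N, g1, OMap G {p, q}) \<in> Arr MSets"
    "\<phi> N {p, q} k2 = (N, g2, OMap G {p, q})" "(N, g2, OMap G {p, q}) \<in> Arr MSets"
    unfolding in_Homs_MSetCat by blast
  define i where "i = ({p, q}, \<lambda>v\<in>{p, q}. v, {p, q})"
  have i: "i \<in> Arr Sets" using pq(2) by (auto simp: i_def)
  have "AMap G (Idn Sets {p, q}) = Idn MSets (OMap G {p, q})"
    using G pq(2) by (simp only: is_functor_def SetCat_simps)
  then have Gi: "AMap G i = (OMap G {p, q}, \<lambda>x\<in>fst (OMap G {p, q}). x, OMap G {p, q})"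
    by (simp add: i_def)
  have "g1 n = g2 n" if n: "n \<in> fst N" for n
  proof -
    let ?o = "orbit_map N n"
    have o: "?o \<in> Arr MSets" by (rule orbit_map_Arr[OF N n])
    have DC: "Dom MSets ?o = regular" "Cod MSets ?o = N" "Dom Sets i = {p, q}" "Cod Sets i = {p, q}"
      by (simp_all add: orbit_map_def i_def)
    obtain r where r: "AMap F ?o = (OMap F regular, r, OMap F N)"
      using functor_arr(1)[OF F o[unfolded orbit_map_def]] unfolding orbit_map_def by blast
    have "r y \<in> OMap F N \<and> r y \<noteq> w" if y: "y \<in> OMap F regular" for y
    proof -
      have "r y = tens F N y n" by (simp add: tens_def r)
      then show ?thesis using tens_closed[OF F N n y] not y n by auto
    qed
    then have "Cmp Sets k1 (AMap F ?o) = Cmp Sets k2 (AMap F ?o)"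
      by (auto simp: r k1_def k2_def compose_def fun_eq_iff)
    then have "Cmp MSets (AMap G i) (Cmp MSets (\<phi> N {p, q} k1) ?o) = Cmp MSets (AMap G i) (Cmp MSets (\<phi> N {p, q} k2) ?o)"
      using nat[OF o i, of k1] nat[OF o i, of k2] k unfolding DC by simp
    moreover have "Cmp MSets (AMap G i) (Cmp MSets (N, g, OMap G {p, q}) ?o) = orbit_map (OMap G {p, q}) (g n)"
      if ga: "(N, g, OMap G {p, q}) \<in> Arr MSets" for g
    proof -
      have GO: "OMap G {p, q} \<in> Obj MSets" using ga by (simp add: in_Arr_MSetCat)
      have gn: "g n \<in> fst (OMap G {p, q})" by (rule Arr_apply[OF ga n])
      have "(OMap G {p, q}, \<lambda>x\<in>fst (OMap G {p, q}). x, OMap G {p, q}) \<in> Arr MSets"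
        using GO act_closed[OF GO] by (auto simp: in_Arr_MSetCat)
      from Cmp_orbit_map[OF this gn] show ?thesis
        using gn by (simp only: Cmp_orbit_map[OF ga n] Gi) simp
    qed
    ultimately have "orbit_map (OMap G {p, q}) (g1 n) = orbit_map (OMap G {p, q}) (g2 n)"
      using g by simp
    moreover have "OMap G {p, q} \<in> Obj MSets" using g(2) by (simp add: in_Arr_MSetCat)
    ultimately show ?thesis
      using orbit_map_apply Arr_apply[OF g(2) n] Arr_apply[OF g(4) n] by metis
  qed
  then have "g1 = g2"
    using g(2,4) unfolding in_Arr_MSetCat by (meson PiE_ext)
  then have "\<phi> N {p, q} k1 = \<phi> N {p, q} k2" using g by simp
  then have "k1 = k2"
    using bij[OF N, of "{p, q}"] pq(2) k unfolding bij_betw_def inj_on_def by simp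
  then have "(\<lambda>v\<in>OMap F N. p) w = (\<lambda>v\<in>OMap F N. if v = w then q else p) w"
    unfolding k1_def k2_def by (metis Pair_inject)
  then show False using pq(1) w by simp
qed

text \<open>Two objects, their identities \<open>0\<close> and \<open>1\<close>, and as many parallel arrows as \<open>P\<close> has elements. Without
arrows its limits are products, with two arrows they are equalizers.\<close>

definition parallel_shape :: "nat set \<Rightarrow> (nat, nat) cat" where
  "parallel_shape P = \<lparr>Obj = {0, 1}, Arr = {0, 1} \<union> P,
     Dom = (\<lambda>u. if u = 1 then 1 else 0), Cod = (\<lambda>u. if u = 0 then 0 else 1),
     Idn = (\<lambda>j. j), Cmp = (\<lambda>g f. if f \<le> 1 then g else f)\<rparr>"

lemma category_parallel_shape:
  assumes "P \<subseteq> {2, 3}"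
  shows "category (parallel_shape P)"
  using assms unfolding category_def parallel_shape_def Homs_def by auto

lemma parallel_diagram:
  assumes f: "(N, f, N') \<in> Arr MSets" and g: "(N, g, N') \<in> Arr MSets" and P: "P \<subseteq> {2, 3}"
  shows "is_functor (parallel_shape P) MSets
    \<lparr>OMap = (\<lambda>j. if j = 0 then N else N'),
     AMap = (\<lambda>u. if u = 0 then (N, \<lambda>x\<in>fst N. x, N) else if u = 1 then (N', \<lambda>x\<in>fst N'. x, N')
       else if u = 2 then (N, f, N') else (N, g, N'))\<rparr>"
    (is "is_functor ?J MSets ?K")
proof -
  have N: "N \<in> Obj MSets" "N' \<in> Obj MSets" using f by (simp_all add: in_Arr_MSetCat)
  have id: "(L, \<lambda>x\<in>fst L. x, L) \<in> Arr MSets" if "L \<in> Obj MSets" for L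
    using that act_closed by (auto simp: in_Arr_MSetCat)
  have compose_id: "compose (fst N) h (\<lambda>x\<in>fst N. x) = h" "compose (fst N) (\<lambda>x\<in>fst N'. x) h = h"
    if h: "(N, h, N') \<in> Arr MSets" for h
  proof -
    have "h \<in> fst N \<rightarrow>\<^sub>E fst N'" using h by (simp add: in_Arr_MSetCat)
    then show "compose (fst N) h (\<lambda>x\<in>fst N. x) = h" "compose (fst N) (\<lambda>x\<in>fst N'. x) h = h"
      by (auto simp: compose_def fun_eq_iff PiE_iff extensional_def)
  qed
  have compose_id_id: "compose (fst L) (\<lambda>x\<in>fst L. x) (\<lambda>x\<in>fst L. x) = (\<lambda>x\<in>fst L. x)" for L :: "('m, 'u) mset"
    by (auto simp: compose_def)
  have hom: "AMap ?K u \<in> Homs MSets (OMap ?K (Dom ?J u)) (OMap ?K (Cod ?J u))" if "u \<in> Arr ?J" for u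
    using that P f g id[OF N(1)] id[OF N(2)] by (auto simp: parallel_shape_def in_Homs_MSetCat)
  have arrows: "u = 0 \<or> u = 1 \<or> u = 2 \<or> u = 3" if "u \<in> Arr ?J" for u
    using that P by (auto simp: parallel_shape_def)
  have comp: "AMap ?K (Cmp ?J v u) = Cmp MSets (AMap ?K v) (AMap ?K u)"
    if uv: "u \<in> Arr ?J" "v \<in> Arr ?J" "Cod ?J u = Dom ?J v" for u v
    using arrows[OF uv(1)] arrows[OF uv(2)] uv(3) compose_id[OF f] compose_id[OF g]
    by (elim disjE) (simp_all add: parallel_shape_def compose_id_id)
  show ?thesis
    unfolding is_functor_def
    using category_parallel_shape[OF P] category_MSetCat[of U M] hom comp N
    by (auto simp: parallel_shape_def)
qed

text \<open>The assumption \<open>gen\<close> is what the right adjoint contributes.\<close>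

context
  fixes F
  assumes F: "is_functor MSets Sets F" and lex: "preserves_finite_limits MSets Sets F"
    and gen: "\<And>N w. N \<in> Obj MSets \<Longrightarrow> w \<in> OMap F N \<Longrightarrow> \<exists>y\<in>OMap F regular. \<exists>n\<in>fst N. w = tens F N y n"
begin

text \<open>The family is an element of the limit of the values of \<open>F\<close>, hence of the value of \<open>F\<close> at the limit;
that element is a product \<open>y \<otimes> l\<close>, and the components of \<open>l\<close> are the required elements. For the empty
diagram, for two copies of the regular object and for a parallel pair this says that the category of
elements of the right \<open>M\<close>-set is filtered.\<close>

lemma flat_family:
  fixes J :: "(nat, nat) cat"
  assumes K: "is_functor J MSets K" and fin: "finite (Obj J)" "finite (Arr J)"
    and w: "\<And>j. j \<in> Obj J \<Longrightarrow> w j \<in> OMap F (OMap K j)"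
      "\<And>u. u \<in> Arr J \<Longrightarrow> ap F (AMap K u) (w (Dom J u)) = w (Cod J u)"
  obtains y n where "y \<in> OMap F regular" "\<And>j. j \<in> Obj J \<Longrightarrow> n j \<in> fst (OMap K j)"
    "\<And>j. j \<in> Obj J \<Longrightarrow> w j = tens F (OMap K j) y (n j)"
    "\<And>u. u \<in> Arr J \<Longrightarrow> arr_fun (AMap K u) (n (Dom J u)) = n (Cod J u)"
proof -
  obtain X \<pi> where limit: "limit_cone J MSets K X \<pi>"
    and comp: "\<And>y u. y \<in> fst X \<Longrightarrow> u \<in> Arr J \<Longrightarrow>
      arr_fun (AMap K u) (arr_fun (\<pi> (Dom J u)) y) = arr_fun (\<pi> (Cod J u)) y"
    and arr: "\<And>j. j \<in> Obj J \<Longrightarrow> (X, arr_fun (\<pi> j), OMap K j) \<in> Arr MSets"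
    using finite_limit_exists[OF K fin(1)] by blast
  have cone: "cone J MSets K X \<pi>" using limit by (simp add: limit_cone_def)
  have X: "X \<in> Obj MSets" using cone by (simp add: cone_def)
  obtain p q where pq: "{p, q} \<in> U" by (rule two_element_set)
  have "{p} \<in> U" by (rule universe_subset[OF universe pq]) simp
  moreover have "limit_cone J Sets (fcomp F K) (OMap F X) (AMap F \<circ> \<pi>)"
    using lex fin K limit unfolding preserves_finite_limits_def by blast
  moreover have "AMap (fcomp F K) u \<in> Homs Sets (OMap (fcomp F K) (Dom J u)) (OMap (fcomp F K) (Cod J u))"
    if u: "u \<in> Arr J" for u
  proof -
    have "AMap K u \<in> Arr MSets" using diagram_arr[OF K u] by simp
    from functor_Homs[OF F this] show ?thesis
      by (subst (asm) (2 3) diagram_arr(1)[OF K u]) (simp add: fcomp_def)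
  qed
  moreover have "OMap (fcomp F K) j \<in> U" if "j \<in> Obj J" for j
    using functor_obj[OF F diagram_obj[OF K that]] by (simp add: fcomp_def)
  ultimately obtain v where v: "v \<in> OMap F X" "\<And>j. j \<in> Obj J \<Longrightarrow> arr_fun ((AMap F \<circ> \<pi>) j) v = w j"
    using category_Dom_Cod[OF functor_category[OF K]] w
      limit_cone_Set_element[of J U "fcomp F K" "OMap F X" "AMap F \<circ> \<pi>" p w]
    by (simp add: fcomp_def) blast
  obtain y l where y: "y \<in> OMap F regular" and l: "l \<in> fst X" and vl: "v = tens F X y l" using gen[OF X v(1)] by blast
  show thesis
  proof (rule that[OF y, of "\<lambda>j. arr_fun (\<pi> j) l"])
    show "arr_fun (\<pi> j) l \<in> fst (OMap K j)" if "j \<in> Obj J" for j by (rule Arr_apply[OF arr[OF that] l])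
    show "w j = tens F (OMap K j) y (arr_fun (\<pi> j) l)" if j: "j \<in> Obj J" for j
    proof -
      have "w j = ap F (\<pi> j) (tens F X y l)" using v(2)[OF j] vl by simp
      also have "\<dots> = tens F (OMap K j) y (arr_fun (\<pi> j) l)"
        using tens_map[OF F arr[OF j] l y] by (subst cone_arr(1)[OF cone j])
      finally show ?thesis .
    qed
    show "arr_fun (AMap K u) (arr_fun (\<pi> (Dom J u)) l) = arr_fun (\<pi> (Cod J u)) l" if "u \<in> Arr J" for u
      by (rule comp[OF l that])
  qed
qed

lemma flat_nonempty: "OMap F regular \<noteq> {}"
proof -
  define J :: "(nat, nat) cat"
    where "J = \<lparr>Obj = {}, Arr = {}, Dom = (\<lambda>u. u), Cod = (\<lambda>u. u), Idn = (\<lambda>j. j), Cmp = (\<lambda>g f. f)\<rparr>"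
  have "category J" by (simp add: category_def J_def)
  then have "is_functor J MSets \<lparr>OMap = (\<lambda>_. regular), AMap = (\<lambda>_. undefined)\<rparr>"
    using category_MSetCat[of U M] by (simp add: is_functor_def J_def)
  then obtain y where "y \<in> OMap F regular"
    by (rule flat_family[of J _ "\<lambda>_. undefined"]) (auto simp: J_def)
  then show ?thesis by blast
qed

lemma regular_id: "(regular, \<lambda>x\<in>fst regular. x, regular) \<in> Arr MSets"
  using act_closed[OF regular_Obj] by (auto simp: in_Arr_MSetCat)

lemma flat_common:
  assumes x: "x \<in> OMap F regular" and y: "y \<in> OMap F regular"
  obtains v m k where "v \<in> OMap F regular" "m \<in> carrier M" "k \<in> carrier M"
    "x = right_mul F v m" "y = right_mul F v k"
proof -
  \<comment> \<open>Two copies of the regular object and their identities, in the form of \<open>parallel_diagram\<close>.\<close>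
  let ?J = "parallel_shape {}"
  let ?K = "\<lparr>OMap = (\<lambda>j. if j = 0 then regular else regular),
     AMap = (\<lambda>u. if u = 0 then (regular, \<lambda>x\<in>fst regular. x, regular)
       else if u = 1 then (regular, \<lambda>x\<in>fst regular. x, regular)
       else if u = 2 then (regular, \<lambda>x\<in>fst regular. x, regular) else (regular, \<lambda>x\<in>fst regular. x, regular))\<rparr>
     :: (nat, nat, ('m, 'u) mset, ('m, 'u) mset_arr) fctr"
  have K: "is_functor ?J MSets ?K" by (rule parallel_diagram[OF regular_id regular_id]) simp
  have idx: "ap F (regular, \<lambda>x\<in>fst regular. x, regular) v = v" if "v \<in> OMap F regular" for v
    by (rule functor_id[OF F regular_Obj that])
  obtain v n where v: "v \<in> OMap F regular" and n: "\<And>j. j \<in> Obj ?J \<Longrightarrow> n j \<in> fst (OMap ?K j)"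
    "\<And>j. j \<in> Obj ?J \<Longrightarrow> (if j = 0 then x else y) = tens F (OMap ?K j) v (n j)"
    by (rule flat_family[OF K, of "\<lambda>j. if j = 0 then x else y"])
      (use x y idx in \<open>auto simp: parallel_shape_def\<close>)
  have "n 0 \<in> code ` carrier M" "n 1 \<in> code ` carrier M"
    using n(1)[of 0] n(1)[of 1] by (auto simp: parallel_shape_def fst_regular)
  then obtain m k where mk: "m \<in> carrier M" "n 0 = code m" "k \<in> carrier M" "n 1 = code k" by blast
  have "x = right_mul F v m" "y = right_mul F v k"
    using n(2)[of 0] n(2)[of 1] mk by (simp_all add: parallel_shape_def)
  then show thesis using that v mk by blast
qed

lemma flat_equalize:
  assumes N: "N \<in> Obj MSets" and n: "n \<in> fst N" "n' \<in> fst N" and x: "x \<in> OMap F regular"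
    and eq: "tens F N x n = tens F N x n'"
  obtains v e where "v \<in> OMap F regular" "e \<in> carrier M" "x = right_mul F v e" "snd N e n = snd N e n'"
proof -
  let ?J = "parallel_shape {2, 3}"
  let ?f = "\<lambda>n. \<lambda>x\<in>fst regular. snd N (decode x) n"
  let ?K = "\<lparr>OMap = (\<lambda>j. if j = 0 then regular else N),
     AMap = (\<lambda>u. if u = 0 then (regular, \<lambda>x\<in>fst regular. x, regular)
       else if u = 1 then (N, \<lambda>x\<in>fst N. x, N)
       else if u = 2 then (regular, ?f n, N) else (regular, ?f n', N))\<rparr>
     :: (nat, nat, ('m, 'u) mset, ('m, 'u) mset_arr) fctr"
  have arr: "(regular, ?f k, N) \<in> Arr MSets" if "k \<in> fst N" for k
    using orbit_map_Arr[OF N that] by (simp add: orbit_map_def)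
  have K: "is_functor ?J MSets ?K" by (rule parallel_diagram[OF arr[OF n(1)] arr[OF n(2)]]) simp
  have idx: "ap F (L, \<lambda>x\<in>fst L. x, L) v = v" if "L \<in> Obj MSets" "v \<in> OMap F L" for L v
    by (rule functor_id[OF F that])
  have ap_f: "ap F (regular, ?f k, N) x = tens F N x k" for k by (simp add: tens_def orbit_map_def)
  have tens_N: "tens F N x n' \<in> OMap F N" by (rule tens_closed[OF F N n(2) x])
  obtain v l where v: "v \<in> OMap F regular" and l: "\<And>j. j \<in> Obj ?J \<Longrightarrow> l j \<in> fst (OMap ?K j)"
    "\<And>j. j \<in> Obj ?J \<Longrightarrow> (if j = 0 then x else tens F N x n) = tens F (OMap ?K j) v (l j)"
    "\<And>u. u \<in> Arr ?J \<Longrightarrow> arr_fun (AMap ?K u) (l (Dom ?J u)) = l (Cod ?J u)"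
    by (rule flat_family[OF K, of "\<lambda>j. if j = 0 then x else tens F N x n"])
      (use x idx[OF regular_Obj] idx[OF N] ap_f eq tens_N in \<open>auto simp: parallel_shape_def\<close>)
  have "l 0 \<in> code ` carrier M" using l(1)[of 0] by (auto simp: parallel_shape_def fst_regular)
  then obtain e where e: "e \<in> carrier M" "l 0 = code e" by blast
  have "x = right_mul F v e" using l(2)[of 0] e by (simp add: parallel_shape_def)
  moreover have "snd N e n = l 1" "snd N e n' = l 1"
    using l(3)[of 2] l(3)[of 3] e by (simp_all add: parallel_shape_def)
  ultimately show thesis using that v e by metis
qed

text \<open>Fix a reference element \<open>x0\<close>. Let \<open>T\<close> consist of the \<open>k\<close> by which \<open>x0\<close> is divisible. If \<open>x0\<close> is
both \<open>y d(a)\<close> and \<open>y' d(b)\<close>, flatness provides \<open>w\<close> with \<open>y = w m\<close>, \<open>y' = w m'\<close> and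
\<open>m d(a) = m' d(b)\<close>. The norm of this element is a common multiple of \<open>a\<close> and \<open>b\<close>, and it lies in \<open>T\<close>
because its unit part can be absorbed into \<open>w\<close>. So \<open>T\<close> is closed under least common multiples. For \<open>a = b\<close> the
same argument with right cancellation gives \<open>y = y'\<close>, which makes the quotients \<open>x a\<close> of \<open>x0\<close> compatible.\<close>

lemma flat_basis: "\<exists>z x. germ_basis F z x"
proof -
  define A where "A = OMap F regular"
  obtain x0 where x0: "x0 \<in> A" using flat_nonempty by (auto simp: A_def)
  define T where "T = {k. k > 0 \<and> (\<exists>y\<in>A. x0 = right_mul F y (d k))}"
  have mul_mul: "right_mul F (right_mul F y m) k = right_mul F y (m \<otimes> k)"
    if "y \<in> A" "m \<in> carrier M" "k \<in> carrier M" for y m k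
    using right_mul_mult[OF F _ that(2,3)] that(1) by (simp add: A_def)
  have mul_A: "right_mul F y m \<in> A" if "y \<in> A" "m \<in> carrier M" for y m
    using right_mul_closed[OF F _ that(2)] that(1) by (simp add: A_def)
  have equalize: "\<exists>v\<in>A. \<exists>e\<in>carrier M. y = right_mul F v e \<and> e \<otimes> m = e \<otimes> k"
    if y: "y \<in> A" and m: "m \<in> carrier M" "k \<in> carrier M" and eq: "right_mul F y m = right_mul F y k" for y m k
  proof -
    obtain v e where v: "v \<in> A" "e \<in> carrier M" "y = right_mul F v e"
      "snd regular e (code m) = snd regular e (code k)"
      using flat_equalize[OF regular_Obj _ _ _ eq] y m unfolding A_def by auto
    then have "code (e \<otimes> m) = code (e \<otimes> k)" using m by simp
    then have "e \<otimes> m = e \<otimes> k" using inj_onD[OF code(1)] m v(2) by blast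
    then show ?thesis using v by blast
  qed
  have common: "\<exists>w\<in>A. \<exists>m\<in>carrier M. \<exists>m'\<in>carrier M. y = right_mul F w m \<and> y' = right_mul F w m' \<and>
      m \<otimes> d k = m' \<otimes> d k'"
    if y: "y \<in> A" "y' \<in> A" and k: "k > 0" "k' > 0" and eq: "right_mul F y (d k) = right_mul F y' (d k')"
    for y y' k k'
  proof -
    obtain v m m' where v: "v \<in> A" "m \<in> carrier M" "m' \<in> carrier M"
      "y = right_mul F v m" "y' = right_mul F v m'"
      using flat_common y unfolding A_def by metis
    have "right_mul F v (m \<otimes> d k) = right_mul F v (m' \<otimes> d k')"
      using eq v mul_mul[OF v(1,2) d_closed[OF k(1)]] mul_mul[OF v(1,3) d_closed[OF k(2)]] by simp
    then obtain w e where w: "w \<in> A" "e \<in> carrier M" "v = right_mul F w e"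
      "e \<otimes> (m \<otimes> d k) = e \<otimes> (m' \<otimes> d k')"
      using equalize[OF v(1) m_closed[OF v(2) d_closed[OF k(1)]] m_closed[OF v(3) d_closed[OF k(2)]]] by blast
    have "y = right_mul F w (e \<otimes> m)" "y' = right_mul F w (e \<otimes> m')"
      using v w mul_mul[OF w(1,2)] by simp_all
    moreover have "(e \<otimes> m) \<otimes> d k = (e \<otimes> m') \<otimes> d k'"
      using w(4) m_assoc[OF w(2) v(2) d_closed[OF k(1)]] m_assoc[OF w(2) v(3) d_closed[OF k(2)]] by simp
    ultimately show ?thesis using w(1) m_closed[OF w(2) v(2)] m_closed[OF w(2) v(3)] by blast
  qed
  have unique: "y = y'"
    if y: "y \<in> A" "y' \<in> A" and k: "k > 0" and eq: "right_mul F y (d k) = right_mul F y' (d k)" for y y' k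
    using common[OF y k k eq] d_cancel[OF k] by metis
  have T_dvd: "b \<in> T" if a: "a \<in> T" and b: "b dvd a" for a b
  proof -
    obtain c where c: "a = c * b" using b by (metis dvd_def mult.commute)
    obtain y where y: "a > 0" "y \<in> A" "x0 = right_mul F y (d a)" using a by (auto simp: T_def)
    have pos: "c > 0" "b > 0" using c y(1) by auto
    have "x0 = right_mul F (right_mul F y (d c)) (d b)"
      using y(3) mul_mul[OF y(2) d_closed[OF pos(1)] d_closed[OF pos(2)]] d_mult[OF pos] c by simp
    then show ?thesis using pos mul_A[OF y(2) d_closed[OF pos(1)]] by (auto simp: T_def)
  qed
  have norm_in_T: "\<exists>u\<in>Units M. right_mul F w u \<in> A \<and> x0 = right_mul F (right_mul F w u) (d (nrm m)) \<and>
      m = u \<otimes> d (nrm m) \<and> nrm m \<in> T"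
    if w: "w \<in> A" and m: "m \<in> carrier M" and eq: "x0 = right_mul F w m" for w m
  proof -
    obtain u where u: "u \<in> Units M" "m = u \<otimes> d (nrm m)" using unit_times_d[OF m] by blast
    have pos: "nrm m > 0" by (rule nrm_pos[OF m])
    have "x0 = right_mul F (right_mul F w u) (d (nrm m))"
      using mul_mul[OF w Units_closed[OF u(1)] d_closed[OF pos]] u(2) eq by simp
    moreover have "right_mul F w u \<in> A" by (rule mul_A[OF w Units_closed[OF u(1)]])
    ultimately show ?thesis using u pos unfolding T_def by blast
  qed
  have T_lcm: "lcm a b \<in> T" if ab: "a \<in> T" "b \<in> T" for a b
  proof -
    obtain y y' where y: "a > 0" "y \<in> A" "x0 = right_mul F y (d a)" "b > 0" "y' \<in> A" "x0 = right_mul F y' (d b)"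
      using ab unfolding T_def by blast
    obtain w m m' where w: "w \<in> A" "m \<in> carrier M" "m' \<in> carrier M" "y = right_mul F w m"
      "m \<otimes> d a = m' \<otimes> d b"
      using common[OF y(2,5,1,4)] y(3,6) by metis
    have ma: "m \<otimes> d a \<in> carrier M" using w(2) d_closed[OF y(1)] by simp
    have "x0 = right_mul F w (m \<otimes> d a)" using y(3) w(4) mul_mul[OF w(1,2) d_closed[OF y(1)]] by simp
    then have in_T: "nrm (m \<otimes> d a) \<in> T" using norm_in_T[OF w(1) ma] by blast
    have "a dvd nrm (m \<otimes> d a)" using nrm_mult[OF w(2) d_closed[OF y(1)]] nrm_d[OF y(1)] by simp
    moreover have "b dvd nrm (m \<otimes> d a)"
      using nrm_mult[OF w(3) d_closed[OF y(4)]] nrm_d[OF y(4)] w(5) by simp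
    ultimately show ?thesis using T_dvd[OF in_T] by (simp add: lcm_least)
  qed
  have "x0 = right_mul F x0 (d 1)" using right_mul_one[OF F] x0 d_one by (simp add: A_def)
  then have one_T: "1 \<in> T" using x0 by (auto simp: T_def)
  have T_pos: "a > 0" if "a \<in> T" for a using that by (simp add: T_def)
  obtain z where z: "divs z = T"
    by (rule exists_zhat_with_divs[OF one_T T_pos T_dvd T_lcm])
  have "\<forall>a\<in>T. \<exists>y. y \<in> A \<and> x0 = right_mul F y (d a)" unfolding T_def by blast
  from bchoice[OF this] obtain x where x: "\<And>a. a \<in> T \<Longrightarrow> x a \<in> A \<and> x0 = right_mul F (x a) (d a)"
    by blast
  have "germ_basis F z x"
    unfolding germ_basis_def z
  proof (intro conjI ballI allI impI)
    show "x a \<in> OMap F regular" if "a \<in> T" for a using x[OF that] by (simp add: A_def)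
    show "right_mul F (x (a * b)) (d b) = x a" if ab: "a * b \<in> T" for a b
    proof -
      have a: "a \<in> T" by (rule T_dvd[OF ab]) simp
      have pos: "b > 0" "a > 0" using ab by (auto simp: T_def)
      have "right_mul F (right_mul F (x (a * b)) (d b)) (d a) = x0"
        using x[OF ab] mul_mul[of "x (a * b)", OF _ d_closed[OF pos(1)] d_closed[OF pos(2)]] d_mult[OF pos]
        by (simp add: mult.commute)
      then show ?thesis
        using unique[OF mul_A[OF _ d_closed[OF pos(1)]] _ pos(2)] x[OF ab] x[OF a] by metis
    qed
    fix N assume N: "N \<in> Obj MSets"
    show "\<exists>a\<in>T. \<exists>n\<in>fst N. w = tens F N (x a) n" if w: "w \<in> OMap F N" for w
    proof -
      obtain y n where y: "y \<in> A" and n: "n \<in> fst N" and wn: "w = tens F N y n"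
        using gen[OF N w] unfolding A_def by blast
      obtain v m k where v: "v \<in> A" "m \<in> carrier M" "k \<in> carrier M" "x0 = right_mul F v m" "y = right_mul F v k"
        using flat_common x0 y unfolding A_def by metis
      obtain u where u: "u \<in> Units M" "right_mul F v u \<in> A" "x0 = right_mul F (right_mul F v u) (d (nrm m))"
        "nrm m \<in> T" using norm_in_T[OF v(1,2,4)] by blast
      have "right_mul F v u = x (nrm m)"
        using unique[OF u(2) _ nrm_pos[OF v(2)]] x[OF u(4)] u(3) by metis
      then have "right_mul F (x (nrm m)) (inv u \<otimes> k) = right_mul F v (u \<otimes> (inv u \<otimes> k))"
        using mul_mul[OF v(1) Units_closed[OF u(1)], of "inv u \<otimes> k"] u(1) v(3) by simp
      also have "u \<otimes> (inv u \<otimes> k) = k"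
        using u(1) v(3) by (simp add: m_assoc[symmetric] Units_closed)
      finally have "y = right_mul F (x (nrm m)) (inv u \<otimes> k)" using v(5) by simp
      moreover have iuk: "inv u \<otimes> k \<in> carrier M" using u(1) v(3) by simp
      ultimately have "w = tens F N (x (nrm m)) (snd N (inv u \<otimes> k) n)"
        using wn tens_right_mul[OF F N n _ iuk] x[OF u(4)] by (simp add: A_def)
      then show ?thesis using u(4) act_closed[OF N iuk n] by blast
    qed
    show "\<exists>b. a * b \<in> T \<and> snd N (d b) n = snd N (d b) n'"
      if a: "a \<in> T" and n: "n \<in> fst N" "n' \<in> fst N" and eq: "tens F N (x a) n = tens F N (x a) n'" for a n n'
    proof -
      have apos: "a > 0" using a by (simp add: T_def)
      obtain v e where v: "v \<in> A" "e \<in> carrier M" "x a = right_mul F v e" "snd N e n = snd N e n'"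
        using flat_equalize[OF N n _ eq] x[OF a] unfolding A_def by metis
      have ea: "e \<otimes> d a \<in> carrier M" using v(2) d_closed[OF apos] by simp
      have "x0 = right_mul F v (e \<otimes> d a)" using x[OF a] v(3) mul_mul[OF v(1,2) d_closed[OF apos]] by simp
      then have "nrm (e \<otimes> d a) \<in> T" using norm_in_T[OF v(1) ea] by blast
      then have "a * nrm e \<in> T"
        using nrm_mult[OF v(2) d_closed[OF apos]] nrm_d[OF apos] by (simp add: mult.commute)
      moreover obtain u where u: "u \<in> Units M" "e = u \<otimes> d (nrm e)" using unit_times_d[OF v(2)] by blast
      have de: "d (nrm e) \<in> carrier M" by (rule d_closed[OF nrm_pos[OF v(2)]])
      have d_eq: "d (nrm e) = inv u \<otimes> e"
        using u de by (metis Units_closed Units_inv_closed Units_l_inv l_one m_assoc)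
      have "snd N (d (nrm e)) n = snd N (d (nrm e)) n'"
        unfolding d_eq using act_mult[OF N Units_inv_closed[OF u(1)] v(2)] n v(4) by simp
      ultimately show ?thesis by blast
    qed
  qed
  then show ?thesis by blast
qed

end

section \<open>Which profinite integers give the same point\<close>

text \<open>The multiples of \<open>k\<close> are cofinal among the divisors of \<open>k z\<close>, and dividing them by \<open>k\<close> gives the divisors
of \<open>z\<close>.\<close>

lemma basis_divisor_shift:
  assumes F: "is_functor MSets Sets F" and basis: "germ_basis F (of_nat k * z) x" and k: "k > 0"
  shows "germ_basis F z (\<lambda>a. x (k * a))"
proof -
  note iff = in_divs_mult_iff[OF k, of _ z]
  have iff2: "k * a * b \<in> divs (of_nat k * z) \<longleftrightarrow> a * b \<in> divs z" for a b
    using iff[of "a * b"] by (simp add: mult.assoc)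
  show ?thesis
    unfolding germ_basis_def
  proof (intro conjI ballI allI impI)
    show "x (k * a) \<in> OMap F regular" if "a \<in> divs z" for a
      using basis_in[OF F basis] iff that by blast
    show "right_mul F (x (k * (a * b))) (d b) = x (k * a)" if "a * b \<in> divs z" for a b
      using basis_transition[OF F basis, of "k * a" b] iff2 that by (simp add: mult.assoc)
    fix N assume N: "N \<in> Obj MSets"
    show "\<exists>a\<in>divs z. \<exists>n\<in>fst N. w = tens F N (x (k * a)) n" if w: "w \<in> OMap F N" for w
    proof -
      obtain a n where a: "a \<in> divs (of_nat k * z)" and n: "n \<in> fst N" and wn: "w = tens F N (x a) n"
        by (rule basis_generates[OF F basis N w])
      have "1 \<in> divs z" by simp
      then have "k \<in> divs (of_nat k * z)" using iff[of 1] by simp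
      then have l: "lcm a k \<in> divs (of_nat k * z)" using divs_lcm[OF a] by blast
      obtain b where b: "lcm a k = k * b" by (metis dvd_def dvd_lcm2)
      have kb: "k * b \<in> divs (of_nat k * z)" and dvd: "a dvd k * b" using l by (simp_all flip: b)
      have "k * b div a > 0"
        using dvd divs_pos[OF kb] by (auto simp: div_greater_zero_iff dvd_imp_le divs_pos[OF a])
      then have "snd N (d (k * b div a)) n \<in> fst N" using act_closed[OF N d_closed n] by blast
      moreover have "w = tens F N (x (k * b)) (snd N (d (k * b div a)) n)"
        using basis_shift_dvd[OF F basis N n kb dvd] wn by simp
      moreover have "b \<in> divs z" using kb iff by blast
      ultimately show ?thesis by blast
    qed
    show "\<exists>b. a * b \<in> divs z \<and> snd N (d b) n = snd N (d b) n'"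
      if a: "a \<in> divs z" and n: "n \<in> fst N" "n' \<in> fst N" and
        eq: "tens F N (x (k * a)) n = tens F N (x (k * a)) n'" for a n n'
      using basis_eqD[OF F basis N _ n eq] iff iff2 a by metis
  qed
qed

lemma basis_unit:
  assumes u: "u dvd 1"
  shows "germ_basis F (u * z) x \<longleftrightarrow> germ_basis F z x"
proof -
  have "u * z dvd z" using mult_dvd_mono[OF u dvd_refl, of z] by simp
  then have "divs (u * z) = divs z"
    unfolding divs_def by (blast intro: dvd_trans dvd_mult)
  then show ?thesis by (simp add: germ_basis_def)
qed

text \<open>The divisor set can be recovered from the right \<open>M\<close>-set and the element \<open>x 1\<close> alone. Norms
turn an equation in the monoid into a divisibility of integers.\<close>

lemma basis_divisors_iff:
  assumes F: "is_functor MSets Sets F" and basis: "germ_basis F z x" and a: "a > 0"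
  shows "a \<in> divs z \<longleftrightarrow> (\<exists>y\<in>OMap F regular. x 1 = right_mul F y (d a))"
proof
  assume az: "a \<in> divs z"
  then show "\<exists>y\<in>OMap F regular. x 1 = right_mul F y (d a)"
    using basis_transition[OF F basis, of 1 a] basis_in[OF F basis az] by force
next
  assume "\<exists>y\<in>OMap F regular. x 1 = right_mul F y (d a)"
  then obtain y where y: "y \<in> OMap F regular" "x 1 = right_mul F y (d a)" by blast
  obtain e m where e: "e \<in> divs z" and m: "m \<in> carrier M" and ym: "y = right_mul F (x e) m"
    by (rule basis_generates_regular[OF F basis y(1)])
  have epos: "e > 0" by (rule divs_pos[OF e])
  have "right_mul F (x e) (m \<otimes> d a) = right_mul F (x e) (d e)"
    using right_mul_mult[OF F basis_in[OF F basis e] m d_closed[OF a]] y(2) ym basis_origin[OF F basis e]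
    by simp
  then have "nrm (m \<otimes> d a) = nrm (d e)"
    using m d_closed a epos by (intro basis_norm_eq[OF F basis e]) auto
  then have "nrm m * a = e" using nrm_mult[OF m d_closed[OF a]] nrm_d a epos by simp
  then have "a dvd e" by auto
  then show "a \<in> divs z" by (rule divs_dvd[OF e])
qed

text \<open>For one inclusion, write \<open>x 1\<close> over a common divisor \<open>c\<close> of \<open>z'\<close> in two ways and compare norms. For
the other, a divisor \<open>a\<close> of \<open>t z'\<close> splits as \<open>a' g\<close> with \<open>g\<close> dividing \<open>t\<close> and \<open>a'\<close> dividing \<open>z'\<close>; then
\<open>y 1\<close> is divisible by \<open>d(a')\<close>, and moving the unit part of \<open>m\<close> to the left shows that \<open>x 1\<close> is
divisible by \<open>d(a)\<close>.\<close>

lemma basis_change_divisors: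
  assumes F: "is_functor MSets Sets F" and x: "germ_basis F z x" and y: "germ_basis F z' y"
    and m: "m \<in> carrier M" and xy: "x 1 = right_mul F (y 1) m"
  shows "divs z = divs (of_nat (nrm m) * z')"
proof (intro equalityI subsetI)
  define t where "t = nrm m"
  have t: "t > 0" unfolding t_def by (rule nrm_pos[OF m])
  fix a assume az: "a \<in> divs z"
  have a: "a > 0" by (rule divs_pos[OF az])
  obtain v where v: "v \<in> OMap F regular" "x 1 = right_mul F v (d a)"
    using basis_divisors_iff[OF F x a] az by blast
  obtain c k where c: "c \<in> divs z'" and k: "k \<in> carrier M" and vk: "v = right_mul F (y c) k"
    by (rule basis_generates_regular[OF F y v(1)])
  have cpos: "c > 0" by (rule divs_pos[OF c])
  have yc: "y c \<in> OMap F regular" by (rule basis_in[OF F y c])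
  have "right_mul F (y c) (k \<otimes> d a) = right_mul F (y c) (d c \<otimes> m)"
    using right_mul_mult[OF F yc k d_closed[OF a]] right_mul_mult[OF F yc d_closed[OF cpos] m]
      basis_origin[OF F y c] v(2) vk xy by simp
  then have "nrm (k \<otimes> d a) = nrm (d c \<otimes> m)"
    using k m d_closed a cpos by (intro basis_norm_eq[OF F y c]) auto
  then have "nrm k * a = t * c"
    using nrm_mult[OF k d_closed[OF a]] nrm_mult[OF d_closed[OF cpos] m] nrm_d a cpos by (simp add: t_def)
  then have "a dvd t * c" by (metis dvd_triv_right)
  moreover have "t * c \<in> divs (of_nat t * z')" using in_divs_mult_iff[OF t] c by blast
  ultimately show "a \<in> divs (of_nat (nrm m) * z')" using divs_dvd unfolding t_def by blast
next
  define t where "t = nrm m"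
  have t: "t > 0" unfolding t_def by (rule nrm_pos[OF m])
  fix a assume "a \<in> divs (of_nat (nrm m) * z')"
  then have at: "a \<in> divs (of_nat t * z')" by (simp add: t_def)
  have a: "a > 0" by (rule divs_pos[OF at])
  define g where "g = gcd a t"
  have g: "g > 0" using t by (simp add: g_def)
  define a' t' where "a' = a div g" and "t' = t div g"
  have split: "a = a' * g" "t = g * t'" by (simp_all add: a'_def t'_def g_def)
  have pos: "a' > 0" "t' > 0" using a t split by auto
  have a'z: "a' \<in> divs z'" using divs_of_nat_multD[OF at t] by (simp add: a'_def g_def)
  obtain u where u: "u \<in> Units M" "m = u \<otimes> d t" using unit_times_d[OF m] unfolding t_def by blast
  have uM: "u \<in> carrier M" by (rule Units_closed[OF u(1)])
  note dM = d_closed[OF a] d_closed[OF g] d_closed[OF pos(1)] d_closed[OF pos(2)] d_closed[OF t]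
  have au: "d a' \<otimes> u \<in> carrier M" using dM uM by simp
  have "nrm (d a' \<otimes> u) = a'" using nrm_mult[OF dM(3) uM] nrm_d[OF pos(1)] nrm_unit[OF u(1)] by simp
  then obtain u' where u': "u' \<in> Units M" "d a' \<otimes> u = u' \<otimes> d a'" using unit_times_d[OF au] by auto
  have u'M: "u' \<in> carrier M" by (rule Units_closed[OF u'(1)])
  have "a' * t = t' * a" using split by simp
  then have comm: "d a' \<otimes> d t = d t' \<otimes> d a"
    using d_mult[OF pos(1) t] d_mult[OF pos(2) a] by simp
  have "d a' \<otimes> m = (u' \<otimes> d t') \<otimes> d a"
  proof -
    have "d a' \<otimes> m = (d a' \<otimes> u) \<otimes> d t" using u(2) m_assoc[OF dM(3) uM dM(5)] by simp
    also have "\<dots> = u' \<otimes> (d a' \<otimes> d t)" using u'(2) m_assoc[OF u'M dM(3,5)] by simp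
    also have "\<dots> = (u' \<otimes> d t') \<otimes> d a" using comm m_assoc[OF u'M dM(4,1)] by simp
    finally show ?thesis .
  qed
  moreover have ya: "y a' \<in> OMap F regular" "right_mul F (y a') (d a') = y 1"
    using basis_in[OF F y a'z] basis_origin[OF F y a'z] by auto
  moreover have ut: "u' \<otimes> d t' \<in> carrier M" using u'M dM by simp
  ultimately have "x 1 = right_mul F (right_mul F (y a') (u' \<otimes> d t')) (d a)"
    using right_mul_mult[OF F ya(1) dM(3) m] right_mul_mult[OF F ya(1) ut dM(1)] xy by simp
  then show "a \<in> divs z"
    using basis_divisors_iff[OF F x a] right_mul_closed[OF F ya(1) ut] by blast
qed

text \<open>The element \<open>x 1\<close> is a multiple of \<open>x' b\<close> for some divisor \<open>b\<close> of \<open>z'\<close>. Passing from \<open>z'\<close> to its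
quotient by \<open>b\<close> makes \<open>x' b\<close> the reference element, so that the divisor sets can be compared.\<close>

lemma bases_related:
  assumes F: "is_functor MSets Sets F" and x: "germ_basis F z x" and x': "germ_basis F z' x'"
  shows "(z, z') \<in> zhat_rel"
proof -
  have x1: "x 1 \<in> OMap F regular" by (rule basis_in[OF F x one_in_divs(1)])
  obtain b m where b: "b \<in> divs z'" and m: "m \<in> carrier M" and xm: "x 1 = right_mul F (x' b) m"
    by (rule basis_generates_regular[OF F x' x1])
  have bpos: "b > 0" by (rule divs_pos[OF b])
  obtain y where y: "z' = of_nat b * y" using b by (auto simp: divs_def)
  have "germ_basis F y (\<lambda>a. x' (b * a))"
    using basis_divisor_shift[OF F _ bpos] x' unfolding y .
  then have "divs (of_nat (nrm m) * y) = divs z"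
    using basis_change_divisors[OF F x _ m] xm by simp
  then obtain u where u: "u dvd 1" "z = u * (of_nat (nrm m) * y)" by (rule divs_eq_imp_associated)
  have "(z, y) \<in> zhat_rel"
    by (rule zhat_relI[OF zero_less_one nrm_pos[OF m] u(1)]) (use u(2) in simp)
  moreover have "(z', y) \<in> zhat_rel"
    by (rule zhat_relI[OF zero_less_one bpos, of 1]) (use y in simp_all)
  ultimately show ?thesis using equiv_zhat_rel by (meson equivE symD transD)
qed

lemma points_functor: "f \<in> points U M \<Longrightarrow> is_functor MSets Sets (inverse_image f)"
  by (simp add: points_def geometric_morphism_def)

lemma point_class_iff:
  "f \<in> point_class U M d z \<longleftrightarrow> f \<in> points U M \<and> (\<exists>x. germ_basis (inverse_image f) z x)"
  using basis_imp_divisor_colimit divisor_colimit_imp_basis points_functor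
  unfolding point_class_def by blast

lemma point_class_nonempty: "\<exists>f. f \<in> point_class U M d z"
proof -
  let ?F = "germ_functor z"
  obtain G where "is_functor Sets MSets G" "adjoint MSets Sets ?F G"
    by (rule basis_right_adjoint[OF germ_functor germ_functor_basis])
  then have "\<lparr>inverse_image = ?F, direct_image = G\<rparr> \<in> points U M"
    using germ_functor basis_preserves_finite_limits[OF germ_functor germ_functor_basis]
    by (simp add: points_def geometric_morphism_def)
  then show ?thesis
    using germ_functor_basis by (intro exI[of _ "\<lparr>inverse_image = ?F, direct_image = G\<rparr>"])
      (auto simp: point_class_iff)
qed

lemma point_in_point_class:
  assumes "f \<in> points U M"
  shows "\<exists>z. f \<in> point_class U M d z"
proof -
  have F: "is_functor MSets Sets (inverse_image f)" and G: "is_functor Sets MSets (direct_image f)"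
    and adj: "adjoint MSets Sets (inverse_image f) (direct_image f)"
    and lex: "preserves_finite_limits MSets Sets (inverse_image f)"
    using assms by (simp_all add: points_def geometric_morphism_def)
  have "\<exists>z x. germ_basis (inverse_image f) z x"
    by (rule flat_basis[OF F lex left_adjoint_generates[OF F G adj]])
  then show ?thesis using assms by (simp add: point_class_iff)
qed

lemma points_iso_class:
  assumes f: "f \<in> point_class U M d z"
  shows "points_iso U M `` {f} = point_class U M d z"
proof (intro equalityI subsetI)
  have fp: "f \<in> points U M" and "\<exists>x. germ_basis (inverse_image f) z x"
    using f unfolding point_class_iff by blast+
  then obtain x where x: "germ_basis (inverse_image f) z x" by blast
  fix g
  show "g \<in> point_class U M d z" if "g \<in> points_iso U M `` {f}"
  proof -
    have g: "g \<in> points U M" "naturally_isomorphic MSets Sets (inverse_image f) (inverse_image g)"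
      using that by (auto simp: points_iso_def)
    then show ?thesis
      using basis_transport[OF points_functor[OF fp] points_functor[OF g(1)] g(2) x]
      unfolding point_class_iff by blast
  qed
  show "g \<in> points_iso U M `` {f}" if gz: "g \<in> point_class U M d z"
  proof -
    obtain y where g: "g \<in> points U M" "germ_basis (inverse_image g) z y"
      using gz unfolding point_class_iff by blast
    then show ?thesis
      using bases_imp_naturally_isomorphic[OF points_functor[OF fp] points_functor[OF g(1)] x g(2)] fp
      by (simp add: points_iso_def)
  qed
qed

text \<open>For the invariance under multiplication by \<open>n\<close> one inclusion is enough: each class is nonempty and
is a full isomorphism class, so two classes with a common member coincide.\<close>

lemma point_class_eq_iff: "(z, z') \<in> zhat_rel \<longleftrightarrow> point_class U M d z = point_class U M d z'"
proof
  assume "point_class U M d z = point_class U M d z'"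
  moreover obtain f where "f \<in> point_class U M d z" using point_class_nonempty by blast
  ultimately obtain x x' where "f \<in> points U M" "germ_basis (inverse_image f) z x" "germ_basis (inverse_image f) z' x'"
    unfolding point_class_iff by (metis point_class_iff)
  then show "(z, z') \<in> zhat_rel" using bases_related points_functor by blast
next
  assume "(z, z') \<in> zhat_rel"
  then show "point_class U M d z = point_class U M d z'"
  proof (rule zhat_rel_invariant[where h = "point_class U M d"])
    show "point_class U M d (u * z) = point_class U M d z" if "u dvd 1" for u z
      by (auto simp: point_class_iff basis_unit[OF that])
    show "point_class U M d (of_nat n * z) = point_class U M d z" if n: "n > 0" for n z
    proof -
      obtain f where f: "f \<in> point_class U M d (of_nat n * z)" using point_class_nonempty by blast
      then have "f \<in> point_class U M d z"
        using basis_divisor_shift[OF points_functor _ n] unfolding point_class_iff by blast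
      then show ?thesis using points_iso_class f by metis
    qed
  qed
qed

lemma points_classification:
  "\<exists>\<Phi>. bij_betw \<Phi> (UNIV // zhat_rel) (points U M // points_iso U M) \<and>
     (\<forall>z. \<Phi> (zhat_rel `` {z}) = point_class U M d z)"
proof (rule bij_betw_quotient[OF point_class_eq_iff])
  show "range (point_class U M d) = points U M // points_iso U M"
  proof (intro equalityI subsetI)
    fix C assume "C \<in> range (point_class U M d)"
    then obtain z where z: "C = point_class U M d z" by blast
    obtain f where f: "f \<in> point_class U M d z" using point_class_nonempty by blast
    then have "f \<in> points U M" by (simp add: point_class_iff)
    then show "C \<in> points U M // points_iso U M"
      using quotientI[of f "points U M" "points_iso U M"] points_iso_class[OF f] z by simp
  next
    fix C assume "C \<in> points U M // points_iso U M"
    then obtain f where f: "f \<in> points U M" "C = points_iso U M `` {f}" by (rule quotientE)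
    then obtain z where "f \<in> point_class U M d z" using point_in_point_class by blast
    then show "C \<in> range (point_class U M d)" using points_iso_class f(2) by blast
  qed
qed

end

section \<open>The two monoids\<close>

lemma divisibility_monoid_Npos:
  assumes "set_universe U"
  shows "divisibility_monoid Npos U (\<lambda>n. n) (\<lambda>n. n)"
proof -
  interpret monoid Npos by (rule monoid_Npos)
  show ?thesis
  proof
    show "\<exists>u\<in>Units Npos. m = u \<otimes>\<^bsub>Npos\<^esub> m" if "m \<in> carrier Npos" for m
      using that Units_one_closed by (intro bexI[of _ "\<one>\<^bsub>Npos\<^esub>"]) auto
  qed (use assms in \<open>auto simp: Npos_def\<close>)
qed

lemma Pns_carrier_cases:
  assumes "m \<in> carrier Pns"
  obtains a b where "a \<noteq> 0" "m = vector [vector [a, b], vector [0, 1]]"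
  using assms by (auto simp: Pns_def)

lemma Pns_mult:
  "(vector [vector [a, b], vector [0, 1]] :: int^2^2) \<otimes>\<^bsub>Pns\<^esub> vector [vector [c, e], vector [0, 1]] =
     vector [vector [a * c, a * e + b], vector [0, 1]]"
  by (simp add: Pns_def upper_triangular_mult)

lemma affine_matrix_eq_iff:
  "(vector [vector [a, b], vector [0, 1]] :: int^2^2) = vector [vector [c, e], vector [0, 1]] \<longleftrightarrow>
     a = c \<and> b = e"
  by (auto simp: vec_eq_iff forall_2)

lemma divisibility_monoid_Pns:
  assumes U: "set_universe U"
  shows "divisibility_monoid Pns U diag1 (\<lambda>m. nat \<bar>m $ 1 $ 1\<bar>)"
proof -
  interpret monoid Pns by (rule monoid_Pns)
  have one: "\<one>\<^bsub>Pns\<^esub> = vector [vector [1, 0], vector [0, 1]]"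
    by (simp add: Pns_def vec_eq_iff mat_def forall_2)
  have carrier: "vector [vector [a, b], vector [0, 1]] \<in> carrier Pns" if "a \<noteq> 0" for a b
    using that by (auto simp: Pns_def)
  show ?thesis
  proof
    show "set_universe U" by (rule U)
    have "carrier Pns \<subseteq> range (\<lambda>(a, b). vector [vector [a, b], vector [0, 1]])"
      by (auto simp: Pns_def)
    then show "countable (carrier Pns)" by (rule countable_subset) simp
    show "diag1 a \<in> carrier Pns" if "a > 0" for a
      using carrier[of "int a" 0] that by (simp add: diag1_def)
    show "diag1 1 = \<one>\<^bsub>Pns\<^esub>" by (simp add: diag1_def one)
    show "diag1 (a * b) = diag1 a \<otimes>\<^bsub>Pns\<^esub> diag1 b" for a b
      by (simp add: diag1_def Pns_mult)
    show "nat \<bar>m $ 1 $ 1\<bar> > 0" if "m \<in> carrier Pns" for m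
      using that by (auto elim!: Pns_carrier_cases)
    show "nat \<bar>(m \<otimes>\<^bsub>Pns\<^esub> k) $ 1 $ 1\<bar> = nat \<bar>m $ 1 $ 1\<bar> * nat \<bar>k $ 1 $ 1\<bar>"
      if "m \<in> carrier Pns" "k \<in> carrier Pns" for m k
      using that by (auto elim!: Pns_carrier_cases simp: Pns_mult abs_mult nat_mult_distrib)
    show "nat \<bar>diag1 a $ 1 $ 1\<bar> = a" for a by (simp add: diag1_def)
    show "\<exists>u\<in>Units Pns. m = u \<otimes>\<^bsub>Pns\<^esub> diag1 (nat \<bar>m $ 1 $ 1\<bar>)" if mP: "m \<in> carrier Pns" for m
    proof -
      obtain a b where m: "a \<noteq> 0" "m = vector [vector [a, b], vector [0, 1]]"
        using mP by (rule Pns_carrier_cases)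
      \<comment> \<open>\<open>t \<mapsto> a t + b\<close> is the dilation by \<open>\<bar>a\<bar>\<close> followed by the invertible map \<open>t \<mapsto> sgn a t + b\<close>.\<close>
      let ?u = "vector [vector [sgn a, b], vector [0, 1]] :: int^2^2"
      let ?v = "vector [vector [sgn a, - sgn a * b], vector [0, 1]] :: int^2^2"
      have sgn: "sgn a * sgn a = 1" "sgn a \<noteq> 0" using m(1) by (auto simp: sgn_if)
      have "?u \<otimes>\<^bsub>Pns\<^esub> ?v = \<one>\<^bsub>Pns\<^esub>" "?v \<otimes>\<^bsub>Pns\<^esub> ?u = \<one>\<^bsub>Pns\<^esub>"
        using sgn by (simp_all add: Pns_mult one affine_matrix_eq_iff mult.assoc[symmetric])
      then have "?u \<in> Units Pns" unfolding Units_def using carrier[OF sgn(2)] by blast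
      moreover have "m = ?u \<otimes>\<^bsub>Pns\<^esub> diag1 (nat \<bar>m $ 1 $ 1\<bar>)"
        by (simp add: m(2) diag1_def Pns_mult affine_matrix_eq_iff sgn_mult_abs)
      ultimately show ?thesis by blast
    qed
    show "m = k" if a: "a > 0" and mk: "m \<in> carrier Pns" "k \<in> carrier Pns"
        and eq: "m \<otimes>\<^bsub>Pns\<^esub> diag1 a = k \<otimes>\<^bsub>Pns\<^esub> diag1 a" for a m k
    proof -
      obtain p q where m: "m = vector [vector [p, q], vector [0, 1]]" using mk(1) by (rule Pns_carrier_cases)
      obtain r s where k: "k = vector [vector [r, s], vector [0, 1]]" using mk(2) by (rule Pns_carrier_cases)
      show ?thesis using eq a by (simp add: m k diag1_def Pns_mult affine_matrix_eq_iff)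
    qed
  qed
qed

theorem theorem13:
  fixes U :: "'u set set"
  assumes "set_universe U"
  shows
    "(\<exists>\<Theta>. bij_betw \<Theta> (UNIV // zhat_rel) (UNIV // adele_rel) \<and>
          (\<forall>z. \<Theta> (zhat_rel `` {z}) = adele_rel `` {pure_tensor z 1})) \<and>
     (\<exists>\<Phi>. bij_betw \<Phi> (UNIV // zhat_rel) (points U Pns // points_iso U Pns) \<and>
          (\<forall>z. \<Phi> (zhat_rel `` {z}) = point_class U Pns diag1 z)) \<and>
     (\<exists>\<Psi>. bij_betw \<Psi> (points U Pns // points_iso U Pns) (points U Npos // points_iso U Npos) \<and>
          (\<forall>z. \<Psi> (point_class U Pns diag1 z) = point_class U Npos (\<lambda>n. n) z))"
proof -
  obtain \<Phi> where \<Phi>: "bij_betw \<Phi> (UNIV // zhat_rel) (points U Pns // points_iso U Pns)"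
    "\<And>z. \<Phi> (zhat_rel `` {z}) = point_class U Pns diag1 z"
    using divisibility_monoid.points_classification[OF divisibility_monoid_Pns[OF assms]] by blast
  obtain \<Phi>' where \<Phi>': "bij_betw \<Phi>' (UNIV // zhat_rel) (points U Npos // points_iso U Npos)"
    "\<And>z. \<Phi>' (zhat_rel `` {z}) = point_class U Npos (\<lambda>n. n) z"
    using divisibility_monoid.points_classification[OF divisibility_monoid_Npos[OF assms]] by blast
  define \<Psi> where "\<Psi> = \<Phi>' \<circ> inv_into (UNIV // zhat_rel) \<Phi>"
  have "bij_betw \<Psi> (points U Pns // points_iso U Pns) (points U Npos // points_iso U Npos)"
    unfolding \<Psi>_def using bij_betw_trans[OF bij_betw_inv_into[OF \<Phi>(1)] \<Phi>'(1)] .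
  moreover have "\<Psi> (point_class U Pns diag1 z) = point_class U Npos (\<lambda>n. n) z" for z
  proof -
    have "zhat_rel `` {z} \<in> UNIV // zhat_rel" by (rule quotientI) simp
    from bij_betw_inv_into_left[OF \<Phi>(1) this] show ?thesis by (simp add: \<Psi>_def \<Phi>(2) \<Phi>'(2))
  qed
  ultimately show ?thesis using adele_classes \<Phi> by blast
qed

end
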